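(* Let $G=\mathrm{SL}_2\times S$ where $S$ is a torus, and let $X$ be a complete horospherical $G$-variety on which $\mathrm{SL}_2\subset G$ acts nontrivially. Suppose $\mu_1,\mu_2\in\alpha+\Gamma_Z$ are such that $\langle\alpha^\vee,\mu_1\rangle=\langle\alpha^\vee,\mu_2\rangle=1$. Then $[\mathcal K_{\mu_1},\mathcal K_{\mu_2}]=0$.
   Context: The ground field $\mathbb K$ is algebraically closed of characteristic $0$. $B\subset G$ is a Borel subgroup, $T\subset B$ a maximal torus, $B^-$ the opposite Borel subgroup ($B\cap B^-=T$), $U,U^-$ the unipotent radicals of $B,B^-$; $\alpha\in\mathfrak X(T)$ is the unique positive root with respect to $B$ and $\alpha^\vee$ its coroot. Groups act on functions by $(gf)(x)=f(g^{-1}x)$. A horospherical $G$-variety here is a normal irreducible $G$-variety with an open $G$-orbit (then also an open $B$-orbit) such that the stabilizer of a point of the open $G$-orbit contains a maximal unipotent subgroup of $G$; here the open $G$-orbit is isomorphic to $G/H$ with $U^-\subset H\subset B^-$. $X_{\mathcal D}\subset X$ is the open subset obtained by removing all colors ($B$-stable, not $G$-stable prime divisors). The canonical section $Z\subset X_{\mathcal D}$ is the closure in $X_{\mathcal D}$ of the $T$-orbit of a $U^-$-fixed point $x_0$ in the open $G$-orbit; it is a toric $T$-variety, and $\Gamma_Z\subset\mathfrak X(T)$ is the set of weights of $T$-semiinvariant functions in $\mathbb K[Z]$. For $\lambda$ in the weight lattice of $X$ (the set of weights of $B$-semiinvariant rational functions), $f_\lambda$ is the $B$-semiinvariant rational function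 on $X$ of weight $\lambda$ with $f_\lambda(x_0)=1$. $\varepsilon_\alpha$ is the vector field on $X$ coming from the action of $U$. For $\mu\in\alpha+\Gamma_Z$ with $\langle\alpha^\vee,\mu\rangle\ge1$, the vector field $f_{\mu-\alpha}\varepsilon_\alpha$ is regular on the whole $X$, and $\mathcal K_\mu$ denotes the simple $G$-module of vector fields on $X$ with highest weight $\mu$ and highest weight vector $f_{\mu-\alpha}\varepsilon_\alpha$. $[\mathcal K_{\mu_1},\mathcal K_{\mu_2}]$ is the linear span of all brackets of elements of $\mathcal K_{\mu_1}$ and $\mathcal K_{\mu_2}$. *)

theory Defs
  imports
    "HOL-Analysis.Analysis"
    "HOL-Algebra.Group_Action"
    "HOL-Algebra.Solvable_Groups"
    "HOL-Algebra.Product_Groups"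
    "HOL-Computational_Algebra.Polynomial"
    "HOL-Library.Function_Algebras"
begin

section \<open>Varieties as spaces with functions\<close>

text \<open>
  A space with functions carries, for every open set, the ring of regular functions on it.
  A function that is regular on \<open>U\<close> is represented by the total function extending it by \<open>0\<close>
  outside \<open>U\<close>, so that equality of regular functions is equality in HOL.
\<close>

record ('x, 'k) fspace =
  top_of :: "'x topology"
  regular :: "'x set \<Rightarrow> ('x \<Rightarrow> 'k) set"

abbreviation points :: "('x, 'k) fspace \<Rightarrow> 'x set" where
  "points X \<equiv> topspace (top_of X)"

definition cut :: "'x set \<Rightarrow> ('x \<Rightarrow> 'k::zero) \<Rightarrow> 'x \<Rightarrow> 'k" where
  "cut U f = (\<lambda>x. if x \<in> U then f x else 0)"

definition sheaf_of_functions :: "('x, 'k::zero) fspace \<Rightarrow> bool" where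
  "sheaf_of_functions X \<longleftrightarrow>
     (\<forall>U f. openin (top_of X) U \<longrightarrow> f \<in> regular X U \<longrightarrow> cut U f = f) \<and>
     (\<forall>U V f. openin (top_of X) U \<longrightarrow> openin (top_of X) V \<longrightarrow> V \<subseteq> U \<longrightarrow> f \<in> regular X U \<longrightarrow>
        cut V f \<in> regular X V) \<and>
     (\<forall>U f. openin (top_of X) U \<longrightarrow> cut U f = f \<longrightarrow>
        (\<forall>x\<in>U. \<exists>V. openin (top_of X) V \<and> x \<in> V \<and> V \<subseteq> U \<and> cut V f \<in> regular X V) \<longrightarrow>
        f \<in> regular X U)"

definition morphism :: "('x, 'k::zero) fspace \<Rightarrow> ('y, 'k) fspace \<Rightarrow> ('x \<Rightarrow> 'y) \<Rightarrow> bool" where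
  "morphism X Y \<phi> \<longleftrightarrow>
     continuous_map (top_of X) (top_of Y) \<phi> \<and>
     (\<forall>V f. openin (top_of Y) V \<longrightarrow> f \<in> regular Y V \<longrightarrow>
        cut {x \<in> points X. \<phi> x \<in> V} (f \<circ> \<phi>) \<in> regular X {x \<in> points X. \<phi> x \<in> V})"

definition isomorphism :: "('x, 'k::zero) fspace \<Rightarrow> ('y, 'k) fspace \<Rightarrow> ('x \<Rightarrow> 'y) \<Rightarrow> bool" where
  "isomorphism X Y \<phi> \<longleftrightarrow>
     morphism X Y \<phi> \<and>
     (\<exists>\<psi>. morphism Y X \<psi> \<and> (\<forall>x\<in>points X. \<psi> (\<phi> x) = x) \<and> (\<forall>y\<in>points Y. \<phi> (\<psi> y) = y))"

text \<open>The induced structure on a (locally closed) subset.\<close>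

definition subspace_on :: "('x, 'k::zero) fspace \<Rightarrow> 'x set \<Rightarrow> ('x, 'k) fspace" where
  "subspace_on X Y =
     \<lparr>top_of = subtopology (top_of X) Y,
      regular = (\<lambda>U. {f. cut U f = f \<and>
        (\<forall>x\<in>U. \<exists>W h. openin (top_of X) W \<and> x \<in> W \<and> h \<in> regular X W \<and> (\<forall>y\<in>W \<inter> U. f y = h y))})\<rparr>"

inductive_set polyfuns :: "('a \<Rightarrow> 'k::comm_ring_1) set \<Rightarrow> ('a \<Rightarrow> 'k) set"
  for C :: "('a \<Rightarrow> 'k) set" where
  const: "(\<lambda>_. c) \<in> polyfuns C"
| coord: "f \<in> C \<Longrightarrow> f \<in> polyfuns C"
| add: "f \<in> polyfuns C \<Longrightarrow> g \<in> polyfuns C \<Longrightarrow> (\<lambda>x. f x + g x) \<in> polyfuns C"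
| mult: "f \<in> polyfuns C \<Longrightarrow> g \<in> polyfuns C \<Longrightarrow> (\<lambda>x. f x * g x) \<in> polyfuns C"

text \<open>
  The structure induced on a point set \<open>P\<close> by an affine space with coordinate functions \<open>C\<close>:
  the non-vanishing sets of polynomials are a base of the topology, and regular functions are
  locally quotients of polynomials.
\<close>

definition zariski :: "'a set \<Rightarrow> ('a \<Rightarrow> 'k::field) set \<Rightarrow> ('a, 'k) fspace" where
  "zariski P C =
     \<lparr>top_of = topology_generated_by {{x \<in> P. p x \<noteq> 0} | p. p \<in> polyfuns C},
      regular = (\<lambda>U. {f. cut U f = f \<and>
        (\<forall>x\<in>U. \<exists>p\<in>polyfuns C. \<exists>q\<in>polyfuns C. q x \<noteq> 0 \<and> (\<forall>y\<in>U. q y \<noteq> 0 \<longrightarrow> f y = p y / q y))})\<rparr>"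

definition coords :: "nat \<Rightarrow> ((nat \<Rightarrow> 'k) \<Rightarrow> 'k) set" where
  "coords n = (\<lambda>i x. x i) ` {..<n}"

definition affine_variety :: "('x, 'k::field) fspace \<Rightarrow> bool" where
  "affine_variety X \<longleftrightarrow>
     (\<exists>n F \<phi>. F \<subseteq> polyfuns (coords n) \<and>
        isomorphism X (zariski {x \<in> {..<n} \<rightarrow>\<^sub>E UNIV. \<forall>p\<in>F. p x = 0} (coords n)) \<phi>)"

text \<open>
  Products: for regular \<open>f\<^sub>i\<close> on \<open>U\<close> and \<open>g\<^sub>i\<close> on \<open>V\<close>, the non-vanishing sets
  of the functions \<open>\<Sum>i. f\<^sub>i(x) g\<^sub>i(y)\<close> on \<open>U \<times> V\<close> are a base of the
  Zariski topology of \<open>X \<times> Y\<close>, and regular functions are locally quotients of such functions.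
\<close>

definition tensors :: "('x, 'k::field) fspace \<Rightarrow> ('y, 'k) fspace \<Rightarrow> 'x set \<Rightarrow> 'y set \<Rightarrow> ('x \<times> 'y \<Rightarrow> 'k) set" where
  "tensors X Y U V =
     {\<lambda>(x, y). \<Sum>i<n. f i x * g i y | (n::nat) f g.
        \<forall>i<n. f i \<in> regular X U \<and> g i \<in> regular Y V}"

definition prod_space :: "('x, 'k::field) fspace \<Rightarrow> ('y, 'k) fspace \<Rightarrow> ('x \<times> 'y, 'k) fspace" where
  "prod_space X Y =
     \<lparr>top_of = topology_generated_by
        {{z \<in> U \<times> V. h z \<noteq> 0} | U V h.
           openin (top_of X) U \<and> openin (top_of Y) V \<and> h \<in> tensors X Y U V},
      regular = (\<lambda>W. {f. cut W f = f \<and>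
        (\<forall>z\<in>W. \<exists>U V. openin (top_of X) U \<and> openin (top_of Y) V \<and> z \<in> U \<times> V \<and>
           (\<exists>h\<in>tensors X Y U V. \<exists>k\<in>tensors X Y U V. k z \<noteq> 0 \<and>
              (\<forall>w\<in>W \<inter> U \<times> V. k w \<noteq> 0 \<longrightarrow> f w = h w / k w)))})\<rparr>"

definition variety :: "('x, 'k::field) fspace \<Rightarrow> bool" where
  "variety X \<longleftrightarrow>
     sheaf_of_functions X \<and>
     (\<exists>\<U>. finite \<U> \<and> \<Union>\<U> = points X \<and>
        (\<forall>U\<in>\<U>. openin (top_of X) U \<and> affine_variety (subspace_on X U))) \<and>
     closedin (top_of (prod_space X X)) {(x, x) | x. x \<in> points X}"

definition irreducible_in :: "'x topology \<Rightarrow> 'x set \<Rightarrow> bool" where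
  "irreducible_in T Y \<longleftrightarrow>
     Y \<noteq> {} \<and> Y \<subseteq> topspace T \<and>
     (\<forall>C D. closedin T C \<longrightarrow> closedin T D \<longrightarrow> Y \<subseteq> C \<union> D \<longrightarrow> Y \<subseteq> C \<or> Y \<subseteq> D)"

text \<open>
  Normality of an irreducible variety: every local ring is integrally closed in the function
  field. The pair \<open>(V, f)\<close> represents a rational function, the coefficients \<open>a i\<close> and the function
  \<open>g\<close> represent germs at \<open>x\<close>.
\<close>

definition normal_variety :: "('x, 'k::field) fspace \<Rightarrow> bool" where
  "normal_variety X \<longleftrightarrow>
     (\<forall>x\<in>points X. \<forall>U V f (n::nat) a.
        openin (top_of X) U \<longrightarrow> x \<in> U \<longrightarrow> (\<forall>i<n. a i \<in> regular X U) \<longrightarrow>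
        openin (top_of X) V \<longrightarrow> V \<noteq> {} \<longrightarrow> f \<in> regular X V \<longrightarrow>
        (\<forall>y\<in>U \<inter> V. f y ^ n + (\<Sum>i<n. a i y * f y ^ i) = 0) \<longrightarrow>
        (\<exists>W g. openin (top_of X) W \<and> x \<in> W \<and> g \<in> regular X W \<and> (\<forall>y\<in>W \<inter> V. g y = f y)))"

text \<open>
  Every variety has at most as many points as the ground field, hence is isomorphic to one
  whose points have type \<^typ>\<open>nat \<Rightarrow> 'k\<close>; so the quantifier over \<open>Y\<close> ranges over all
  varieties.
\<close>

definition complete_variety :: "('x, 'k::field) fspace \<Rightarrow> bool" where
  "complete_variety X \<longleftrightarrow>
     (\<forall>Y :: (nat \<Rightarrow> 'k, 'k) fspace. variety Y \<longrightarrow>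
        (\<forall>Z. closedin (top_of (prod_space X Y)) Z \<longrightarrow> closedin (top_of Y) (snd ` Z)))"

text \<open>Codimension one: no irreducible closed subset lies strictly between \<open>D\<close> and \<open>X\<close>.\<close>

definition prime_divisor :: "('x, 'k) fspace \<Rightarrow> 'x set \<Rightarrow> bool" where
  "prime_divisor X D \<longleftrightarrow>
     closedin (top_of X) D \<and> irreducible_in (top_of X) D \<and> D \<noteq> points X \<and>
     (\<forall>E. closedin (top_of X) E \<longrightarrow> irreducible_in (top_of X) E \<longrightarrow> D \<subseteq> E \<longrightarrow> E = D \<or> E = points X)"


section \<open>Algebraic groups\<close>

definition algebraic_group :: "'g monoid \<Rightarrow> ('g, 'k::field) fspace \<Rightarrow> bool" where
  "algebraic_group G VG \<longleftrightarrow>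
     group G \<and> variety VG \<and> points VG = carrier G \<and>
     morphism (prod_space VG VG) VG (\<lambda>(x, y). x \<otimes>\<^bsub>G\<^esub> y) \<and>
     morphism VG VG (\<lambda>x. inv\<^bsub>G\<^esub> x)"

definition alg_group_iso ::
  "'g monoid \<Rightarrow> ('g, 'k::zero) fspace \<Rightarrow> 'h monoid \<Rightarrow> ('h, 'k) fspace \<Rightarrow> ('g \<Rightarrow> 'h) \<Rightarrow> bool" where
  "alg_group_iso G VG H VH \<phi> \<longleftrightarrow> \<phi> \<in> iso G H \<and> isomorphism VG VH \<phi>"

definition Ga :: "'k::field monoid" where
  "Ga = \<lparr>carrier = UNIV, mult = (+), one = 0\<rparr>"

definition Ga_var :: "('k, 'k::field) fspace" where
  "Ga_var = zariski UNIV {\<lambda>x. x}"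

definition Gm :: "'k::field monoid" where
  "Gm = \<lparr>carrier = UNIV - {0}, mult = (*), one = 1\<rparr>"

definition Gm_var :: "('k, 'k::field) fspace" where
  "Gm_var = zariski (UNIV - {0}) {\<lambda>x. x}"

abbreviation Gm_pow :: "nat \<Rightarrow> (nat \<Rightarrow> 'k::field) monoid" where
  "Gm_pow r \<equiv> product_group {..<r} (\<lambda>_. Gm)"

definition Gm_pow_var :: "nat \<Rightarrow> (nat \<Rightarrow> 'k, 'k::field) fspace" where
  "Gm_pow_var r = zariski ({..<r} \<rightarrow>\<^sub>E (UNIV - {0})) (coords r)"

definition torus :: "'g monoid \<Rightarrow> ('g, 'k::field) fspace \<Rightarrow> bool" where
  "torus S VS \<longleftrightarrow>
     algebraic_group S VS \<and> (\<exists>r \<phi>. alg_group_iso (Gm_pow r) (Gm_pow_var r) S VS \<phi>)"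

definition SL2 :: "('k::field^2^2) monoid" where
  "SL2 = \<lparr>carrier = {A. det A = 1}, mult = (**), one = mat 1\<rparr>"

definition SL2_var :: "('k::field^2^2, 'k) fspace" where
  "SL2_var = zariski {A. det A = 1} {(\<lambda>A. A $ i $ j) | i j. True}"

abbreviation restrict_group :: "'g monoid \<Rightarrow> 'g set \<Rightarrow> 'g monoid" where
  "restrict_group G H \<equiv> G\<lparr>carrier := H\<rparr>"

definition closed_subgroup :: "'g monoid \<Rightarrow> ('g, 'k) fspace \<Rightarrow> 'g set \<Rightarrow> bool" where
  "closed_subgroup G VG H \<longleftrightarrow> subgroup H G \<and> closedin (top_of VG) H"

definition connected_solvable_subgroup :: "'g monoid \<Rightarrow> ('g, 'k) fspace \<Rightarrow> 'g set \<Rightarrow> bool" where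
  "connected_solvable_subgroup G VG H \<longleftrightarrow>
     closed_subgroup G VG H \<and> connectedin (top_of VG) H \<and> solvable (restrict_group G H)"

definition borel_subgroup :: "'g monoid \<Rightarrow> ('g, 'k) fspace \<Rightarrow> 'g set \<Rightarrow> bool" where
  "borel_subgroup G VG B \<longleftrightarrow>
     connected_solvable_subgroup G VG B \<and>
     (\<forall>H. connected_solvable_subgroup G VG H \<longrightarrow> B \<subseteq> H \<longrightarrow> H = B)"

definition subtorus :: "'g monoid \<Rightarrow> ('g, 'k::field) fspace \<Rightarrow> 'g set \<Rightarrow> bool" where
  "subtorus G VG T \<longleftrightarrow> closed_subgroup G VG T \<and> torus (restrict_group G T) (subspace_on VG T)"

definition maximal_torus :: "'g monoid \<Rightarrow> ('g, 'k::field) fspace \<Rightarrow> 'g set \<Rightarrow> bool" where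
  "maximal_torus G VG T \<longleftrightarrow>
     subtorus G VG T \<and> (\<forall>T'. subtorus G VG T' \<longrightarrow> T \<subseteq> T' \<longrightarrow> T' = T)"

text \<open>
  Unipotent elements of \<open>SL2 \<times> S\<close> for a torus \<open>S\<close>: since \<open>S\<close> is a group of diagonal
  matrices, the second component has to be trivial. Matrix products on \<open>'k^2^2\<close> are \<open>**\<close>,
  whence the iteration instead of a power.
\<close>

definition unipotent :: "'s monoid \<Rightarrow> (('k::field)^2^2) \<times> 's \<Rightarrow> bool" where
  "unipotent S g \<longleftrightarrow>
     (\<exists>n. (((**) (fst g - mat 1)) ^^ n) (mat 1) = 0) \<and> snd g = \<one>\<^bsub>S\<^esub>"

definition unipotent_subgroup ::
  "'s monoid \<Rightarrow> ('s, 'k::field) fspace \<Rightarrow> (('k^2^2) \<times> 's) set \<Rightarrow> bool" where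
  "unipotent_subgroup S VS N \<longleftrightarrow>
     closed_subgroup (SL2 \<times>\<times> S) (prod_space SL2_var VS) N \<and> (\<forall>g\<in>N. unipotent S g)"

definition maximal_unipotent_subgroup ::
  "'s monoid \<Rightarrow> ('s, 'k::field) fspace \<Rightarrow> (('k^2^2) \<times> 's) set \<Rightarrow> bool" where
  "maximal_unipotent_subgroup S VS N \<longleftrightarrow>
     unipotent_subgroup S VS N \<and> (\<forall>M. unipotent_subgroup S VS M \<longrightarrow> N \<subseteq> M \<longrightarrow> M = N)"

definition connected_normal_unipotent ::
  "'s monoid \<Rightarrow> ('s, 'k::field) fspace \<Rightarrow> (('k^2^2) \<times> 's) set \<Rightarrow> (('k^2^2) \<times> 's) set \<Rightarrow> bool" where
  "connected_normal_unipotent S VS H N \<longleftrightarrow>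
     unipotent_subgroup S VS N \<and> connectedin (top_of (prod_space SL2_var VS)) N \<and>
     N \<lhd> restrict_group (SL2 \<times>\<times> S) H"

definition unipotent_radical ::
  "'s monoid \<Rightarrow> ('s, 'k::field) fspace \<Rightarrow> (('k^2^2) \<times> 's) set \<Rightarrow> (('k^2^2) \<times> 's) set \<Rightarrow> bool" where
  "unipotent_radical S VS H U \<longleftrightarrow>
     connected_normal_unipotent S VS H U \<and>
     (\<forall>N. connected_normal_unipotent S VS H N \<longrightarrow> N \<subseteq> U)"

text \<open>
  Characters and cocharacters are written multiplicatively: a sum of characters is the pointwise
  product of functions on \<open>T\<close>.
\<close>

definition character :: "'g monoid \<Rightarrow> ('g, 'k::field) fspace \<Rightarrow> 'g set \<Rightarrow> ('g \<Rightarrow> 'k) \<Rightarrow> bool" where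
  "character G VG T \<xi> \<longleftrightarrow>
     \<xi> \<in> hom (restrict_group G T) Gm \<and> morphism (subspace_on VG T) Gm_var \<xi>"

definition cocharacter :: "'g monoid \<Rightarrow> ('g, 'k::field) fspace \<Rightarrow> 'g set \<Rightarrow> ('k \<Rightarrow> 'g) \<Rightarrow> bool" where
  "cocharacter G VG T \<gamma> \<longleftrightarrow>
     \<gamma> \<in> hom Gm (restrict_group G T) \<and> morphism Gm_var (subspace_on VG T) \<gamma>"

text \<open>The pairing \<open>\<langle>\<gamma>, \<xi>\<rangle> = n\<close>.\<close>

definition has_pairing :: "('k::field \<Rightarrow> 'g) \<Rightarrow> ('g \<Rightarrow> 'k) \<Rightarrow> int \<Rightarrow> bool" where
  "has_pairing \<gamma> \<xi> n \<longleftrightarrow> (\<forall>c. c \<noteq> 0 \<longrightarrow> \<xi> (\<gamma> c) = c powi n)"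

text \<open>
  When \<open>U\<close> is one-dimensional, \<open>\<alpha>\<close> is the weight of \<open>T\<close> on its Lie algebra, and \<open>u\<close>
  parametrizes \<open>U\<close> (uniquely up to rescaling the parameter).
\<close>

definition root_parametrization ::
  "'g monoid \<Rightarrow> ('g, 'k::field) fspace \<Rightarrow> 'g set \<Rightarrow> 'g set \<Rightarrow> ('g \<Rightarrow> 'k) \<Rightarrow> ('k \<Rightarrow> 'g) \<Rightarrow> bool" where
  "root_parametrization G VG T U \<alpha> u \<longleftrightarrow>
     character G VG T \<alpha> \<and>
     alg_group_iso Ga Ga_var (restrict_group G U) (subspace_on VG U) u \<and>
     (\<forall>t\<in>T. \<forall>a. t \<otimes>\<^bsub>G\<^esub> u a \<otimes>\<^bsub>G\<^esub> inv\<^bsub>G\<^esub> t = u (\<alpha> t * a))"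

text \<open>The coroot of \<open>\<alpha>\<close> for a group of semisimple rank one.\<close>

definition coroot ::
  "'g monoid \<Rightarrow> ('g, 'k::field) fspace \<Rightarrow> 'g set \<Rightarrow> ('g \<Rightarrow> 'k) \<Rightarrow> ('k \<Rightarrow> 'g) \<Rightarrow> bool" where
  "coroot G VG T \<alpha> \<gamma> \<longleftrightarrow>
     cocharacter G VG T \<gamma> \<and> (\<forall>c. c \<noteq> 0 \<longrightarrow> \<gamma> c \<in> derived G (carrier G)) \<and> has_pairing \<gamma> \<alpha> 2"


section \<open>Varieties with a group action\<close>

definition algebraic_action ::
  "'g monoid \<Rightarrow> ('g, 'k::field) fspace \<Rightarrow> ('x, 'k) fspace \<Rightarrow> ('g \<Rightarrow> 'x \<Rightarrow> 'x) \<Rightarrow> bool" where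
  "algebraic_action G VG X act \<longleftrightarrow>
     group_action G (points X) act \<and> morphism (prod_space VG X) X (\<lambda>(g, x). act g x)"

definition horospherical ::
  "'s monoid \<Rightarrow> ('s, 'k::field) fspace \<Rightarrow> ('x, 'k) fspace \<Rightarrow> (('k^2^2) \<times> 's \<Rightarrow> 'x \<Rightarrow> 'x) \<Rightarrow> bool" where
  "horospherical S VS X act \<longleftrightarrow>
     variety X \<and> irreducible_in (top_of X) (points X) \<and> normal_variety X \<and>
     algebraic_action (SL2 \<times>\<times> S) (prod_space SL2_var VS) X act \<and>
     (\<exists>x\<in>points X. openin (top_of X) (orbit (SL2 \<times>\<times> S) act x) \<and>
        (\<exists>N. maximal_unipotent_subgroup S VS N \<and> N \<subseteq> stabilizer (SL2 \<times>\<times> S) act x))"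

definition stable_under :: "'g set \<Rightarrow> ('g \<Rightarrow> 'x \<Rightarrow> 'x) \<Rightarrow> 'x set \<Rightarrow> bool" where
  "stable_under H act D \<longleftrightarrow> (\<forall>h\<in>H. \<forall>x\<in>D. act h x \<in> D)"

definition colors ::
  "'g monoid \<Rightarrow> 'g set \<Rightarrow> ('x, 'k) fspace \<Rightarrow> ('g \<Rightarrow> 'x \<Rightarrow> 'x) \<Rightarrow> 'x set set" where
  "colors G B X act =
     {D. prime_divisor X D \<and> stable_under B act D \<and> \<not> stable_under (carrier G) act D}"

definition minus_colors ::
  "'g monoid \<Rightarrow> 'g set \<Rightarrow> ('x, 'k) fspace \<Rightarrow> ('g \<Rightarrow> 'x \<Rightarrow> 'x) \<Rightarrow> 'x set" where
  "minus_colors G B X act = points X - \<Union>(colors G B X act)"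

definition canonical_section ::
  "'g monoid \<Rightarrow> 'g set \<Rightarrow> 'g set \<Rightarrow> ('x, 'k) fspace \<Rightarrow> ('g \<Rightarrow> 'x \<Rightarrow> 'x) \<Rightarrow> 'x \<Rightarrow> 'x set" where
  "canonical_section G B T X act x\<^sub>0 =
     (subtopology (top_of X) (minus_colors G B X act)) closure_of {act t x\<^sub>0 | t. t \<in> T}"

text \<open>\<open>\<Gamma>\<^sub>Z\<close>: the weights of \<open>T\<close> on \<open>K[Z]\<close>, for the action \<open>(t f)(z) = f(t\<^sup>-\<^sup>1 z)\<close>.\<close>

definition weights_of ::
  "'g monoid \<Rightarrow> ('g, 'k::field) fspace \<Rightarrow> 'g set \<Rightarrow> ('x, 'k) fspace \<Rightarrow> ('g \<Rightarrow> 'x \<Rightarrow> 'x) \<Rightarrow> 'x set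
     \<Rightarrow> ('g \<Rightarrow> 'k) set" where
  "weights_of G VG T X act Z =
     {\<xi>. character G VG T \<xi> \<and>
        (\<exists>f\<in>regular (subspace_on X Z) Z. (\<exists>z\<in>Z. f z \<noteq> 0) \<and>
           (\<forall>t\<in>T. \<forall>z\<in>Z. f (act (inv\<^bsub>G\<^esub> t) z) = \<xi> t * f z))}"

text \<open>
  The rational function on \<open>X\<close> represented by the regular function \<open>f\<close> on the non-empty open set
  \<open>W\<close> is \<open>B\<close>-semiinvariant of weight \<open>\<xi>\<close>, where \<open>B = T U\<close> and \<open>\<xi>\<close> is extended to \<open>B\<close>
  trivially on \<open>U\<close>.
\<close>

definition rational_semiinvariant ::
  "'g monoid \<Rightarrow> 'g set \<Rightarrow> 'g set \<Rightarrow> ('x, 'k::field) fspace \<Rightarrow> ('g \<Rightarrow> 'x \<Rightarrow> 'x) \<Rightarrow> ('g \<Rightarrow> 'k)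
     \<Rightarrow> 'x set \<Rightarrow> ('x \<Rightarrow> 'k) \<Rightarrow> bool" where
  "rational_semiinvariant G T U X act \<xi> W f \<longleftrightarrow>
     openin (top_of X) W \<and> W \<noteq> {} \<and> f \<in> regular X W \<and>
     (\<forall>t\<in>T. \<forall>v\<in>U. \<forall>x\<in>W. act (inv\<^bsub>G\<^esub> (t \<otimes>\<^bsub>G\<^esub> v)) x \<in> W \<longrightarrow>
        f (act (inv\<^bsub>G\<^esub> (t \<otimes>\<^bsub>G\<^esub> v)) x) = \<xi> t * f x)"


section \<open>Vector fields\<close>

text \<open>
  A vector field is a derivation of the structure sheaf. It is represented by a function that is
  \<open>0\<close> on irrelevant arguments, so that the pointwise operations are the vector space operations.
\<close>

type_synonym ('x, 'k) vfield = "'x set \<Rightarrow> ('x \<Rightarrow> 'k) \<Rightarrow> 'x \<Rightarrow> 'k"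

definition vscale :: "'k::field \<Rightarrow> ('x, 'k) vfield \<Rightarrow> ('x, 'k) vfield" where
  "vscale c D = (\<lambda>U f x. c * D U f x)"

lemma vector_space_vscale: "vector_space (vscale :: 'k::field \<Rightarrow> ('x, 'k) vfield \<Rightarrow> _)"
  by unfold_locales (auto simp: vscale_def fun_eq_iff algebra_simps)

definition vector_fields :: "('x, 'k::field) fspace \<Rightarrow> ('x, 'k) vfield set" where
  "vector_fields X = {D.
     (\<forall>U f. \<not> (openin (top_of X) U \<and> f \<in> regular X U) \<longrightarrow> D U f = 0) \<and>
     (\<forall>U. openin (top_of X) U \<longrightarrow>
        (\<forall>f\<in>regular X U. D U f \<in> regular X U \<and>
           (\<forall>c. D U (\<lambda>x. c * f x) = (\<lambda>x. c * D U f x)) \<and>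
           (\<forall>g\<in>regular X U.
              D U (\<lambda>x. f x + g x) = (\<lambda>x. D U f x + D U g x) \<and>
              D U (\<lambda>x. f x * g x) = (\<lambda>x. f x * D U g x + g x * D U f x)) \<and>
           (\<forall>V. openin (top_of X) V \<longrightarrow> V \<subseteq> U \<longrightarrow> D V (cut V f) = cut V (D U f))))}"

definition lie_bracket :: "('x, 'k::field) vfield \<Rightarrow> ('x, 'k) vfield \<Rightarrow> ('x, 'k) vfield" where
  "lie_bracket D E = (\<lambda>U f x. D U (E U f) x - E U (D U f) x)"

definition bracket_span ::
  "('x, 'k::field) vfield set \<Rightarrow> ('x, 'k) vfield set \<Rightarrow> ('x, 'k) vfield set" where
  "bracket_span K L = module.span vscale {lie_bracket D E | D E. D \<in> K \<and> E \<in> L}"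

text \<open>\<open>g D = g \<circ> D \<circ> g\<^sup>-\<^sup>1\<close>, where \<open>(g f)(x) = f(g\<^sup>-\<^sup>1 x)\<close>.\<close>

definition act_vfield ::
  "'g monoid \<Rightarrow> ('x, 'k::field) fspace \<Rightarrow> ('g \<Rightarrow> 'x \<Rightarrow> 'x) \<Rightarrow> 'g \<Rightarrow> ('x, 'k) vfield \<Rightarrow> ('x, 'k) vfield" where
  "act_vfield G X act g D = (\<lambda>U f x.
     if openin (top_of X) U \<and> f \<in> regular X U \<and> x \<in> U
     then D (act (inv\<^bsub>G\<^esub> g) ` U) (cut (act (inv\<^bsub>G\<^esub> g) ` U) (\<lambda>y. f (act g y))) (act (inv\<^bsub>G\<^esub> g) x)
     else 0)"

definition G_submodule ::
  "'g monoid \<Rightarrow> ('x, 'k::field) fspace \<Rightarrow> ('g \<Rightarrow> 'x \<Rightarrow> 'x) \<Rightarrow> ('x, 'k) vfield set \<Rightarrow> bool" where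
  "G_submodule G X act K \<longleftrightarrow>
     K \<subseteq> vector_fields X \<and> module.subspace vscale K \<and>
     (\<forall>g\<in>carrier G. \<forall>D\<in>K. act_vfield G X act g D \<in> K)"

definition simple_G_submodule ::
  "'g monoid \<Rightarrow> ('x, 'k::field) fspace \<Rightarrow> ('g \<Rightarrow> 'x \<Rightarrow> 'x) \<Rightarrow> ('x, 'k) vfield set \<Rightarrow> bool" where
  "simple_G_submodule G X act K \<longleftrightarrow>
     G_submodule G X act K \<and> K \<noteq> {0} \<and>
     (\<forall>L. G_submodule G X act L \<longrightarrow> L \<subseteq> K \<longrightarrow> L = {0} \<or> L = K)"

text \<open>
  The derivative at \<open>0\<close> of a function of one variable that is regular near \<open>0\<close>, i.e. agrees with
  a quotient \<open>p / q\<close> of polynomials outside a finite set not containing \<open>0\<close>.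
\<close>

definition has_deriv_at_0 :: "('k::field \<Rightarrow> 'k) \<Rightarrow> 'k \<Rightarrow> bool" where
  "has_deriv_at_0 h d \<longleftrightarrow>
     (\<exists>p q N. finite N \<and> 0 \<notin> N \<and> (\<forall>a. a \<notin> N \<longrightarrow> poly q a \<noteq> 0 \<and> h a = poly p a / poly q a) \<and>
        d = (poly (pderiv p) 0 * poly q 0 - poly p 0 * poly (pderiv q) 0) / (poly q 0)\<^sup>2)"

text \<open>
  The vector field of the infinitesimal action of the one-parameter group \<open>u\<close>:
  \<open>(\<epsilon> f)(x)\<close> is the derivative at \<open>a = 0\<close> of \<open>(u(a) f)(x) = f(u(a)\<^sup>-\<^sup>1 x)\<close>.
\<close>

definition infinitesimal_action ::
  "'g monoid \<Rightarrow> ('x, 'k::field) fspace \<Rightarrow> ('g \<Rightarrow> 'x \<Rightarrow> 'x) \<Rightarrow> ('k \<Rightarrow> 'g) \<Rightarrow> ('x, 'k) vfield" where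
  "infinitesimal_action G X act u = (\<lambda>U f x.
     if openin (top_of X) U \<and> f \<in> regular X U \<and> x \<in> U
     then THE d. has_deriv_at_0 (\<lambda>a. f (act (inv\<^bsub>G\<^esub> (u a)) x)) d
     else 0)"

text \<open>
  \<open>D\<close> is the vector field \<open>\<phi> \<epsilon>\<close> for the rational function \<open>\<phi>\<close> represented on \<open>W\<close>;
  on an irreducible variety \<open>D\<close> is determined by its restriction to \<open>W\<close>.
\<close>

definition rational_multiple ::
  "('x, 'k::field) fspace \<Rightarrow> 'x set \<Rightarrow> ('x \<Rightarrow> 'k) \<Rightarrow> ('x, 'k) vfield \<Rightarrow> ('x, 'k) vfield \<Rightarrow> bool" where
  "rational_multiple X W \<phi> \<epsilon> D \<longleftrightarrow>
     (\<forall>V f. openin (top_of X) V \<longrightarrow> V \<subseteq> W \<longrightarrow> f \<in> regular X V \<longrightarrow>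
        D V f = (\<lambda>x. \<phi> x * \<epsilon> V f x))"

definition highest_weight_vector ::
  "'g monoid \<Rightarrow> 'g set \<Rightarrow> 'g set \<Rightarrow> ('x, 'k::field) fspace \<Rightarrow> ('g \<Rightarrow> 'x \<Rightarrow> 'x) \<Rightarrow> ('g \<Rightarrow> 'k)
     \<Rightarrow> ('x, 'k) vfield \<Rightarrow> bool" where
  "highest_weight_vector G T U X act \<mu> D \<longleftrightarrow>
     D \<noteq> 0 \<and>
     (\<forall>t\<in>T. \<forall>v\<in>U. act_vfield G X act (t \<otimes>\<^bsub>G\<^esub> v) D = vscale (\<mu> t) D)"

text \<open>
  \<open>K\<close> is the simple \<open>G\<close>-module of vector fields with highest weight \<open>\<mu>\<close> and highest weight
  vector \<open>f\<^bsub>\<mu> - \<alpha>\<^esub> \<epsilon>\<^sub>\<alpha>\<close>, where \<open>f\<^bsub>\<mu> - \<alpha>\<^esub>\<close> is normalized by its value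
  \<open>1\<close> at \<open>x\<^sub>0\<close>.
\<close>

definition is_module_K ::
  "'g monoid \<Rightarrow> 'g set \<Rightarrow> 'g set \<Rightarrow> ('x, 'k::field) fspace \<Rightarrow> ('g \<Rightarrow> 'x \<Rightarrow> 'x) \<Rightarrow> 'x
     \<Rightarrow> ('g \<Rightarrow> 'k) \<Rightarrow> ('k \<Rightarrow> 'g) \<Rightarrow> ('g \<Rightarrow> 'k) \<Rightarrow> ('x, 'k) vfield set \<Rightarrow> bool" where
  "is_module_K G T U X act x\<^sub>0 \<alpha> u \<mu> K \<longleftrightarrow>
     simple_G_submodule G X act K \<and>
     (\<exists>W f D. rational_semiinvariant G T U X act (\<lambda>t. \<mu> t / \<alpha> t) W f \<and> x\<^sub>0 \<in> W \<and> f x\<^sub>0 = 1 \<and>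
        rational_multiple X W f (infinitesimal_action G X act u) D \<and>
        D \<in> K \<and> highest_weight_vector G T U X act \<mu> D)"

end

theory Submission
  imports Defs
begin

text \<open>The group \<open>SL2\<close> modulo a maximal unipotent subgroup is the punctured plane, and on the plane every
\<open>\<K>\<^sub>\<mu>\<close> of the theorem consists of constant vector fields; the brackets vanish because partial
derivatives commute.

In detail, choose a basis of the plane in which the root subgroup is \<open>u(a) = (1 a; 0 1)\<close> and the coroot is
\<open>c \<mapsto> diag(c, 1/c)\<close> (\<open>root_subgroup_normal_form\<close>). In this basis the opposite Borel subgroup is the
product of the lower triangular matrices and \<open>S\<close>, so \<open>x\<^sub>0\<close> is fixed by all \<open>(1 0; b 1)\<close>
(\<open>lower_unipotent_in_opposite_radical\<close>). Hence for each \<open>s\<close> in the torus \<open>S\<close> the point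
\<open>(A, s) x\<^sub>0\<close> depends only on the second column \<open>p\<close> of \<open>A\<close>. This gives regular
maps \<open>p \<mapsto> orb s p\<close> from the punctured plane, equivariant under \<open>SL2\<close>, whose images together
form the open orbit.

Along such a map \<open>\<epsilon>\<^sub>\<alpha>\<close> becomes \<open>- p\<^sub>2 \<partial>\<^sub>1\<close>, and as \<open>\<mu> - \<alpha>\<close> has pairing
\<open>1 - 2 = -1\<close> with the coroot, semiinvariance forces \<open>f\<^bsub>\<mu> - \<alpha>\<^esub>\<close> to be, along the map, a constant multiple of
\<open>1 / p\<^sub>2\<close> (\<open>semiinvariant_on_orbit\<close>). So the highest weight vector is a constant multiple of
\<open>\<partial>\<^sub>1\<close>, and its translate by \<open>(Q, t)\<close> is a constant multiple of the derivative in the direction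
\<open>Q e\<^sub>1\<close> (\<open>highest_weight_constant_on_plane\<close>, \<open>constant_on_plane_translate\<close>). Two such
fields commute at the points of the open orbit (\<open>constant_fields_commute\<close>), hence everywhere, since \<open>X\<close>
is irreducible. Thus one highest weight vector commutes with all translates of the other, and simplicity of the two
modules extends this to all their elements (\<open>simple_submodules_commute\<close>).\<close>

section \<open>Spaces with functions\<close>

text \<open>The usual axioms of a space with functions: a sheaf of algebras in which a function is invertible on the set where it
does not vanish, and this set is open. They are what it takes to map a space into a product, and unlike affineness
they can be checked locally.\<close>

definition function_space :: "('x, 'k::field) fspace \<Rightarrow> bool" where
  "function_space X \<longleftrightarrow>
     sheaf_of_functions X \<and>
     (\<forall>U. openin (top_of X) U \<longrightarrow>
        (\<forall>c. cut U (\<lambda>_. c) \<in> regular X U) \<and>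
        (\<forall>f\<in>regular X U.
           openin (top_of X) {x\<in>U. f x \<noteq> 0} \<and>
           (\<lambda>x. inverse (f x)) \<in> regular X {x\<in>U. f x \<noteq> 0} \<and>
           (\<forall>g\<in>regular X U. (\<lambda>x. f x + g x) \<in> regular X U \<and> (\<lambda>x. f x * g x) \<in> regular X U)))"

lemma cut_cut: "cut U (cut V f) = cut (U \<inter> V) f"
  by (auto simp: cut_def)

lemma cut_cut_subset: "U \<subseteq> V \<Longrightarrow> cut U (cut V f) = cut U f"
  by (auto simp: cut_def fun_eq_iff)

lemma cut_cong: "(\<And>x. x \<in> U \<Longrightarrow> f x = g x) \<Longrightarrow> cut U f = cut U g"
  by (auto simp: cut_def)

lemma cut_apply: "x \<in> U \<Longrightarrow> cut U f x = f x"
  by (auto simp: cut_def)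

lemma sheaf_cut: "sheaf_of_functions X \<Longrightarrow> openin (top_of X) U \<Longrightarrow> f \<in> regular X U \<Longrightarrow> cut U f = f"
  by (auto simp: sheaf_of_functions_def)

lemma sheaf_outside:
  "sheaf_of_functions X \<Longrightarrow> openin (top_of X) U \<Longrightarrow> f \<in> regular X U \<Longrightarrow> x \<notin> U \<Longrightarrow> f x = 0"
  by (metis cut_def sheaf_cut)

lemma sheaf_restrict:
  "sheaf_of_functions X \<Longrightarrow> openin (top_of X) U \<Longrightarrow> openin (top_of X) V \<Longrightarrow> V \<subseteq> U \<Longrightarrow>
     f \<in> regular X U \<Longrightarrow> cut V f \<in> regular X V"
  by (auto simp: sheaf_of_functions_def)

lemma sheaf_glue:
  assumes "sheaf_of_functions X" "openin (top_of X) U" "cut U f = f"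
    "\<And>x. x \<in> U \<Longrightarrow> \<exists>V. openin (top_of X) V \<and> x \<in> V \<and> V \<subseteq> U \<and> cut V f \<in> regular X V"
  shows "f \<in> regular X U"
proof -
  have "\<forall>U f. openin (top_of X) U \<longrightarrow> cut U f = f \<longrightarrow>
        (\<forall>x\<in>U. \<exists>V. openin (top_of X) V \<and> x \<in> V \<and> V \<subseteq> U \<and> cut V f \<in> regular X V) \<longrightarrow>
        f \<in> regular X U"
    by (rule conjunct2[OF conjunct2[OF assms(1)[unfolded sheaf_of_functions_def]]])
  then show ?thesis using assms(2-4) by simp
qed

lemma function_space_sheaf: "function_space X \<Longrightarrow> sheaf_of_functions X"
  by (simp add: function_space_def)

lemma regular_const: "function_space X \<Longrightarrow> openin (top_of X) U \<Longrightarrow> cut U (\<lambda>_. c) \<in> regular X U"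
  by (simp add: function_space_def)

lemma regular_zero: "function_space X \<Longrightarrow> openin (top_of X) U \<Longrightarrow> (\<lambda>_. 0) \<in> regular X U"
  using regular_const[of X U 0] by (simp add: cut_def cong: if_cong)

lemma regular_add:
  "function_space X \<Longrightarrow> openin (top_of X) U \<Longrightarrow> f \<in> regular X U \<Longrightarrow> g \<in> regular X U \<Longrightarrow>
     (\<lambda>x. f x + g x) \<in> regular X U"
  by (simp add: function_space_def)

lemma regular_mult:
  "function_space X \<Longrightarrow> openin (top_of X) U \<Longrightarrow> f \<in> regular X U \<Longrightarrow> g \<in> regular X U \<Longrightarrow>
     (\<lambda>x. f x * g x) \<in> regular X U"
  by (simp add: function_space_def)

lemma regular_sum:
  assumes "function_space X" "openin (top_of X) U" "\<And>i. i \<in> I \<Longrightarrow> f i \<in> regular X U"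
  shows "(\<lambda>x. \<Sum>i\<in>I. f i x) \<in> regular X U"
  using assms(3)
  by (induction I rule: infinite_finite_induct)
     (auto intro: regular_zero regular_add assms(1,2))

lemma nonvanishing_open:
  "function_space X \<Longrightarrow> openin (top_of X) U \<Longrightarrow> f \<in> regular X U \<Longrightarrow> openin (top_of X) {x\<in>U. f x \<noteq> 0}"
  by (simp add: function_space_def)

lemma regular_inverse:
  "function_space X \<Longrightarrow> openin (top_of X) U \<Longrightarrow> f \<in> regular X U \<Longrightarrow>
     (\<lambda>x. inverse (f x)) \<in> regular X {x\<in>U. f x \<noteq> 0}"
  by (simp add: function_space_def)

subsection \<open>Zariski spaces\<close>

text \<open>The nonvanishing sets of polynomials generate the Zariski topology and are closed under intersections, so that open
sets can be tested pointwise.\<close>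

lemma generate_topology_on_base:
  assumes "generate_topology_on \<S> U"
    and base: "\<And>a b x. a \<in> \<S> \<Longrightarrow> b \<in> \<S> \<Longrightarrow> x \<in> a \<Longrightarrow> x \<in> b \<Longrightarrow> \<exists>c\<in>\<S>. x \<in> c \<and> c \<subseteq> a \<inter> b"
  shows "x \<in> U \<Longrightarrow> \<exists>c\<in>\<S>. x \<in> c \<and> c \<subseteq> U"
  using assms(1)
proof (induction arbitrary: x)
  case Empty
  then show ?case by simp
next
  case (Int a b)
  then obtain c d where "c \<in> \<S>" "x \<in> c" "c \<subseteq> a" "d \<in> \<S>" "x \<in> d" "d \<subseteq> b"
    by (metis IntD1 IntD2)
  then show ?case
    using base[of c d x] by blast
next
  case (UN K)
  then show ?case by (meson Sup_upper UnionE subset_trans)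
next
  case (Basis s)
  then show ?case by blast
qed

lemma topology_generated_by_base_iff:
  assumes base: "\<And>a b x. a \<in> \<S> \<Longrightarrow> b \<in> \<S> \<Longrightarrow> x \<in> a \<Longrightarrow> x \<in> b \<Longrightarrow> \<exists>c\<in>\<S>. x \<in> c \<and> c \<subseteq> a \<inter> b"
  shows "openin (topology_generated_by \<S>) U \<longleftrightarrow> (\<forall>x\<in>U. \<exists>c\<in>\<S>. x \<in> c \<and> c \<subseteq> U)"
proof
  assume "openin (topology_generated_by \<S>) U"
  then show "\<forall>x\<in>U. \<exists>c\<in>\<S>. x \<in> c \<and> c \<subseteq> U"
    using generate_topology_on_base[OF openin_topology_generated_by base] by blast
next
  assume *: "\<forall>x\<in>U. \<exists>c\<in>\<S>. x \<in> c \<and> c \<subseteq> U"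
  show "openin (topology_generated_by \<S>) U"
    by (subst openin_subopen) (meson * topology_generated_by_Basis)
qed

lemma openin_zariski:
  "openin (top_of (zariski P C)) U \<longleftrightarrow>
     U \<subseteq> P \<and> (\<forall>x\<in>U. \<exists>r\<in>polyfuns C. r x \<noteq> 0 \<and> {y\<in>P. r y \<noteq> 0} \<subseteq> U)"
proof -
  let ?S = "{{x \<in> P. p x \<noteq> 0} | p. p \<in> polyfuns C}"
  have "openin (topology_generated_by ?S) U \<longleftrightarrow> (\<forall>x\<in>U. \<exists>c\<in>?S. x \<in> c \<and> c \<subseteq> U)"
  proof (rule topology_generated_by_base_iff)
    fix a b x assume "a \<in> ?S" "b \<in> ?S" and x: "x \<in> a" "x \<in> b"
    then obtain p q where pq: "a = {x \<in> P. p x \<noteq> 0}" "b = {x \<in> P. q x \<noteq> 0}" "p \<in> polyfuns C" "q \<in> polyfuns C"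
      by blast
    then have "{x \<in> P. p x * q x \<noteq> 0} \<in> ?S"
      by (intro CollectI exI[of _ "\<lambda>x. p x * q x"] conjI refl polyfuns.mult pq)
    then show "\<exists>c\<in>?S. x \<in> c \<and> c \<subseteq> a \<inter> b"
      using pq x by (intro bexI[of _ "{x \<in> P. p x * q x \<noteq> 0}"]) auto
  qed
  moreover have "(\<exists>c\<in>?S. x \<in> c \<and> c \<subseteq> U) \<longleftrightarrow> x \<in> P \<and> (\<exists>r\<in>polyfuns C. r x \<noteq> 0 \<and> {y\<in>P. r y \<noteq> 0} \<subseteq> U)" for x
    by (auto simp: Bex_def)
  ultimately show ?thesis by (auto simp: zariski_def)
qed

lemma points_zariski [simp]: "points (zariski P C) = P"
proof -
  have "openin (top_of (zariski P C)) P"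
    unfolding openin_zariski using polyfuns.const[of 1 C] by (auto intro!: bexI[of _ "\<lambda>_. 1"])
  moreover have "points (zariski P C) \<subseteq> P"
    using openin_zariski[of P C "points (zariski P C)"] by simp
  ultimately show ?thesis using openin_subset by blast
qed

text \<open>Multiplying numerator and denominator by a polynomial that vanishes outside \<open>U\<close> makes the quotient
representation independent of \<open>U\<close>; in this form representations can be restricted and combined.\<close>

lemma regular_zariski:
  assumes "openin (top_of (zariski P C)) U"
  shows "f \<in> regular (zariski P C) U \<longleftrightarrow> cut U f = f \<and>
     (\<forall>x\<in>U. \<exists>p\<in>polyfuns C. \<exists>q\<in>polyfuns C. q x \<noteq> 0 \<and> (\<forall>y\<in>P. q y \<noteq> 0 \<longrightarrow> y \<in> U \<and> f y = p y / q y))"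
proof -
  have "(\<exists>p\<in>polyfuns C. \<exists>q\<in>polyfuns C. q x \<noteq> 0 \<and> (\<forall>y\<in>U. q y \<noteq> 0 \<longrightarrow> f y = p y / q y)) \<longleftrightarrow>
    (\<exists>p\<in>polyfuns C. \<exists>q\<in>polyfuns C. q x \<noteq> 0 \<and> (\<forall>y\<in>P. q y \<noteq> 0 \<longrightarrow> y \<in> U \<and> f y = p y / q y))"
    (is "?L = ?R") if x: "x \<in> U" for x
  proof
    assume ?L
    then obtain p q where pq: "p \<in> polyfuns C" "q \<in> polyfuns C" "q x \<noteq> 0" "\<forall>y\<in>U. q y \<noteq> 0 \<longrightarrow> f y = p y / q y"
      by blast
    obtain r where r: "r \<in> polyfuns C" "r x \<noteq> 0" "{y\<in>P. r y \<noteq> 0} \<subseteq> U"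
      using assms x by (auto simp: openin_zariski)
    show ?R
      by (intro bexI[of _ "\<lambda>y. p y * r y"] bexI[of _ "\<lambda>y. q y * r y"])
         (use pq r in \<open>auto intro: polyfuns.mult\<close>)
  next
    assume ?R
    then show ?L using assms openin_zariski by (metis subsetD)
  qed
  then show ?thesis unfolding zariski_def by auto
qed

lemma sheaf_zariski: "sheaf_of_functions (zariski P C)"
  unfolding sheaf_of_functions_def
proof (intro conjI allI impI)
  let ?X = "zariski P C"
  fix U and f :: "'a \<Rightarrow> 'b" assume U: "openin (top_of ?X) U"
  { assume "f \<in> regular ?X U"
    then show "cut U f = f" by (simp add: zariski_def) }
  { fix V assume V: "openin (top_of ?X) V" "V \<subseteq> U" and f: "f \<in> regular ?X U"
    show "cut V f \<in> regular ?X V"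
      unfolding zariski_def
    proof (simp add: cut_cut, intro ballI)
      fix x assume "x \<in> V"
      then obtain p q where "p \<in> polyfuns C" "q \<in> polyfuns C" "q x \<noteq> 0" "\<forall>y\<in>P. q y \<noteq> 0 \<longrightarrow> y \<in> U \<and> f y = p y / q y"
        using f V unfolding regular_zariski[OF U] by blast
      then show "\<exists>p\<in>polyfuns C. \<exists>q\<in>polyfuns C. q x \<noteq> 0 \<and> (\<forall>y\<in>V. q y \<noteq> 0 \<longrightarrow> cut V f y = p y / q y)"
        using V(1) unfolding openin_zariski by (metis cut_apply subsetD)
    qed }
  { assume f: "cut U f = f" and loc: "\<forall>x\<in>U. \<exists>V. openin (top_of ?X) V \<and> x \<in> V \<and> V \<subseteq> U \<and> cut V f \<in> regular ?X V"
    show "f \<in> regular ?X U"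
      unfolding regular_zariski[OF U]
    proof (intro conjI ballI f)
      fix x assume "x \<in> U"
      then obtain V where V: "openin (top_of ?X) V" "x \<in> V" "V \<subseteq> U" "cut V f \<in> regular ?X V"
        using loc by blast
      then obtain p q where "p \<in> polyfuns C" "q \<in> polyfuns C" "q x \<noteq> 0" "\<forall>y\<in>P. q y \<noteq> 0 \<longrightarrow> y \<in> V \<and> cut V f y = p y / q y"
        unfolding regular_zariski[OF V(1)] by blast
      then show "\<exists>p\<in>polyfuns C. \<exists>q\<in>polyfuns C. q x \<noteq> 0 \<and> (\<forall>y\<in>P. q y \<noteq> 0 \<longrightarrow> y \<in> U \<and> f y = p y / q y)"
        using V(3) by (metis cut_apply subsetD)
    qed }
qed

lemma function_space_zariski: "function_space (zariski P C)"
  unfolding function_space_def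
proof (intro conjI allI impI ballI sheaf_zariski)
  let ?X = "zariski P C"
  fix U assume U: "openin (top_of ?X) U"
  { fix c show "cut U (\<lambda>_. c) \<in> regular ?X U"
      unfolding zariski_def
      by (simp add: cut_cut, intro ballI bexI[of _ "\<lambda>_. c"] bexI[of _ "\<lambda>_. 1"])
         (auto simp: cut_apply intro: polyfuns.const) }
  fix f assume f: "f \<in> regular ?X U"
  have f0: "f x = 0" if "x \<notin> U" for x
    using f that sheaf_outside[OF sheaf_zariski U] by blast
  have loc: "\<exists>p\<in>polyfuns C. \<exists>q\<in>polyfuns C. q x \<noteq> 0 \<and> (\<forall>y\<in>P. q y \<noteq> 0 \<longrightarrow> y \<in> U \<and> f y = p y / q y)" if "x \<in> U" for x
    using f that unfolding regular_zariski[OF U] by simp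
  have UP: "U \<subseteq> P" using U by (simp add: openin_zariski)
  have loc': "\<exists>p\<in>polyfuns C. \<exists>q\<in>polyfuns C. p x * q x \<noteq> 0 \<and> (\<forall>y\<in>P. q y \<noteq> 0 \<longrightarrow> y \<in> U \<and> f y = p y / q y)"
    if x: "x \<in> U" "f x \<noteq> 0" for x
  proof -
    obtain p q where "p\<in>polyfuns C" "q\<in>polyfuns C" "q x \<noteq> 0" "\<forall>y\<in>P. q y \<noteq> 0 \<longrightarrow> y \<in> U \<and> f y = p y / q y"
      using loc[OF x(1)] by auto
    moreover have "p x \<noteq> 0" using calculation x UP by auto
    ultimately show ?thesis by (intro bexI[of _ p] bexI[of _ q]) auto
  qed
  show open': "openin (top_of ?X) {x \<in> U. f x \<noteq> 0}"
    unfolding openin_zariski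
  proof (intro conjI ballI)
    show "{x \<in> U. f x \<noteq> 0} \<subseteq> P" using UP by blast
    fix x assume "x \<in> {x \<in> U. f x \<noteq> 0}"
    then obtain p q where pq: "p\<in>polyfuns C" "q\<in>polyfuns C" "p x * q x \<noteq> 0" "\<forall>y\<in>P. q y \<noteq> 0 \<longrightarrow> y \<in> U \<and> f y = p y / q y"
      using loc'[of x] by auto
    then show "\<exists>r\<in>polyfuns C. r x \<noteq> 0 \<and> {y \<in> P. r y \<noteq> 0} \<subseteq> {x \<in> U. f x \<noteq> 0}"
      by (intro bexI[of _ "\<lambda>y. p y * q y"]) (auto intro: polyfuns.mult)
  qed
  show "(\<lambda>x. inverse (f x)) \<in> regular ?X {x \<in> U. f x \<noteq> 0}"
    unfolding regular_zariski[OF open']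
  proof (intro conjI ballI)
    show "cut {x \<in> U. f x \<noteq> 0} (\<lambda>x. inverse (f x)) = (\<lambda>x. inverse (f x))"
      using f0 by (force simp: cut_def)
    fix x assume "x \<in> {x \<in> U. f x \<noteq> 0}"
    then obtain p q where pq: "p\<in>polyfuns C" "q\<in>polyfuns C" "p x * q x \<noteq> 0" "\<forall>y\<in>P. q y \<noteq> 0 \<longrightarrow> y \<in> U \<and> f y = p y / q y"
      using loc'[of x] by auto
    then show "\<exists>r\<in>polyfuns C. \<exists>s\<in>polyfuns C. s x \<noteq> 0 \<and> (\<forall>y\<in>P. s y \<noteq> 0 \<longrightarrow> y \<in> {x \<in> U. f x \<noteq> 0} \<and> inverse (f y) = r y / s y)"
      by (intro bexI[of _ "\<lambda>y. q y * q y"] bexI[of _ "\<lambda>y. p y * q y"]) (auto intro: polyfuns.mult)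
  qed
  fix g assume g: "g \<in> regular ?X U"
  have g0: "g x = 0" if "x \<notin> U" for x
    using g that sheaf_outside[OF sheaf_zariski U] by blast
  have locg: "\<exists>p\<in>polyfuns C. \<exists>q\<in>polyfuns C. q x \<noteq> 0 \<and> (\<forall>y\<in>P. q y \<noteq> 0 \<longrightarrow> y \<in> U \<and> g y = p y / q y)" if "x \<in> U" for x
    using g that unfolding regular_zariski[OF U] by simp
  show "(\<lambda>x. f x + g x) \<in> regular ?X U"
    unfolding regular_zariski[OF U]
  proof (intro conjI ballI)
    show "cut U (\<lambda>x. f x + g x) = (\<lambda>x. f x + g x)" using f0 g0 by (auto simp: cut_def)
    fix x assume x: "x \<in> U"
    obtain p q where pq: "p\<in>polyfuns C" "q\<in>polyfuns C" "q x \<noteq> 0" "\<forall>y\<in>P. q y \<noteq> 0 \<longrightarrow> y \<in> U \<and> f y = p y / q y"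
      using loc[OF x] by auto
    obtain p' q' where pq': "p'\<in>polyfuns C" "q'\<in>polyfuns C" "q' x \<noteq> 0" "\<forall>y\<in>P. q' y \<noteq> 0 \<longrightarrow> y \<in> U \<and> g y = p' y / q' y"
      using locg[OF x] by auto
    show "\<exists>r\<in>polyfuns C. \<exists>s\<in>polyfuns C. s x \<noteq> 0 \<and> (\<forall>y\<in>P. s y \<noteq> 0 \<longrightarrow> y \<in> U \<and> f y + g y = r y / s y)"
      using pq pq' by (intro bexI[of _ "\<lambda>y. p y * q' y + p' y * q y"] bexI[of _ "\<lambda>y. q y * q' y"])
        (auto intro!: polyfuns.mult polyfuns.add simp: add_frac_eq)
  qed
  show "(\<lambda>x. f x * g x) \<in> regular ?X U"
    unfolding regular_zariski[OF U]
  proof (intro conjI ballI)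
    show "cut U (\<lambda>x. f x * g x) = (\<lambda>x. f x * g x)" using f0 g0 by (auto simp: cut_def)
    fix x assume x: "x \<in> U"
    obtain p q where pq: "p\<in>polyfuns C" "q\<in>polyfuns C" "q x \<noteq> 0" "\<forall>y\<in>P. q y \<noteq> 0 \<longrightarrow> y \<in> U \<and> f y = p y / q y"
      using loc[OF x] by auto
    obtain p' q' where pq': "p'\<in>polyfuns C" "q'\<in>polyfuns C" "q' x \<noteq> 0" "\<forall>y\<in>P. q' y \<noteq> 0 \<longrightarrow> y \<in> U \<and> g y = p' y / q' y"
      using locg[OF x] by auto
    show "\<exists>r\<in>polyfuns C. \<exists>s\<in>polyfuns C. s x \<noteq> 0 \<and> (\<forall>y\<in>P. s y \<noteq> 0 \<longrightarrow> y \<in> U \<and> f y * g y = r y / s y)"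
      using pq pq' by (intro bexI[of _ "\<lambda>y. p y * p' y"] bexI[of _ "\<lambda>y. q y * q' y"])
        (auto intro!: polyfuns.mult polyfuns.add)
  qed
qed

lemma regular_polyfun:
  assumes "p \<in> polyfuns C" shows "cut P p \<in> regular (zariski P C) P"
proof -
  have "openin (top_of (zariski P C)) P" by (metis openin_topspace points_zariski)
  then show ?thesis
    by (subst regular_zariski)
       (simp_all add: cut_cut, intro ballI bexI[of _ p] bexI[of _ "\<lambda>_. 1"],
        auto simp: cut_apply intro: polyfuns.const assms)
qed

subsection \<open>Open subspaces\<close>

lemma openin_subspace_on:
  "openin (top_of X) A \<Longrightarrow> openin (top_of (subspace_on X A)) V \<longleftrightarrow> openin (top_of X) V \<and> V \<subseteq> A"
  by (simp add: subspace_on_def openin_open_subtopology)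

lemma regular_subspace_on:
  assumes X: "sheaf_of_functions X" and A: "openin (top_of X) A" and V: "openin (top_of X) V" "V \<subseteq> A"
  shows "regular (subspace_on X A) V = regular X V"
proof (intro equalityI subsetI)
  fix f assume f: "f \<in> regular (subspace_on X A) V"
  show "f \<in> regular X V"
  proof (rule sheaf_glue[OF X V(1)])
    show "cut V f = f" using f by (simp add: subspace_on_def)
    fix x assume "x \<in> V"
    then obtain W h where W: "openin (top_of X) W" "x \<in> W" "h \<in> regular X W" "\<forall>y\<in>W \<inter> V. f y = h y"
      using f unfolding subspace_on_def by auto
    have o: "openin (top_of X) (W \<inter> V)" using W V by blast
    have "cut (W \<inter> V) h \<in> regular X (W \<inter> V)"
      using sheaf_restrict[OF X W(1) o _ W(3)] by blast
    moreover have "cut (W \<inter> V) h = cut (W \<inter> V) f" using W(4) by (intro cut_cong) auto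
    ultimately show "\<exists>V'. openin (top_of X) V' \<and> x \<in> V' \<and> V' \<subseteq> V \<and> cut V' f \<in> regular X V'"
      using W o \<open>x \<in> V\<close> by (intro exI[of _ "W \<inter> V"]) auto
  qed
next
  fix f assume f: "f \<in> regular X V"
  then show "f \<in> regular (subspace_on X A) V"
    using sheaf_cut[OF X V(1) f] V by (auto simp: subspace_on_def)
qed

lemma sheaf_subspace_on:
  assumes X: "sheaf_of_functions X" and A: "openin (top_of X) A"
  shows "sheaf_of_functions (subspace_on X A)"
  unfolding sheaf_of_functions_def openin_subspace_on[OF A]
proof (intro conjI allI impI; (elim conjE)?)
  fix U f assume U: "openin (top_of X) U" "U \<subseteq> A"
  { assume "f \<in> regular (subspace_on X A) U"
    then show "cut U f = f" using sheaf_cut[OF X U(1)] regular_subspace_on[OF X A U] by simp }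
  { fix V assume "openin (top_of X) V" "V \<subseteq> A" "V \<subseteq> U" "f \<in> regular (subspace_on X A) U"
    then show "cut V f \<in> regular (subspace_on X A) V"
      using sheaf_restrict[OF X U(1)] regular_subspace_on[OF X A] U by blast }
  { assume "cut U f = f" and
      *: "\<forall>x\<in>U. \<exists>V. (openin (top_of X) V \<and> V \<subseteq> A) \<and> x \<in> V \<and> V \<subseteq> U \<and> cut V f \<in> regular (subspace_on X A) V"
    then show "f \<in> regular (subspace_on X A) U"
      unfolding regular_subspace_on[OF X A U]
      by (intro sheaf_glue[OF X U(1)]) (use regular_subspace_on[OF X A] in fastforce)+ }
qed

subsection \<open>Morphisms\<close>

lemma morphism_continuous: "morphism X Y \<phi> \<Longrightarrow> continuous_map (top_of X) (top_of Y) \<phi>"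
  by (simp add: morphism_def)

lemma morphism_points: "morphism X Y \<phi> \<Longrightarrow> x \<in> points X \<Longrightarrow> \<phi> x \<in> points Y"
  using continuous_map_image_subset_topspace[OF morphism_continuous] by blast

lemma morphism_preimage_open:
  "morphism X Y \<phi> \<Longrightarrow> openin (top_of Y) V \<Longrightarrow> openin (top_of X) {x \<in> points X. \<phi> x \<in> V}"
  by (auto simp: morphism_def continuous_map_def)

lemma morphism_pullback:
  "morphism X Y \<phi> \<Longrightarrow> openin (top_of Y) V \<Longrightarrow> f \<in> regular Y V \<Longrightarrow>
     cut {x \<in> points X. \<phi> x \<in> V} (f \<circ> \<phi>) \<in> regular X {x \<in> points X. \<phi> x \<in> V}"
  by (simp add: morphism_def)

lemma morphism_comp:
  assumes f: "morphism X Y f" and g: "morphism Y Z g"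
  shows "morphism X Z (\<lambda>x. g (f x))"
proof -
  have pre: "{x \<in> points X. f x \<in> {y \<in> points Y. g y \<in> V}} = {x \<in> points X. g (f x) \<in> V}" for V
    using morphism_points[OF f] by auto
  show ?thesis
    unfolding morphism_def
  proof (intro conjI allI impI)
    show "continuous_map (top_of X) (top_of Z) (\<lambda>x. g (f x))"
      using continuous_map_compose[OF morphism_continuous[OF f] morphism_continuous[OF g]]
      by (simp add: comp_def)
    fix V h assume V: "openin (top_of Z) V" "h \<in> regular Z V"
    have "cut {x \<in> points X. g (f x) \<in> V} (cut {y \<in> points Y. g y \<in> V} (h \<circ> g) \<circ> f)
        \<in> regular X {x \<in> points X. g (f x) \<in> V}"
      using morphism_pullback[OF f morphism_preimage_open[OF g V(1)] morphism_pullback[OF g V]]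
      unfolding pre .
    moreover have "cut {x \<in> points X. g (f x) \<in> V} (cut {y \<in> points Y. g y \<in> V} (h \<circ> g) \<circ> f)
        = cut {x \<in> points X. g (f x) \<in> V} (h \<circ> (\<lambda>x. g (f x)))"
      using morphism_points[OF f] by (intro cut_cong) (auto simp: cut_def)
    ultimately show "cut {x \<in> points X. g (f x) \<in> V} (h \<circ> (\<lambda>x. g (f x))) \<in> regular X {x \<in> points X. g (f x) \<in> V}"
      by simp
  qed
qed

lemma morphism_id: "function_space X \<Longrightarrow> morphism X X (\<lambda>x. x)"
  unfolding morphism_def
proof (intro conjI allI impI)
  fix V f assume X: "function_space X" "openin (top_of X) V" "f \<in> regular X V"
  have "{x \<in> points X. x \<in> V} = V" using X(2) openin_subset by blast
  then show "cut {x \<in> points X. x \<in> V} (f \<circ> (\<lambda>x. x)) \<in> regular X {x \<in> points X. x \<in> V}"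
    using X sheaf_cut[OF function_space_sheaf[OF X(1)] X(2,3)] by (simp add: comp_def)
qed simp

lemma morphism_const:
  assumes X: "function_space X" and y: "y \<in> points Y" shows "morphism X Y (\<lambda>_. y)"
  unfolding morphism_def
proof (intro conjI allI impI)
  show "continuous_map (top_of X) (top_of Y) (\<lambda>_. y)" using y by simp
  fix V f assume V: "openin (top_of Y) V" "f \<in> regular Y V"
  have "openin (top_of X) {x \<in> points X. y \<in> V}" by (cases "y \<in> V") auto
  from regular_const[OF X this, of "f y"]
  show "cut {x \<in> points X. y \<in> V} (f \<circ> (\<lambda>_. y)) \<in> regular X {x \<in> points X. y \<in> V}"
    by (simp add: comp_def)
qed

lemma function_space_iso:
  assumes X: "sheaf_of_functions X" and Y: "function_space Y" and iso: "isomorphism X Y \<phi>"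
  shows "function_space X"
proof -
  obtain \<psi> where \<phi>: "morphism X Y \<phi>" and \<psi>: "morphism Y X \<psi>"
    and inv: "\<And>x. x \<in> points X \<Longrightarrow> \<psi> (\<phi> x) = x" "\<And>y. y \<in> points Y \<Longrightarrow> \<phi> (\<psi> y) = y"
    using iso unfolding isomorphism_def by blast
  define T where "T U = {y \<in> points Y. \<psi> y \<in> U}" for U
  define P where "P U f = cut (T U) (f \<circ> \<psi>)" for U and f :: "'a \<Rightarrow> 'b"
  have T: "openin (top_of Y) (T U)" if "openin (top_of X) U" for U
    unfolding T_def by (rule morphism_preimage_open[OF \<psi> that])
  have P: "P U f \<in> regular Y (T U)" if "openin (top_of X) U" "f \<in> regular X U" for U f
    unfolding T_def P_def by (rule morphism_pullback[OF \<psi> that])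
  have back_pts: "{x \<in> points X. \<phi> x \<in> T U} = U" if "openin (top_of X) U" for U
    using openin_subset[OF that] morphism_points[OF \<phi>] inv by (auto simp: T_def)
  have descend: "h \<in> regular X U" if U: "openin (top_of X) U" and g: "g \<in> regular Y (T U)"
      and eq: "\<And>x. x \<in> U \<Longrightarrow> h x = g (\<phi> x)" and h0: "\<And>x. x \<notin> U \<Longrightarrow> h x = 0" for U g h
  proof -
    have "cut U (g \<circ> \<phi>) \<in> regular X U"
      using morphism_pullback[OF \<phi> T[OF U] g] unfolding back_pts[OF U] .
    moreover have "cut U (g \<circ> \<phi>) = h" using eq h0 by (auto simp: cut_def)
    ultimately show ?thesis by simp
  qed
  have Px: "P U f (\<phi> x) = f x" if "openin (top_of X) U" "x \<in> U" for U f x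
    using openin_subset[OF that(1)] that morphism_points[OF \<phi>, of x] inv(1)[of x] by (auto simp: P_def T_def cut_def)
  show ?thesis
    unfolding function_space_def
  proof (intro conjI allI impI ballI X)
    fix U assume U: "openin (top_of X) U"
    note o = sheaf_outside[OF X U]
    { fix c show "cut U (\<lambda>_. c) \<in> regular X U"
        by (rule descend[OF U regular_const[OF Y T[OF U], of c]])
           (use back_pts[OF U] in \<open>auto simp: cut_def\<close>) }
    fix f assume f: "f \<in> regular X U"
    have eq: "{y \<in> T U. P U f y \<noteq> 0} = T {x \<in> U. f x \<noteq> 0}"
      by (auto simp: T_def P_def cut_def)
    have "{x \<in> U. f x \<noteq> 0} = {x \<in> points X. \<phi> x \<in> {y \<in> T U. P U f y \<noteq> 0}}"
    proof -
      have "x \<in> U" if "x \<in> points X" "\<phi> x \<in> T U" for x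
        using that back_pts[OF U] by blast
      moreover have "x \<in> points X" "\<phi> x \<in> T U" if "x \<in> U" for x
        using that back_pts[OF U] by blast+
      ultimately show ?thesis using Px[OF U] by force
    qed
    then show op: "openin (top_of X) {x \<in> U. f x \<noteq> 0}"
      using morphism_preimage_open[OF \<phi> nonvanishing_open[OF Y T[OF U] P[OF U f]]] by simp
    show "(\<lambda>x. inverse (f x)) \<in> regular X {x \<in> U. f x \<noteq> 0}"
      by (rule descend[OF op regular_inverse[OF Y T[OF U] P[OF U f], unfolded eq]])
         (use Px[OF U] o[OF f] in auto)
    fix g assume g: "g \<in> regular X U"
    show "(\<lambda>x. f x + g x) \<in> regular X U"
      by (rule descend[OF U regular_add[OF Y T[OF U] P[OF U f] P[OF U g]]])
         (use Px[OF U] o[OF f] o[OF g] in auto)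
    show "(\<lambda>x. f x * g x) \<in> regular X U"
      by (rule descend[OF U regular_mult[OF Y T[OF U] P[OF U f] P[OF U g]]])
         (use Px[OF U] o[OF f] o[OF g] in auto)
  qed
qed

text \<open>Each axiom concerns the germs of functions at a point, so the sheaf property glues it together from a cover.\<close>

lemma function_space_local:
  assumes X: "sheaf_of_functions X"
    and loc: "\<And>x. x \<in> points X \<Longrightarrow> \<exists>A. openin (top_of X) A \<and> x \<in> A \<and> function_space (subspace_on X A)"
  shows "function_space X"
  unfolding function_space_def
proof (intro conjI allI impI ballI X)
  fix U assume U: "openin (top_of X) U"
  have nbhd: "\<exists>A. openin (top_of X) (U \<inter> A) \<and> x \<in> A \<and> U \<inter> A \<subseteq> A \<and> openin (top_of X) A \<and> function_space (subspace_on X A)"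
    if "x \<in> U" for x
    using loc[of x] openin_subset[OF U] that U by (auto intro: openin_Int)
  have restr: "cut (U \<inter> A) f \<in> regular (subspace_on X A) (U \<inter> A)"
    if "openin (top_of X) A" "f \<in> regular X U" for A f
    using sheaf_restrict[OF X U _ _ that(2), of "U \<inter> A"] regular_subspace_on[OF X that(1), of "U \<inter> A"] U that(1)
    by auto
  have glue: "h \<in> regular X U" if "cut U h = h"
    "\<And>A. openin (top_of X) A \<Longrightarrow> openin (top_of X) (U \<inter> A) \<Longrightarrow> function_space (subspace_on X A) \<Longrightarrow>
       openin (top_of (subspace_on X A)) (U \<inter> A) \<Longrightarrow> cut (U \<inter> A) h \<in> regular (subspace_on X A) (U \<inter> A)" for h
  proof (rule sheaf_glue[OF X U that(1)])
    fix x assume x: "x \<in> U"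
    then obtain A where A: "openin (top_of X) (U \<inter> A)" "x \<in> A" "openin (top_of X) A" "function_space (subspace_on X A)"
      using nbhd by blast
    then have "cut (U \<inter> A) h \<in> regular X (U \<inter> A)"
      using that(2)[OF A(3,1,4)] openin_subspace_on[OF A(3)] regular_subspace_on[OF X A(3,1)] by simp
    then show "\<exists>V. openin (top_of X) V \<and> x \<in> V \<and> V \<subseteq> U \<and> cut V h \<in> regular X V"
      using A x by (intro exI[of _ "U \<inter> A"]) auto
  qed
  show "cut U (\<lambda>_. c) \<in> regular X U" for c
    by (rule glue) (simp_all add: cut_cut_subset regular_const cut_cut[of U U])
  fix f assume f: "f \<in> regular X U"
  note o = sheaf_outside[OF X U]
  show op: "openin (top_of X) {x \<in> U. f x \<noteq> 0}"
  proof (subst openin_subopen, intro ballI)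
    fix x assume x: "x \<in> {x \<in> U. f x \<noteq> 0}"
    then obtain A where A: "openin (top_of X) (U \<inter> A)" "x \<in> A" "openin (top_of X) A" "function_space (subspace_on X A)"
      using nbhd by blast
    have "openin (top_of (subspace_on X A)) {x \<in> U \<inter> A. cut (U \<inter> A) f x \<noteq> 0}"
      using nonvanishing_open[OF A(4) _ restr[OF A(3) f]] openin_subspace_on[OF A(3)] A(1) by blast
    then have "openin (top_of X) {x \<in> U \<inter> A. cut (U \<inter> A) f x \<noteq> 0}"
      using openin_subspace_on[OF A(3)] by blast
    then show "\<exists>T. openin (top_of X) T \<and> x \<in> T \<and> T \<subseteq> {x \<in> U. f x \<noteq> 0}"
      using x A(2) openin_subset[OF U] by (intro exI[of _ "{x \<in> U \<inter> A. cut (U \<inter> A) f x \<noteq> 0}"]) (auto simp: cut_def)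
  qed
  show "(\<lambda>x. inverse (f x)) \<in> regular X {x \<in> U. f x \<noteq> 0}"
  proof (rule sheaf_glue[OF X op])
    show "cut {x \<in> U. f x \<noteq> 0} (\<lambda>x. inverse (f x)) = (\<lambda>x. inverse (f x))"
      using o[OF f] by (force simp: cut_def)
    fix x assume x: "x \<in> {x \<in> U. f x \<noteq> 0}"
    then obtain A where A: "openin (top_of X) (U \<inter> A)" "x \<in> A" "openin (top_of X) A" "function_space (subspace_on X A)"
      using nbhd by blast
    let ?V = "{x \<in> U \<inter> A. cut (U \<inter> A) f x \<noteq> 0}"
    have sub: "openin (top_of (subspace_on X A)) (U \<inter> A)" using openin_subspace_on[OF A(3)] A(1) by blast
    have V: "openin (top_of X) ?V" "?V \<subseteq> A"
      using nonvanishing_open[OF A(4) sub restr[OF A(3) f]] unfolding openin_subspace_on[OF A(3)] by simp_all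
    have "(\<lambda>x. inverse (cut (U \<inter> A) f x)) \<in> regular X ?V"
      using regular_inverse[OF A(4) sub restr[OF A(3) f]] regular_subspace_on[OF X A(3) V] by simp
    moreover have "(\<lambda>x. inverse (cut (U \<inter> A) f x)) = cut ?V (\<lambda>x. inverse (f x))"
      by (auto simp: cut_def)
    ultimately show "\<exists>V. openin (top_of X) V \<and> x \<in> V \<and> V \<subseteq> {x \<in> U. f x \<noteq> 0} \<and> cut V (\<lambda>x. inverse (f x)) \<in> regular X V"
      using x A V by (intro exI[of _ ?V]) (auto simp: cut_def)
  qed
  fix g assume g: "g \<in> regular X U"
  show "(\<lambda>x. f x + g x) \<in> regular X U"
  proof (rule glue)
    show "cut U (\<lambda>x. f x + g x) = (\<lambda>x. f x + g x)" using o[OF f] o[OF g] by (auto simp: cut_def)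
    fix A assume A: "openin (top_of X) A" "openin (top_of X) (U \<inter> A)" "function_space (subspace_on X A)"
      "openin (top_of (subspace_on X A)) (U \<inter> A)"
    have "(\<lambda>x. cut (U \<inter> A) f x + cut (U \<inter> A) g x) = cut (U \<inter> A) (\<lambda>x. f x + g x)" by (auto simp: cut_def)
    then show "cut (U \<inter> A) (\<lambda>x. f x + g x) \<in> regular (subspace_on X A) (U \<inter> A)"
      using regular_add[OF A(3,4) restr[OF A(1) f] restr[OF A(1) g]] by simp
  qed
  show "(\<lambda>x. f x * g x) \<in> regular X U"
  proof (rule glue)
    show "cut U (\<lambda>x. f x * g x) = (\<lambda>x. f x * g x)" using o[OF f] o[OF g] by (auto simp: cut_def)
    fix A assume A: "openin (top_of X) A" "openin (top_of X) (U \<inter> A)" "function_space (subspace_on X A)"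
      "openin (top_of (subspace_on X A)) (U \<inter> A)"
    have "(\<lambda>x. cut (U \<inter> A) f x * cut (U \<inter> A) g x) = cut (U \<inter> A) (\<lambda>x. f x * g x)" by (auto simp: cut_def)
    then show "cut (U \<inter> A) (\<lambda>x. f x * g x) \<in> regular (subspace_on X A) (U \<inter> A)"
      using regular_mult[OF A(3,4) restr[OF A(1) f] restr[OF A(1) g]] by simp
  qed
qed

lemma function_space_variety:
  assumes "variety X" shows "function_space X"
proof (rule function_space_local)
  show X: "sheaf_of_functions X" using assms by (simp add: variety_def)
  fix x assume "x \<in> points X"
  then obtain A where A: "openin (top_of X) A" "x \<in> A" "affine_variety (subspace_on X A)"
    using assms unfolding variety_def by blast
  have "function_space (subspace_on X A)"
    using A(3) function_space_iso[OF sheaf_subspace_on[OF X A(1)] function_space_zariski]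
    unfolding affine_variety_def by blast
  then show "\<exists>A. openin (top_of X) A \<and> x \<in> A \<and> function_space (subspace_on X A)"
    using A by blast
qed

text \<open>A regular function on a Zariski space is locally a quotient of polynomials in the coordinates, and the axioms of a
space with functions let one form such quotients on the source.\<close>

lemma morphism_zariskiI:
  assumes Y: "function_space Y" and P: "\<And>y. y \<in> points Y \<Longrightarrow> a y \<in> P"
    and C: "\<And>f. f \<in> C \<Longrightarrow> cut (points Y) (f \<circ> a) \<in> regular Y (points Y)"
  shows "morphism Y (zariski P C) a"
proof -
  have top: "openin (top_of Y) (points Y)" by simp
  have poly: "cut (points Y) (p \<circ> a) \<in> regular Y (points Y)" if "p \<in> polyfuns C" for p
    using that
  proof induction
    case (const c)
    then show ?case using regular_const[OF Y top, of c] by (simp add: comp_def)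
  next
    case (coord f)
    then show ?case by (rule C)
  next
    case (add f g)
    have "(\<lambda>x. cut (points Y) (f \<circ> a) x + cut (points Y) (g \<circ> a) x) = cut (points Y) ((\<lambda>x. f x + g x) \<circ> a)"
      by (auto simp: cut_def)
    then show ?case using regular_add[OF Y top add.IH] by (simp only:)
  next
    case (mult f g)
    have "(\<lambda>x. cut (points Y) (f \<circ> a) x * cut (points Y) (g \<circ> a) x) = cut (points Y) ((\<lambda>x. f x * g x) \<circ> a)"
      by (auto simp: cut_def)
    then show ?case using regular_mult[OF Y top mult.IH] by (simp only:)
  qed
  have basic: "openin (top_of Y) {y \<in> points Y. p (a y) \<noteq> 0}" if "p \<in> polyfuns C" for p
  proof -
    have "{y \<in> points Y. p (a y) \<noteq> 0} = {y \<in> points Y. cut (points Y) (p \<circ> a) y \<noteq> 0}" by (auto simp: cut_def)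
    then show ?thesis using nonvanishing_open[OF Y top poly[OF that]] by simp
  qed
  have pre: "openin (top_of Y) {y \<in> points Y. a y \<in> V}" if V: "openin (top_of (zariski P C)) V" for V
  proof (subst openin_subopen, intro ballI)
    fix y assume y: "y \<in> {y \<in> points Y. a y \<in> V}"
    then obtain r where "r \<in> polyfuns C" "r (a y) \<noteq> 0" "{z\<in>P. r z \<noteq> 0} \<subseteq> V"
      using V unfolding openin_zariski by blast
    then show "\<exists>T. openin (top_of Y) T \<and> y \<in> T \<and> T \<subseteq> {y \<in> points Y. a y \<in> V}"
      using y P basic[of r] by (intro exI[of _ "{y \<in> points Y. r (a y) \<noteq> 0}"]) auto
  qed
  show ?thesis
    unfolding morphism_def
  proof (intro conjI allI impI)
    show "continuous_map (top_of Y) (top_of (zariski P C)) a"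
      using P pre by (auto simp: continuous_map_def)
    fix V f assume V: "openin (top_of (zariski P C)) V" and f: "f \<in> regular (zariski P C) V"
    show "cut {y \<in> points Y. a y \<in> V} (f \<circ> a) \<in> regular Y {y \<in> points Y. a y \<in> V}"
    proof (rule sheaf_glue[OF function_space_sheaf[OF Y] pre[OF V]])
      fix y assume y: "y \<in> {y \<in> points Y. a y \<in> V}"
      then obtain p q where pq: "p \<in> polyfuns C" "q \<in> polyfuns C" "q (a y) \<noteq> 0"
          "\<forall>z\<in>P. q z \<noteq> 0 \<longrightarrow> z \<in> V \<and> f z = p z / q z"
        using f unfolding regular_zariski[OF V] by auto
      let ?W = "{y \<in> points Y. q (a y) \<noteq> 0}"
      have eq: "{y \<in> points Y. cut (points Y) (q \<circ> a) y \<noteq> 0} = ?W" by (auto simp: cut_def)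
      have 1: "(\<lambda>y. inverse (cut (points Y) (q \<circ> a) y)) \<in> regular Y ?W"
        using regular_inverse[OF Y top poly[OF pq(2)]] unfolding eq .
      have 2: "cut ?W (cut (points Y) (p \<circ> a)) \<in> regular Y ?W"
        by (rule sheaf_restrict[OF function_space_sheaf[OF Y] top basic[OF pq(2)] _ poly[OF pq(1)]]) auto
      have "(\<lambda>y. cut ?W (cut (points Y) (p \<circ> a)) y * inverse (cut (points Y) (q \<circ> a) y))
          = cut ?W (cut {y \<in> points Y. a y \<in> V} (f \<circ> a))"
        using pq(4) P by (auto simp: cut_def field_simps)
      then show "\<exists>W. openin (top_of Y) W \<and> y \<in> W \<and> W \<subseteq> {y \<in> points Y. a y \<in> V} \<and>
          cut W (cut {y \<in> points Y. a y \<in> V} (f \<circ> a)) \<in> regular Y W"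
        using regular_mult[OF Y basic[OF pq(2)] 2 1] basic[OF pq(2)] y pq(3,4) P
        by (intro exI[of _ ?W]) auto
    qed (simp add: cut_cut)
  qed
qed

section \<open>Products\<close>

lemma morphism_subspace_inclusion: "morphism (subspace_on X A) X (\<lambda>x. x)"
  unfolding morphism_def
proof (intro conjI allI impI)
  show "continuous_map (top_of (subspace_on X A)) (top_of X) (\<lambda>x. x)"
    by (simp add: subspace_on_def continuous_map_from_subtopology)
  fix V f assume "openin (top_of X) V" "f \<in> regular X V"
  then show "cut {x \<in> points (subspace_on X A). x \<in> V} (f \<circ> (\<lambda>x. x)) \<in> regular (subspace_on X A) {x \<in> points (subspace_on X A). x \<in> V}"
    by (auto simp: subspace_on_def cut_cut cut_apply intro!: exI[of _ V] exI[of _ f])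
qed

text \<open>The points of a product are the pairs of points as soon as \<open>1\<close> is regular on both factors. This condition is
inherited by products, so it applies to \<open>(SL2 \<times> S) \<times> X\<close>, the source of the action.\<close>

definition has_one :: "('x, 'k::field) fspace \<Rightarrow> bool" where
  "has_one X \<longleftrightarrow> cut (points X) (\<lambda>_. 1) \<in> regular X (points X)"

lemma has_one_function_space: "function_space X \<Longrightarrow> has_one X"
  using regular_const[of X "points X" 1] by (simp add: has_one_def)

lemma tensor_single: "f \<in> regular X U \<Longrightarrow> g \<in> regular Y V \<Longrightarrow> (\<lambda>(x, y). f x * g y) \<in> tensors X Y U V"
  unfolding tensors_def
  by (intro CollectI exI[of _ "1::nat"] exI[of _ "\<lambda>_. f"] exI[of _ "\<lambda>_. g"]) auto

lemma prod_basic_open: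
  "openin (top_of X) U \<Longrightarrow> openin (top_of Y) V \<Longrightarrow> h \<in> tensors X Y U V \<Longrightarrow>
     openin (top_of (prod_space X Y)) {z \<in> U \<times> V. h z \<noteq> 0}"
  unfolding prod_space_def by (simp, rule topology_generated_by_Basis) blast

lemma points_prod_space:
  fixes X :: "('x, 'k::field) fspace" and Y :: "('y, 'k) fspace"
  assumes "has_one X" "has_one Y"
  shows "points (prod_space X Y) = points X \<times> points Y"
proof
  show "points (prod_space X Y) \<subseteq> points X \<times> points Y"
    using openin_subset[of "top_of X"] openin_subset[of "top_of Y"]
    by (auto simp: prod_space_def)
  have "points X \<times> points Y \<subseteq>
      {z \<in> points X \<times> points Y. (\<lambda>(x, y). cut (points X) (\<lambda>_. 1 :: 'k) x * cut (points Y) (\<lambda>_. 1) y) z \<noteq> 0}"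
    by (auto simp: cut_def)
  also have "\<dots> \<subseteq> points (prod_space X Y)"
    by (rule openin_subset, rule prod_basic_open) (use assms in \<open>auto simp: has_one_def intro: tensor_single\<close>)
  finally show "points X \<times> points Y \<subseteq> points (prod_space X Y)" .
qed

lemma has_one_prod_space:
  assumes "has_one X" "has_one Y" shows "has_one (prod_space X Y)"
proof -
  let ?W = "points (prod_space X Y)" and ?U = "points X" and ?V = "points Y"
  let ?h = "\<lambda>(x, y). cut ?U (\<lambda>_. 1) x * cut ?V (\<lambda>_. 1) y"
  have t: "?h \<in> tensors X Y ?U ?V" using assms by (auto simp: has_one_def intro: tensor_single)
  have "\<exists>U V. openin (top_of X) U \<and> openin (top_of Y) V \<and> z \<in> U \<times> V \<and>
           (\<exists>h\<in>tensors X Y U V. \<exists>k\<in>tensors X Y U V. k z \<noteq> 0 \<and>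
              (\<forall>w\<in>?W \<inter> U \<times> V. k w \<noteq> 0 \<longrightarrow> cut ?W (\<lambda>_. 1) w = h w / k w))" if "z \<in> ?W" for z
    by (rule exI[of _ ?U], rule exI[of _ ?V], intro conjI bexI[OF _ t])
       (use that in \<open>auto simp: points_prod_space[OF assms] cut_def\<close>)
  then show ?thesis
    unfolding has_one_def by (subst (2) prod_space_def) (auto simp: cut_cut)
qed

lemma morphism_fst:
  fixes X :: "('x, 'k::field) fspace" and Y :: "('y, 'k) fspace"
  assumes X: "function_space X" and Y: "function_space Y"
  shows "morphism (prod_space X Y) X fst"
proof -
  note one = has_one_function_space[OF X] has_one_function_space[OF Y]
  have pre: "{z \<in> points (prod_space X Y). fst z \<in> U} = U \<times> points Y" if "openin (top_of X) U" for U
    using openin_subset[OF that] by (auto simp: points_prod_space[OF one])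
  have t1: "(\<lambda>(x, y). f x * cut (points Y) (\<lambda>_. 1) y) \<in> tensors X Y U (points Y)"
    if "f \<in> regular X U" for f U
    using one(2) that by (auto simp: has_one_def intro: tensor_single)
  have "openin (top_of (prod_space X Y)) (U \<times> points Y)" if U: "openin (top_of X) U" for U
  proof -
    have "{z \<in> U \<times> points Y. (\<lambda>(x, y). cut U (\<lambda>_. 1 :: 'k) x * cut (points Y) (\<lambda>_. 1) y) z \<noteq> 0} = U \<times> points Y"
      by (auto simp: cut_def)
    then show ?thesis using prod_basic_open[OF U _ t1[OF regular_const[OF X U]], of 1] by simp
  qed
  then have "continuous_map (top_of (prod_space X Y)) (top_of X) fst"
    using pre by (auto simp: continuous_map_def points_prod_space[OF one])
  moreover have "cut (U \<times> points Y) (f \<circ> fst) \<in> regular (prod_space X Y) (U \<times> points Y)"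
    if U: "openin (top_of X) U" and f: "f \<in> regular X U" for U f
  proof -
    have "\<exists>U' V'. openin (top_of X) U' \<and> openin (top_of Y) V' \<and> z \<in> U' \<times> V' \<and>
           (\<exists>h\<in>tensors X Y U' V'. \<exists>k\<in>tensors X Y U' V'. k z \<noteq> 0 \<and>
              (\<forall>w\<in>(U \<times> points Y) \<inter> U' \<times> V'. k w \<noteq> 0 \<longrightarrow> cut (U \<times> points Y) (f \<circ> fst) w = h w / k w))"
      if "z \<in> U \<times> points Y" for z
      by (rule exI[of _ U], rule exI[of _ "points Y"],
          intro conjI bexI[OF _ t1[OF f]] bexI[OF _ t1[OF regular_const[OF X U, of 1]]])
         (use that U in \<open>auto simp: cut_def\<close>)
    then show ?thesis
      by (subst prod_space_def) (auto simp: cut_cut)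
  qed
  ultimately show ?thesis using pre by (simp add: morphism_def)
qed

text \<open>A tensor \<open>\<Sum>i. f\<^sub>i(x) g\<^sub>i(y)\<close> pulls back to the sum of products \<open>f\<^sub>i(a(y)) g\<^sub>i(b(y))\<close>,
which is regular on the source; openness and regularity in the product are both defined by tensors.\<close>

lemma morphism_pair:
  assumes Y: "function_space Y" and one: "has_one X1" "has_one X2"
    and a: "morphism Y X1 a" and b: "morphism Y X2 b"
  shows "morphism Y (prod_space X1 X2) (\<lambda>y. (a y, b y))"
proof -
  note sheaf = function_space_sheaf[OF Y]
  define R where "R U V = {y \<in> points Y. a y \<in> U \<and> b y \<in> V}" for U V
  have R_Int: "R U V = {y \<in> points Y. a y \<in> U} \<inter> {y \<in> points Y. b y \<in> V}" for U V
    by (auto simp: R_def)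
  have R: "openin (top_of Y) (R U V)" if "openin (top_of X1) U" "openin (top_of X2) V" for U V
    unfolding R_Int using morphism_preimage_open[OF a that(1)] morphism_preimage_open[OF b that(2)] by blast
  have tens: "cut (R U V) (\<lambda>y. h (a y, b y)) \<in> regular Y (R U V)"
    if U: "openin (top_of X1) U" and V: "openin (top_of X2) V" and h: "h \<in> tensors X1 X2 U V" for U V h
  proof -
    obtain n :: nat and f g where h: "h = (\<lambda>(x, y). \<Sum>i<n. f i x * g i y)"
      and fg: "\<forall>i<n. f i \<in> regular X1 U \<and> g i \<in> regular X2 V"
      using h unfolding tensors_def by blast
    have 1: "cut (R U V) (cut {y \<in> points Y. a y \<in> U} (f i \<circ> a)) \<in> regular Y (R U V)" if "i < n" for i
      by (rule sheaf_restrict[OF sheaf morphism_preimage_open[OF a U] R[OF U V] _ morphism_pullback[OF a U]])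
         (use that fg in \<open>auto simp: R_def\<close>)
    have 2: "cut (R U V) (cut {y \<in> points Y. b y \<in> V} (g i \<circ> b)) \<in> regular Y (R U V)" if "i < n" for i
      by (rule sheaf_restrict[OF sheaf morphism_preimage_open[OF b V] R[OF U V] _ morphism_pullback[OF b V]])
         (use that fg in \<open>auto simp: R_def\<close>)
    have "(\<lambda>y. \<Sum>i\<in>{..<n}. cut (R U V) (cut {y \<in> points Y. a y \<in> U} (f i \<circ> a)) y *
        cut (R U V) (cut {y \<in> points Y. b y \<in> V} (g i \<circ> b)) y) \<in> regular Y (R U V)"
      by (intro regular_sum[OF Y R[OF U V]] regular_mult[OF Y R[OF U V]] 1 2) auto
    also have "(\<lambda>y. \<Sum>i\<in>{..<n}. cut (R U V) (cut {y \<in> points Y. a y \<in> U} (f i \<circ> a)) y *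
        cut (R U V) (cut {y \<in> points Y. b y \<in> V} (g i \<circ> b)) y) = cut (R U V) (\<lambda>y. h (a y, b y))"
      by (auto simp: cut_def h R_def fun_eq_iff)
    finally show ?thesis .
  qed
  have basic: "openin (top_of Y) {y \<in> R U V. h (a y, b y) \<noteq> 0}"
    if "openin (top_of X1) U" "openin (top_of X2) V" "h \<in> tensors X1 X2 U V" for U V h
  proof -
    have "{y \<in> R U V. h (a y, b y) \<noteq> 0} = {y \<in> R U V. cut (R U V) (\<lambda>y. h (a y, b y)) y \<noteq> 0}"
      by (auto simp: cut_def)
    then show ?thesis using nonvanishing_open[OF Y R tens] that by simp
  qed
  have cont: "continuous_map (top_of Y) (top_of (prod_space X1 X2)) (\<lambda>y. (a y, b y))"
  proof -
    let ?S = "{{z \<in> U \<times> V. h z \<noteq> 0} | U V h.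
           openin (top_of X1) U \<and> openin (top_of X2) V \<and> h \<in> tensors X1 X2 U V}"
    have "continuous_map (top_of Y) (topology_generated_by ?S) (\<lambda>y. (a y, b y))"
      unfolding continuous_on_generated_topo_iff
    proof (intro conjI allI impI)
      fix Q assume "Q \<in> ?S"
      then obtain U V h where Q: "Q = {z \<in> U \<times> V. h z \<noteq> 0}" and UVh: "openin (top_of X1) U" "openin (top_of X2) V" "h \<in> tensors X1 X2 U V"
        by blast
      have "(\<lambda>y. (a y, b y)) -` Q \<inter> points Y = {y \<in> R U V. h (a y, b y) \<noteq> 0}"
        by (auto simp: Q R_def)
      then show "openin (top_of Y) ((\<lambda>y. (a y, b y)) -` Q \<inter> points Y)"
        using basic[OF UVh] by simp
    next
      show "(\<lambda>y. (a y, b y)) ` points Y \<subseteq> \<Union> ?S"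
        using points_prod_space[OF one] morphism_points[OF a] morphism_points[OF b]
        by (auto simp: prod_space_def)
    qed
    then show ?thesis by (simp add: prod_space_def)
  qed
  show ?thesis
    unfolding morphism_def
  proof (intro conjI allI impI cont)
    fix W f assume W: "openin (top_of (prod_space X1 X2)) W" and f: "f \<in> regular (prod_space X1 X2) W"
    let ?W = "{y \<in> points Y. (a y, b y) \<in> W}"
    have oW: "openin (top_of Y) ?W" using cont W by (simp add: continuous_map_def)
    show "cut ?W (f \<circ> (\<lambda>y. (a y, b y))) \<in> regular Y ?W"
    proof (rule sheaf_glue[OF sheaf oW])
      fix y assume y: "y \<in> ?W"
      obtain U V h k where UV: "openin (top_of X1) U" "openin (top_of X2) V" "(a y, b y) \<in> U \<times> V"
        and hk: "h \<in> tensors X1 X2 U V" "k \<in> tensors X1 X2 U V" "k (a y, b y) \<noteq> 0"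
          "\<forall>w\<in>W \<inter> U \<times> V. k w \<noteq> 0 \<longrightarrow> f w = h w / k w"
        using f y unfolding prod_space_def by fastforce
      let ?D = "{y \<in> R U V. h (a y, b y) \<noteq> h (a y, b y) + k (a y, b y)}"
      have D: "?D = {y \<in> R U V. k (a y, b y) \<noteq> 0}" by auto
      have D': "{y \<in> R U V. cut (R U V) (\<lambda>y. k (a y, b y)) y \<noteq> 0} = ?D" by (auto simp: cut_def)
      have oD: "openin (top_of Y) ?D" unfolding D by (rule basic[OF UV(1,2) hk(2)])
      have oDW: "openin (top_of Y) (?D \<inter> ?W)" using oD oW by blast
      have 1: "cut (?D \<inter> ?W) (cut (R U V) (\<lambda>y. h (a y, b y))) \<in> regular Y (?D \<inter> ?W)"
        by (rule sheaf_restrict[OF sheaf R[OF UV(1,2)] oDW _ tens[OF UV(1,2) hk(1)]]) auto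
      have 2: "cut (?D \<inter> ?W) (\<lambda>y. inverse (cut (R U V) (\<lambda>y. k (a y, b y)) y)) \<in> regular Y (?D \<inter> ?W)"
        by (rule sheaf_restrict[OF sheaf oD oDW _ regular_inverse[OF Y R[OF UV(1,2)] tens[OF UV(1,2) hk(2)], unfolded D']]) auto
      have "(\<lambda>y. cut (?D \<inter> ?W) (cut (R U V) (\<lambda>y. h (a y, b y))) y *
          cut (?D \<inter> ?W) (\<lambda>y. inverse (cut (R U V) (\<lambda>y. k (a y, b y)) y)) y)
          = cut (?D \<inter> ?W) (cut ?W (f \<circ> (\<lambda>y. (a y, b y))))"
        using hk(4) by (auto simp: cut_def R_def field_simps)
      then have "cut (?D \<inter> ?W) (cut ?W (f \<circ> (\<lambda>y. (a y, b y)))) \<in> regular Y (?D \<inter> ?W)"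
        using regular_mult[OF Y oDW 1 2] by simp
      then show "\<exists>V. openin (top_of Y) V \<and> y \<in> V \<and> V \<subseteq> ?W \<and> cut V (cut ?W (f \<circ> (\<lambda>y. (a y, b y)))) \<in> regular Y V"
        using oDW y UV(3) hk(3) by (intro exI[of _ "?D \<inter> ?W"]) (auto simp: R_def)
    qed (simp add: cut_cut)
  qed
qed

section \<open>Lines\<close>

definition line_minus :: "'k set \<Rightarrow> ('k::field, 'k) fspace" where
  "line_minus N = zariski (UNIV - N) {\<lambda>x. x}"

lemma Ga_var_line: "Ga_var = line_minus {}"
  by (simp add: Ga_var_def line_minus_def)

lemma function_space_line_minus: "function_space (line_minus N)"
  by (simp add: line_minus_def function_space_zariski)

lemma points_line_minus [simp]: "points (line_minus N) = UNIV - N"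
  by (simp add: line_minus_def)

lemma points_Ga_var [simp]: "points (Ga_var :: ('k::field, 'k) fspace) = UNIV"
  by (simp add: Ga_var_def)

lemma polyfuns_line: "p \<in> polyfuns {\<lambda>x. x} \<Longrightarrow> \<exists>q. p = poly q"
proof (induction rule: polyfuns.induct)
  case (const c)
  have "(\<lambda>_. c) = poly [:c:]" by auto
  then show ?case by blast
next
  case (coord f)
  have "f = poly [:0, 1:]" using coord by auto
  then show ?case by blast
next
  case (add f g)
  then obtain p q where "f = poly p" "g = poly q" by blast
  then have "(\<lambda>x. f x + g x) = poly (p + q)" by auto
  then show ?case by blast
next
  case (mult f g)
  then obtain p q where "f = poly p" "g = poly q" by blast
  then have "(\<lambda>x. f x * g x) = poly (p * q)" by auto
  then show ?case by blast
qed

lemma openin_line_minus_cofinite: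
  assumes "finite N" "openin (top_of (line_minus N)) U" "U \<noteq> {}"
  shows "finite (- U)"
proof -
  obtain r x where "r \<in> polyfuns {\<lambda>x. x}" "r x \<noteq> 0" "{y \<in> UNIV - N. r y \<noteq> 0} \<subseteq> U"
    using assms(2,3) unfolding line_minus_def openin_zariski by blast
  moreover then obtain q where "r = poly q" using polyfuns_line by blast
  ultimately have "- U \<subseteq> N \<union> {x. poly q x = 0}" "q \<noteq> 0" by auto
  then show ?thesis using assms(1) poly_roots_finite[of q] finite_subset by blast
qed

lemma line_minus_open_Int:
  fixes U V :: "'k::field_char_0 set"
  assumes "finite N" "openin (top_of (line_minus N)) U" "U \<noteq> {}" "openin (top_of (line_minus N)) V" "V \<noteq> {}"
  shows "U \<inter> V \<noteq> {}"
proof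
  assume "U \<inter> V = {}"
  then have "UNIV \<subseteq> - U \<union> - V" by auto
  then have "finite (UNIV :: 'k set)"
    using openin_line_minus_cofinite[OF assms(1)] assms(2-) finite_subset by (metis finite_Un)
  then show False using infinite_UNIV_char_0 by blast
qed

lemma connected_line_minus:
  fixes N :: "'k::field_char_0 set"
  assumes "finite N" shows "connected_space (top_of (line_minus N))"
  unfolding connected_space_def using line_minus_open_Int[OF assms] by blast

text \<open>A line without finitely many points is irreducible in the Zariski topology, hence so are the images of rational curves;
a union of connected sets with a common point is connected. All connectedness proofs for subgroups go this way.\<close>

lemma connectedin_rational_curves:
  fixes Y :: "('y, 'k::field_char_0) fspace"
  assumes z: "z \<in> S"
    and curves: "\<And>y. y \<in> S \<Longrightarrow> \<exists>N c. finite N \<and> morphism (line_minus N) Y c \<and>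
        c ` (UNIV - N) \<subseteq> S \<and> z \<in> c ` (UNIV - N) \<and> y \<in> c ` (UNIV - N)"
  shows "connectedin (top_of Y) S"
proof -
  let ?C = "{C. connectedin (top_of Y) C \<and> C \<subseteq> S \<and> z \<in> C}"
  have cover: "\<exists>C\<in>?C. y \<in> C" if y: "y \<in> S" for y
  proof -
    obtain N c where c: "finite N" "morphism (line_minus N) Y c" "c ` (UNIV - N) \<subseteq> S" "z \<in> c ` (UNIV - N)" "y \<in> c ` (UNIV - N)"
      using curves[OF y] by blast
    have "connectedin (top_of (line_minus N)) (UNIV - N)"
      using connected_line_minus[OF c(1)] by (metis connectedin_topspace points_line_minus)
    then have "connectedin (top_of Y) (c ` (UNIV - N))"
      using connectedin_continuous_map_image[OF morphism_continuous[OF c(2)]] by blast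
    then show ?thesis using c(3-5) by (intro bexI[of _ "c ` (UNIV - N)"]) simp_all
  qed
  have "\<Union>?C = S"
  proof
    show "\<Union>?C \<subseteq> S" by auto
    show "S \<subseteq> \<Union>?C" using cover by (meson UnionI subsetI)
  qed
  moreover have "connectedin (top_of Y) (\<Union>?C)"
    by (rule connectedin_Union) (use z in auto)
  ultimately show ?thesis by simp
qed

lemma regular_along_curve:
  assumes c: "morphism (line_minus N) X c" and V: "openin (top_of X) V" "h \<in> regular X V"
    and b: "b \<notin> N" "c b \<in> V"
  shows "\<exists>p q. poly q b \<noteq> 0 \<and> (\<forall>a. a \<notin> N \<longrightarrow> poly q a \<noteq> 0 \<longrightarrow> c a \<in> V \<and> h (c a) = poly p a / poly q a)"
proof -
  let ?V = "{a \<in> points (line_minus N). c a \<in> V}"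
  have o: "openin (top_of (line_minus N)) ?V" by (rule morphism_preimage_open[OF c V(1)])
  have r: "cut ?V (h \<circ> c) \<in> regular (line_minus N) ?V" by (rule morphism_pullback[OF c V])
  have bV: "b \<in> ?V" using b by simp
  obtain p q where "p \<in> polyfuns {\<lambda>x. x}" "q \<in> polyfuns {\<lambda>x. x}" "q b \<noteq> 0"
      "\<forall>a\<in>UNIV - N. q a \<noteq> 0 \<longrightarrow> a \<in> ?V \<and> cut ?V (h \<circ> c) a = p a / q a"
    using r bV unfolding line_minus_def regular_zariski[OF o[unfolded line_minus_def]] by fastforce
  moreover then obtain p' q' where "p = poly p'" "q = poly q'" using polyfuns_line by metis
  ultimately have "poly q' b \<noteq> 0 \<and> (\<forall>a. a \<notin> N \<longrightarrow> poly q' a \<noteq> 0 \<longrightarrow> c a \<in> V \<and> h (c a) = poly p' a / poly q' a)"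
    by (auto simp: cut_def)
  then show ?thesis by blast
qed

lemma morphism_Ga:
  assumes "function_space Y"
  shows "morphism Y Ga_var f \<longleftrightarrow> cut (points Y) f \<in> regular Y (points Y)"
proof
  assume f: "morphism Y Ga_var f"
  have "cut UNIV (\<lambda>x. x) \<in> regular Ga_var UNIV"
    unfolding Ga_var_def by (rule regular_polyfun) (simp add: polyfuns.coord)
  then show "cut (points Y) f \<in> regular Y (points Y)"
    using morphism_pullback[OF f, of UNIV "\<lambda>x. x"] openin_topspace[of "top_of (Ga_var :: ('b, 'b) fspace)"]
    by (simp add: cut_def comp_def)
next
  assume "cut (points Y) f \<in> regular Y (points Y)"
  then show "morphism Y Ga_var f"
    unfolding Ga_var_def by (intro morphism_zariskiI[OF assms]) (auto simp: comp_def)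
qed

lemma closedin_zero_set:
  assumes "morphism Y Ga_var f" shows "closedin (top_of Y) {y \<in> points Y. f y = 0}"
proof -
  have "openin (top_of Ga_var) (- {0})"
    unfolding Ga_var_def openin_zariski by (auto intro!: bexI[of _ "\<lambda>x. x"] polyfuns.coord)
  from morphism_preimage_open[OF assms this]
  show ?thesis unfolding closedin_def
    by (auto elim: back_subst[of "openin (top_of Y)"])
qed

section \<open>Derivatives of rational functions\<close>

lemma has_deriv_at_0_quotient:
  assumes "poly q 0 \<noteq> 0" "\<And>a. poly q a \<noteq> 0 \<Longrightarrow> h a = poly p a / poly q a"
  shows "has_deriv_at_0 h ((poly (pderiv p) 0 * poly q 0 - poly p 0 * poly (pderiv q) 0) / (poly q 0)\<^sup>2)"
  unfolding has_deriv_at_0_def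
  by (rule exI[of _ p], rule exI[of _ q], rule exI[of _ "{a. poly q a = 0}"])
     (use assms poly_roots_finite[of q] in \<open>cases "q = 0"; auto\<close>)

text \<open>Two representations \<open>p / q\<close> and \<open>r / s\<close> of the same function satisfy \<open>p s = r q\<close> at infinitely many points,
hence as polynomials; differentiating this identity at \<open>0\<close> gives the claim. It makes the definite description in the
infinitesimal action computable.\<close>

lemma has_deriv_at_0_unique:
  fixes h :: "'k::field_char_0 \<Rightarrow> 'k"
  assumes "has_deriv_at_0 h d" "has_deriv_at_0 h e" shows "d = e"
proof -
  obtain p q N where 1: "finite N" "0 \<notin> N" "\<And>a. a \<notin> N \<Longrightarrow> poly q a \<noteq> 0 \<and> h a = poly p a / poly q a"
      "d = (poly (pderiv p) 0 * poly q 0 - poly p 0 * poly (pderiv q) 0) / (poly q 0)\<^sup>2"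
    using assms(1) unfolding has_deriv_at_0_def by blast
  obtain r s M where 2: "finite M" "0 \<notin> M" "\<And>a. a \<notin> M \<Longrightarrow> poly s a \<noteq> 0 \<and> h a = poly r a / poly s a"
      "e = (poly (pderiv r) 0 * poly s 0 - poly r 0 * poly (pderiv s) 0) / (poly s 0)\<^sup>2"
    using assms(2) unfolding has_deriv_at_0_def by blast
  have "poly (p * s) a = poly (r * q) a" if "a \<notin> N \<union> M" for a
    using 1(3)[of a] 2(3)[of a] that by (simp add: field_simps)
  then have "\<not> finite {a. poly (p * s - r * q) a = 0}"
    using 1(1) 2(1) infinite_UNIV_char_0[where 'a='k] finite_subset[of "- (N \<union> M)" "{a. poly (p * s - r * q) a = 0}"]
    by (auto simp: Compl_eq_Diff_UNIV)
  then have eq: "p * s = r * q" using poly_roots_finite[of "p * s - r * q"] by fastforce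
  have q0: "poly q 0 \<noteq> 0" and s0: "poly s 0 \<noteq> 0" using 1 2 by auto
  let ?p = "poly p 0" and ?q = "poly q 0" and ?r = "poly r 0" and ?s = "poly s 0"
  let ?p' = "poly (pderiv p) 0" and ?q' = "poly (pderiv q) 0" and ?r' = "poly (pderiv r) 0" and ?s' = "poly (pderiv s) 0"
  have v: "?p * ?s = ?r * ?q" using arg_cong[OF eq, of "\<lambda>f. poly f 0"] by simp
  have d: "?p * ?s' + ?s * ?p' = ?r * ?q' + ?q * ?r'"
    using arg_cong[OF eq, of "\<lambda>f. poly (pderiv f) 0"] by (simp add: pderiv_mult)
  have r: "?r = ?p * ?s / ?q" using v q0 by (simp add: field_simps)
  have "?q * ?r' = ?p * ?s' + ?s * ?p' - ?r * ?q'" using d by (simp add: algebra_simps)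
  then have r': "?r' = (?p * ?s' + ?s * ?p' - ?p * ?s / ?q * ?q') / ?q"
    using q0 unfolding r by (simp add: field_simps)
  show ?thesis
    unfolding 1(4) 2(4) r r' using q0 s0 by (simp add: field_simps power2_eq_square)
qed

lemma has_deriv_at_0_cong:
  assumes "has_deriv_at_0 h d" "finite N" "0 \<notin> N" "\<And>a. a \<notin> N \<Longrightarrow> g a = h a"
  shows "has_deriv_at_0 g d"
proof -
  obtain p q M where "finite M" "0 \<notin> M" "\<forall>a. a \<notin> M \<longrightarrow> poly q a \<noteq> 0 \<and> h a = poly p a / poly q a"
      "d = (poly (pderiv p) 0 * poly q 0 - poly p 0 * poly (pderiv q) 0) / (poly q 0)\<^sup>2"
    using assms(1) unfolding has_deriv_at_0_def by blast
  then show ?thesis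
    unfolding has_deriv_at_0_def using assms(2-4)
    by (intro exI[of _ p] exI[of _ q] exI[of _ "M \<union> N"]) simp
qed

lemma has_deriv_at_0_scale:
  assumes "has_deriv_at_0 h d" shows "has_deriv_at_0 (\<lambda>a. h (c * a)) (c * d)"
proof -
  obtain p q M where M: "finite M" "0 \<notin> M" "\<forall>a. a \<notin> M \<longrightarrow> poly q a \<noteq> 0 \<and> h a = poly p a / poly q a"
      and d: "d = (poly (pderiv p) 0 * poly q 0 - poly p 0 * poly (pderiv q) 0) / (poly q 0)\<^sup>2"
    using assms unfolding has_deriv_at_0_def by blast
  have "finite {a. c * a \<in> M}"
  proof (cases "c = 0")
    case False
    then have "inj_on (\<lambda>a. c * a) {a. c * a \<in> M}" by (simp add: inj_on_def)
    moreover have "(\<lambda>a. c * a) ` {a. c * a \<in> M} \<subseteq> M" by auto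
    ultimately show ?thesis using M(1) finite_subset by (metis finite_imageD)
  qed (use M(2) in simp)
  then show ?thesis
    unfolding has_deriv_at_0_def d using M
    by (intro exI[of _ "pcompose p [:0, c:]"] exI[of _ "pcompose q [:0, c:]"] exI[of _ "{a. c * a \<in> M}"])
       (simp add: poly_pcompose pderiv_pcompose pderiv_pCons algebra_simps)
qed

definition plane_coords :: "('k::field^2 \<Rightarrow> 'k) set" where
  "plane_coords = {\<lambda>p. p $ i | i. True}"

text \<open>The derivative of \<open>P\<close> in the direction \<open>v\<close>, expressed through the restrictions of \<open>P\<close> to lines because
\<open>has_deriv_at_0\<close> is about functions of one variable.\<close>

definition polynomial_derivative :: "'k::field^2 \<Rightarrow> ('k^2 \<Rightarrow> 'k) \<Rightarrow> ('k^2 \<Rightarrow> 'k) \<Rightarrow> bool" where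
  "polynomial_derivative v P P' \<longleftrightarrow>
     (\<forall>p. \<exists>r. (\<forall>a. P (p + a *s v) = poly r a) \<and> poly (pderiv r) 0 = P' p)"

lemma polynomial_derivative_const: "polynomial_derivative v (\<lambda>_. c) (\<lambda>_. 0)"
  unfolding polynomial_derivative_def by (intro allI exI[of _ "[:c:]"]) simp

lemma polynomial_derivative_coord: "polynomial_derivative v (\<lambda>p. p $ i) (\<lambda>_. v $ i)"
  unfolding polynomial_derivative_def
proof
  fix p :: "'a^2"
  show "\<exists>r. (\<forall>a. (p + a *s v) $ i = poly r a) \<and> poly (pderiv r) 0 = v $ i"
    by (rule exI[of _ "[:p $ i, v $ i:]"]) (simp add: pderiv_pCons)
qed

lemma polynomial_derivative_add:
  assumes "polynomial_derivative v P P'" "polynomial_derivative v Q Q'"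
  shows "polynomial_derivative v (\<lambda>p. P p + Q p) (\<lambda>p. P' p + Q' p)"
  unfolding polynomial_derivative_def
proof
  fix p
  obtain r s where "\<forall>a. P (p + a *s v) = poly r a" "poly (pderiv r) 0 = P' p"
      "\<forall>a. Q (p + a *s v) = poly s a" "poly (pderiv s) 0 = Q' p"
    using assms unfolding polynomial_derivative_def by meson
  then show "\<exists>r. (\<forall>a. P (p + a *s v) + Q (p + a *s v) = poly r a) \<and> poly (pderiv r) 0 = P' p + Q' p"
    by (intro exI[of _ "r + s"]) (simp add: pderiv_add)
qed

lemma polynomial_derivative_mult:
  assumes "polynomial_derivative v P P'" "polynomial_derivative v Q Q'"
  shows "polynomial_derivative v (\<lambda>p. P p * Q p) (\<lambda>p. P p * Q' p + Q p * P' p)"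
  unfolding polynomial_derivative_def
proof
  fix p
  obtain r s where "\<forall>a. P (p + a *s v) = poly r a" "poly (pderiv r) 0 = P' p"
      "\<forall>a. Q (p + a *s v) = poly s a" "poly (pderiv s) 0 = Q' p"
    using assms unfolding polynomial_derivative_def by meson
  moreover from this have "P p = poly r 0" "Q p = poly s 0"
    by (metis add.right_neutral vector_smult_lzero)+
  ultimately show "\<exists>r. (\<forall>a. P (p + a *s v) * Q (p + a *s v) = poly r a) \<and> poly (pderiv r) 0 = P p * Q' p + Q p * P' p"
    by (intro exI[of _ "r * s"]) (simp add: pderiv_mult)
qed

text \<open>Induction on the construction of \<open>P\<close>: applied twice, the product rule gives
\<open>P Q\<^sub>v\<^sub>w + P\<^sub>w Q\<^sub>v + Q P\<^sub>v\<^sub>w + Q\<^sub>w P\<^sub>v\<close>, which is symmetric in \<open>v\<close> and \<open>w\<close>.\<close>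

lemma polynomial_derivatives_commute:
  assumes "P \<in> polyfuns plane_coords"
  shows "\<exists>Pv Pw Pvw. polynomial_derivative v P Pv \<and> polynomial_derivative w P Pw \<and>
    polynomial_derivative w Pv Pvw \<and> polynomial_derivative v Pw Pvw"
  using assms
proof induction
  case (const c)
  then show ?case
    by (intro exI[of _ "\<lambda>_. 0"]) (simp add: polynomial_derivative_const)
next
  case (coord f)
  then obtain i where f: "f = (\<lambda>p. p $ i)" by (auto simp: plane_coords_def)
  show ?case
    unfolding f
    by (rule exI[of _ "\<lambda>_. v $ i"], rule exI[of _ "\<lambda>_. w $ i"], rule exI[of _ "\<lambda>_. 0"])
       (simp add: polynomial_derivative_const polynomial_derivative_coord)
next
  case (add P Q)
  then obtain Pv Pw Pvw Qv Qw Qvw where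
    "polynomial_derivative v P Pv" "polynomial_derivative w P Pw" "polynomial_derivative w Pv Pvw" "polynomial_derivative v Pw Pvw"
    "polynomial_derivative v Q Qv" "polynomial_derivative w Q Qw" "polynomial_derivative w Qv Qvw" "polynomial_derivative v Qw Qvw"
    by blast
  then show ?case
    by (intro exI[of _ "\<lambda>p. Pv p + Qv p"] exI[of _ "\<lambda>p. Pw p + Qw p"] exI[of _ "\<lambda>p. Pvw p + Qvw p"])
       (simp add: polynomial_derivative_add)
next
  case (mult P Q)
  then obtain Pv Pw Pvw Qv Qw Qvw where
    *: "polynomial_derivative v P Pv" "polynomial_derivative w P Pw" "polynomial_derivative w Pv Pvw" "polynomial_derivative v Pw Pvw"
    "polynomial_derivative v Q Qv" "polynomial_derivative w Q Qw" "polynomial_derivative w Qv Qvw" "polynomial_derivative v Qw Qvw"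
    by blast
  have 1: "polynomial_derivative w (\<lambda>p. P p * Qv p + Q p * Pv p)
      (\<lambda>p. (P p * Qvw p + Qv p * Pw p) + (Q p * Pvw p + Pv p * Qw p))"
    by (intro polynomial_derivative_add polynomial_derivative_mult *)
  have "polynomial_derivative v (\<lambda>p. P p * Qw p + Q p * Pw p)
      (\<lambda>p. (P p * Qvw p + Qw p * Pv p) + (Q p * Pvw p + Pw p * Qv p))"
    by (intro polynomial_derivative_add polynomial_derivative_mult *)
  moreover have "(\<lambda>p. (P p * Qvw p + Qw p * Pv p) + (Q p * Pvw p + Pw p * Qv p))
      = (\<lambda>p. (P p * Qvw p + Qv p * Pw p) + (Q p * Pvw p + Pv p * Qw p))"
    by (simp add: algebra_simps)
  ultimately show ?case
    using 1
    by (intro exI[of _ "\<lambda>p. P p * Qv p + Q p * Pv p"] exI[of _ "\<lambda>p. P p * Qw p + Q p * Pw p"]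
          exI[of _ "\<lambda>p. (P p * Qvw p + Qv p * Pw p) + (Q p * Pvw p + Pv p * Qw p)"] conjI
          polynomial_derivative_mult *) simp_all
qed

lemma has_deriv_at_0_polynomial_quotient:
  assumes "polynomial_derivative v P Pv" "polynomial_derivative v Q Qv" "Q p \<noteq> 0"
    and F: "\<And>p. Q p \<noteq> 0 \<Longrightarrow> F p = P p / Q p"
  shows "has_deriv_at_0 (\<lambda>a. F (p + a *s v)) ((Pv p * Q p - P p * Qv p) / (Q p)\<^sup>2)"
proof -
  obtain r s where rs: "\<forall>a. P (p + a *s v) = poly r a" "poly (pderiv r) 0 = Pv p"
      "\<forall>a. Q (p + a *s v) = poly s a" "poly (pderiv s) 0 = Qv p"
    using assms(1,2) unfolding polynomial_derivative_def by meson
  then have 0: "P p = poly r 0" "Q p = poly s 0"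
    by (metis add.right_neutral vector_smult_lzero)+
  show ?thesis
    unfolding 0 rs(2,4)[symmetric]
    by (rule has_deriv_at_0_quotient) (use 0 assms(3) rs F in auto)
qed

text \<open>\<open>G1\<close> and \<open>G2\<close> stand for \<open>c1 \<partial>\<^sub>v F\<close> and \<open>c2 \<partial>\<^sub>w F\<close>, which are again rational; applying
the quotient rule twice to \<open>F = P / Q\<close> leads to an expression \<open>e\<close> that is symmetric in \<open>v\<close> and \<open>w\<close>.\<close>

lemma directional_derivatives_commute:
  fixes F :: "'k::field_char_0^2 \<Rightarrow> 'k"
  assumes P: "P \<in> polyfuns plane_coords" and Q: "Q \<in> polyfuns plane_coords" and Q0: "Q p\<^sub>0 \<noteq> 0"
    and F: "\<And>p. Q p \<noteq> 0 \<Longrightarrow> F p = P p / Q p"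
    and G1: "\<And>p. Q p \<noteq> 0 \<Longrightarrow> \<exists>d. has_deriv_at_0 (\<lambda>a. F (p + a *s v)) d \<and> G1 p = c1 * d"
    and G2: "\<And>p. Q p \<noteq> 0 \<Longrightarrow> \<exists>d. has_deriv_at_0 (\<lambda>a. F (p + a *s w)) d \<and> G2 p = c2 * d"
  shows "\<exists>e. has_deriv_at_0 (\<lambda>a. G1 (p\<^sub>0 + a *s w)) (c1 * e) \<and> has_deriv_at_0 (\<lambda>a. G2 (p\<^sub>0 + a *s v)) (c2 * e)"
proof -
  obtain Pv Pw Pvw where DP: "polynomial_derivative v P Pv" "polynomial_derivative w P Pw"
      "polynomial_derivative w Pv Pvw" "polynomial_derivative v Pw Pvw"
    using polynomial_derivatives_commute[OF P] by blast
  obtain Qv Qw Qvw where DQ: "polynomial_derivative v Q Qv" "polynomial_derivative w Q Qw"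
      "polynomial_derivative w Qv Qvw" "polynomial_derivative v Qw Qvw"
    using polynomial_derivatives_commute[OF Q] by blast
  have G1': "G1 p = c1 * ((Pv p * Q p - P p * Qv p) / (Q p)\<^sup>2)" if "Q p \<noteq> 0" for p
    using has_deriv_at_0_unique[OF has_deriv_at_0_polynomial_quotient[OF DP(1) DQ(1) that F]] G1[OF that] by blast
  have G2': "G2 p = c2 * ((Pw p * Q p - P p * Qw p) / (Q p)\<^sup>2)" if "Q p \<noteq> 0" for p
    using has_deriv_at_0_unique[OF has_deriv_at_0_polynomial_quotient[OF DP(2) DQ(2) that F]] G2[OF that] by blast
  define N1 where "N1 = (\<lambda>p. c1 * (Pv p * Q p + - 1 * (P p * Qv p)))"
  define N2 where "N2 = (\<lambda>p. c2 * (Pw p * Q p + - 1 * (P p * Qw p)))"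
  define D where "D = (\<lambda>p. Q p * Q p)"
  define N1' where "N1' = (\<lambda>p. c1 * ((Pv p * Qw p + Q p * Pvw p) + (- 1 * (P p * Qvw p + Qv p * Pw p) + (P p * Qv p) * 0)) + (Pv p * Q p + - 1 * (P p * Qv p)) * 0)"
  define N2' where "N2' = (\<lambda>p. c2 * ((Pw p * Qv p + Q p * Pvw p) + (- 1 * (P p * Qvw p + Qw p * Pv p) + (P p * Qw p) * 0)) + (Pw p * Q p + - 1 * (P p * Qw p)) * 0)"
  have N1: "polynomial_derivative w N1 N1'" unfolding N1_def N1'_def
    by (intro polynomial_derivative_mult polynomial_derivative_add polynomial_derivative_const DP DQ)
  have N2: "polynomial_derivative v N2 N2'" unfolding N2_def N2'_def
    by (intro polynomial_derivative_mult polynomial_derivative_add polynomial_derivative_const DP DQ)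
  have Dw: "polynomial_derivative w D (\<lambda>p. Q p * Qw p + Q p * Qw p)" unfolding D_def
    by (intro polynomial_derivative_mult DQ)
  have Dv: "polynomial_derivative v D (\<lambda>p. Q p * Qv p + Q p * Qv p)" unfolding D_def
    by (intro polynomial_derivative_mult DQ)
  have D0: "D p\<^sub>0 \<noteq> 0" using Q0 by (simp add: D_def)
  let ?d = "\<lambda>f. f p\<^sub>0"
  define e where "e = (?d Pvw * ?d Q * ?d Q - ?d P * ?d Qvw * ?d Q - ?d Pw * ?d Qv * ?d Q - ?d Pv * ?d Qw * ?d Q
      + 2 * ?d P * ?d Qv * ?d Qw) / (?d Q)^3"
  have "has_deriv_at_0 (\<lambda>a. G1 (p\<^sub>0 + a *s w)) ((N1' p\<^sub>0 * D p\<^sub>0 - N1 p\<^sub>0 * (Q p\<^sub>0 * Qw p\<^sub>0 + Q p\<^sub>0 * Qw p\<^sub>0)) / (D p\<^sub>0)\<^sup>2)"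
    by (rule has_deriv_at_0_polynomial_quotient[OF N1 Dw D0])
       (simp add: G1' D_def N1_def power2_eq_square)
  also have "(N1' p\<^sub>0 * D p\<^sub>0 - N1 p\<^sub>0 * (Q p\<^sub>0 * Qw p\<^sub>0 + Q p\<^sub>0 * Qw p\<^sub>0)) / (D p\<^sub>0)\<^sup>2 = c1 * e"
    using Q0 by (simp add: N1'_def N1_def D_def e_def field_simps power2_eq_square power3_eq_cube)
  finally have 1: "has_deriv_at_0 (\<lambda>a. G1 (p\<^sub>0 + a *s w)) (c1 * e)" .
  have "has_deriv_at_0 (\<lambda>a. G2 (p\<^sub>0 + a *s v)) ((N2' p\<^sub>0 * D p\<^sub>0 - N2 p\<^sub>0 * (Q p\<^sub>0 * Qv p\<^sub>0 + Q p\<^sub>0 * Qv p\<^sub>0)) / (D p\<^sub>0)\<^sup>2)"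
    by (rule has_deriv_at_0_polynomial_quotient[OF N2 Dv D0])
       (simp add: G2' D_def N2_def power2_eq_square)
  also have "(N2' p\<^sub>0 * D p\<^sub>0 - N2 p\<^sub>0 * (Q p\<^sub>0 * Qv p\<^sub>0 + Q p\<^sub>0 * Qv p\<^sub>0)) / (D p\<^sub>0)\<^sup>2 = c2 * e"
    using Q0 by (simp add: N2'_def N2_def D_def e_def field_simps power2_eq_square power3_eq_cube)
  finally show ?thesis using 1 by blast
qed

section \<open>Two by two matrices\<close>

definition mat2 :: "'k \<Rightarrow> 'k \<Rightarrow> 'k \<Rightarrow> 'k \<Rightarrow> 'k^2^2" where
  "mat2 a b c d = (\<chi> i j. if i = 1 then if j = 1 then a else b else if j = 1 then c else d)"

lemma mat2_nth [simp]:
  "mat2 a b c d $ 1 $ 1 = a" "mat2 a b c d $ 1 $ 2 = b" "mat2 a b c d $ 2 $ 1 = c" "mat2 a b c d $ 2 $ 2 = d"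
  by (simp_all add: mat2_def)

lemma mat2_eqI:
  fixes A B :: "'k^2^2"
  assumes "A $ 1 $ 1 = B $ 1 $ 1" "A $ 1 $ 2 = B $ 1 $ 2" "A $ 2 $ 1 = B $ 2 $ 1" "A $ 2 $ 2 = B $ 2 $ 2"
  shows "A = B"
  using assms by (simp add: vec_eq_iff forall_2)

lemma mat2_entries: "mat2 (A $ 1 $ 1) (A $ 1 $ 2) (A $ 2 $ 1) (A $ 2 $ 2) = A"
  by (rule mat2_eqI) simp_all

lemma mat2_cases: obtains a b c d where "A = mat2 a b c d"
  using mat2_entries[of A] by metis

lemma mat2_inject [simp]: "mat2 a b c d = mat2 a' b' c' d' \<longleftrightarrow> a = a' \<and> b = b' \<and> c = c' \<and> d = d'"
  by (metis mat2_nth)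

lemma mat2_mult [simp]:
  "mat2 a b c d ** mat2 a' b' c' d' =
     mat2 (a * a' + b * c') (a * b' + b * d') (c * a' + d * c') (c * b' + d * d')"
  by (rule mat2_eqI) (simp_all add: matrix_matrix_mult_def sum_2)

lemma mat_1_mat2: "mat 1 = mat2 1 0 0 1"
  by (rule mat2_eqI) (simp_all add: mat_def)

lemma det_mat2 [simp]: "det (mat2 a b c d) = a * d - b * c"
  by (simp add: det_2)

lemma mat2_diff: "mat2 a b c d - mat2 a' b' c' d' = mat2 (a - a') (b - b') (c - c') (d - d')"
  by (rule mat2_eqI) simp_all

definition vec2 :: "'k \<Rightarrow> 'k \<Rightarrow> 'k^2" where
  "vec2 a b = (\<chi> i. if i = 1 then a else b)"

lemma vec2_nth [simp]: "vec2 a b $ 1 = a" "vec2 a b $ 2 = b"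
  by (simp_all add: vec2_def)

lemma vec2_entries: "vec2 (p $ 1) (p $ 2) = p"
  by (simp add: vec_eq_iff forall_2)

lemma vec2_inject [simp]: "vec2 a b = vec2 a' b' \<longleftrightarrow> a = a' \<and> b = b'"
  by (metis vec2_nth)

lemma mat2_vec2 [simp]: "mat2 a b c d *v vec2 x y = vec2 (a * x + b * y) (c * x + d * y)"
  by (simp add: vec_eq_iff forall_2 matrix_vector_mult_def sum_2)

lemma carrier_SL2: "carrier SL2 = {A. det A = 1}" by (simp add: SL2_def)
lemma mult_SL2 [simp]: "A \<otimes>\<^bsub>SL2\<^esub> B = A ** B" by (simp add: SL2_def)
lemma one_SL2 [simp]: "\<one>\<^bsub>SL2\<^esub> = mat 1" by (simp add: SL2_def)

text \<open>The adjugate, which is the inverse for matrices of determinant \<open>1\<close>.\<close>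

definition adj2 :: "'k::ab_group_add^2^2 \<Rightarrow> 'k^2^2" where
  "adj2 A = mat2 (A $ 2 $ 2) (- (A $ 1 $ 2)) (- (A $ 2 $ 1)) (A $ 1 $ 1)"

lemma adj2_mat2 [simp]: "adj2 (mat2 a b c d) = mat2 d (- b) (- c) a"
  by (simp add: adj2_def)

lemma adj2_mult:
  fixes A :: "'k::field^2^2" assumes "det A = 1" shows "A ** adj2 A = mat 1" "adj2 A ** A = mat 1"
proof -
  obtain a b c d where "A = mat2 a b c d" by (rule mat2_cases)
  then show "A ** adj2 A = mat 1" "adj2 A ** A = mat 1"
    using assms by (simp_all add: mat_1_mat2 algebra_simps)
qed

lemma det_adj2: fixes A :: "'k::field^2^2" shows "det (adj2 A) = det A"
  by (rule mat2_cases[of A]) simp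

lemma group_SL2: "group (SL2 :: ('k::field^2^2) monoid)"
proof (rule groupI)
  fix A B C :: "'k^2^2"
  assume A: "A \<in> carrier SL2"
  show "\<exists>B\<in>carrier SL2. B \<otimes>\<^bsub>SL2\<^esub> A = \<one>\<^bsub>SL2\<^esub>"
    using A by (intro bexI[of _ "adj2 A"]) (auto simp: carrier_SL2 adj2_mult det_adj2)
qed (auto simp: carrier_SL2 det_mul matrix_mul_assoc)

lemma inv_SL2: "det A = 1 \<Longrightarrow> inv\<^bsub>SL2\<^esub> A = adj2 A" for A :: "'k::field^2^2"
  by (intro group.inv_equality[OF group_SL2]) (auto simp: carrier_SL2 adj2_mult det_adj2)

section \<open>Regular functions and matrices of them\<close>

lemma function_space_Ga: "function_space Ga_var"
  by (simp add: Ga_var_def function_space_zariski)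

lemma morphism_Ga_const: "function_space Y \<Longrightarrow> morphism Y Ga_var (\<lambda>_. c)"
  by (rule morphism_const) simp_all

lemma morphism_Ga_add:
  assumes Y: "function_space Y" and "morphism Y Ga_var f" "morphism Y Ga_var g"
  shows "morphism Y Ga_var (\<lambda>y. f y + g y)"
proof -
  have "(\<lambda>y. cut (points Y) f y + cut (points Y) g y) = cut (points Y) (\<lambda>y. f y + g y)"
    by (auto simp: cut_def)
  then show ?thesis
    using assms(2,3) regular_add[OF Y openin_topspace] unfolding morphism_Ga[OF Y] by metis
qed

lemma morphism_Ga_mult:
  assumes Y: "function_space Y" and "morphism Y Ga_var f" "morphism Y Ga_var g"
  shows "morphism Y Ga_var (\<lambda>y. f y * g y)"
proof -
  have "(\<lambda>y. cut (points Y) f y * cut (points Y) g y) = cut (points Y) (\<lambda>y. f y * g y)"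
    by (auto simp: cut_def)
  then show ?thesis
    using assms(2,3) regular_mult[OF Y openin_topspace] unfolding morphism_Ga[OF Y] by metis
qed

lemma morphism_Ga_sum:
  assumes Y: "function_space Y" and "\<And>i. i \<in> I \<Longrightarrow> morphism Y Ga_var (f i)"
  shows "morphism Y Ga_var (\<lambda>y. \<Sum>i\<in>I. f i y)"
  using assms(2)
  by (induction I rule: infinite_finite_induct) (auto intro: morphism_Ga_const morphism_Ga_add Y)

lemma morphism_Ga_inverse:
  assumes Y: "function_space Y" and f: "morphism Y Ga_var f" and nz: "\<And>y. y \<in> points Y \<Longrightarrow> f y \<noteq> 0"
  shows "morphism Y Ga_var (\<lambda>y. inverse (f y))"
proof -
  have "{y \<in> points Y. cut (points Y) f y \<noteq> 0} = points Y" using nz by (auto simp: cut_def)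
  moreover have "(\<lambda>y. inverse (cut (points Y) f y)) = cut (points Y) (\<lambda>y. inverse (f y))"
    by (auto simp: cut_def)
  ultimately show ?thesis
    using f regular_inverse[OF Y openin_topspace] unfolding morphism_Ga[OF Y] by metis
qed

lemma morphism_Ga_diff:
  assumes Y: "function_space Y" and "morphism Y Ga_var f" "morphism Y Ga_var g"
  shows "morphism Y Ga_var (\<lambda>y. f y - g y)"
  using morphism_Ga_add[OF Y assms(2) morphism_Ga_mult[OF Y morphism_Ga_const[OF Y, of "- 1"] assms(3)]]
  by simp

lemma morphism_Ga_coord: "f \<in> C \<Longrightarrow> morphism (zariski P C) Ga_var f"
  by (subst morphism_Ga[OF function_space_zariski]) (simp add: regular_polyfun polyfuns.coord)

lemma morphism_Ga_line: "morphism (line_minus N) Ga_var (\<lambda>a. a)"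
  unfolding line_minus_def by (rule morphism_Ga_coord) simp

definition regular_matrix :: "('y, 'k::field) fspace \<Rightarrow> ('y \<Rightarrow> 'k^2^2) \<Rightarrow> bool" where
  "regular_matrix Y A \<longleftrightarrow> (\<forall>i j. morphism Y Ga_var (\<lambda>y. A y $ i $ j))"

lemma regular_matrix_const: "function_space Y \<Longrightarrow> regular_matrix Y (\<lambda>_. A)"
  by (simp add: regular_matrix_def morphism_Ga_const)

lemma regular_matrix_mat2:
  assumes "morphism Y Ga_var a" "morphism Y Ga_var b" "morphism Y Ga_var c" "morphism Y Ga_var d"
  shows "regular_matrix Y (\<lambda>y. mat2 (a y) (b y) (c y) (d y))"
  using assms by (simp add: regular_matrix_def forall_2)

lemma regular_matrix_mult:
  assumes Y: "function_space Y" and "regular_matrix Y A" "regular_matrix Y B"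
  shows "regular_matrix Y (\<lambda>y. A y ** B y)"
  unfolding regular_matrix_def matrix_matrix_mult_def
  using assms(2,3) by (auto simp: regular_matrix_def intro!: morphism_Ga_sum[OF Y] morphism_Ga_mult[OF Y])

lemma function_space_SL2: "function_space SL2_var"
  by (simp add: SL2_var_def function_space_zariski)

lemma points_SL2 [simp]: "points SL2_var = {A. det A = 1}"
  by (simp add: SL2_var_def)

lemma regular_matrix_SL2: "regular_matrix SL2_var (\<lambda>A. A)"
  unfolding regular_matrix_def SL2_var_def by (auto intro!: morphism_Ga_coord)

lemma morphism_SL2I:
  assumes Y: "function_space Y" and A: "regular_matrix Y A" and det: "\<And>y. y \<in> points Y \<Longrightarrow> det (A y) = 1"
  shows "morphism Y SL2_var A"
  unfolding SL2_var_def
  by (rule morphism_zariskiI[OF Y])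
     (use A det in \<open>auto simp: regular_matrix_def morphism_Ga[OF Y] comp_def\<close>)

text \<open>A point is the preimage of the closed diagonal under \<open>y \<mapsto> (y, x)\<close>.\<close>

lemma closedin_singleton:
  assumes X: "variety X" and x: "x \<in> points X" shows "closedin (top_of X) {x}"
proof -
  note fs = function_space_variety[OF X]
  have m: "morphism X (prod_space X X) (\<lambda>y. (y, x))"
    using morphism_pair[OF fs has_one_function_space[OF fs] has_one_function_space[OF fs] morphism_id[OF fs] morphism_const[OF fs x]] .
  have "closedin (top_of X) {y \<in> points X. (y, x) \<in> {(z, z) | z. z \<in> points X}}"
    using closedin_continuous_map_preimage[OF morphism_continuous[OF m]] X unfolding variety_def by blast
  also have "{y \<in> points X. (y, x) \<in> {(z, z) | z. z \<in> points X}} = {x}" using x by auto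
  finally show ?thesis .
qed

section \<open>The group\<close>

lemma torus_comm_group:
  assumes "torus S VS" shows "comm_group S"
proof -
  obtain r and \<phi> :: "(nat \<Rightarrow> 'b) \<Rightarrow> 'a" where \<phi>: "\<phi> \<in> iso (Gm_pow r) S"
    using assms unfolding torus_def alg_group_iso_def by blast
  interpret group S using assms by (simp add: torus_def algebraic_group_def)
  show ?thesis
  proof (rule group_comm_groupI)
    fix x y assume "x \<in> carrier S" "y \<in> carrier S"
    moreover have im: "\<phi> ` carrier (Gm_pow r) = carrier S" using \<phi> unfolding iso_def bij_betw_def by blast
    ultimately have "x \<in> \<phi> ` carrier (Gm_pow r)" "y \<in> \<phi> ` carrier (Gm_pow r)" by simp_all
    then obtain a b where ab: "a \<in> carrier (Gm_pow r)" "b \<in> carrier (Gm_pow r)" "x = \<phi> a" "y = \<phi> b"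
      by (elim imageE)
    then show "x \<otimes>\<^bsub>S\<^esub> y = y \<otimes>\<^bsub>S\<^esub> x"
      using hom_mult[of \<phi> "Gm_pow r" S a b] hom_mult[of \<phi> "Gm_pow r" S b a] \<phi>
      by (simp add: iso_def Gm_def mult.commute cong: restrict_cong)
  qed
qed

text \<open>In coordinates \<open>t\<^sub>i\<close> the segment \<open>1 + a (t\<^sub>i - 1)\<close> leads from the identity to \<open>t\<close>; the values
\<open>a\<close> at which one of these coordinates vanishes form the finite set \<open>N\<close>.\<close>

lemma torus_rational_curve:
  fixes S :: "'s monoid" and VS :: "('s, 'k::field) fspace"
  assumes S: "torus S VS" and s: "s \<in> carrier S"
  shows "\<exists>N c. finite N \<and> 0 \<notin> N \<and> 1 \<notin> N \<and> morphism (line_minus N) VS c \<and> c 0 = \<one>\<^bsub>S\<^esub> \<and> c 1 = s"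
proof -
  obtain r and \<phi> :: "(nat \<Rightarrow> 'k) \<Rightarrow> 's" where \<phi>: "\<phi> \<in> iso (Gm_pow r) S" and iso: "isomorphism (Gm_pow_var r) VS \<phi>"
    using S unfolding torus_def alg_group_iso_def by blast
  interpret group S using S by (simp add: torus_def algebraic_group_def)
  obtain t where t: "t \<in> carrier (Gm_pow r)" "s = \<phi> t"
    using \<phi> s unfolding iso_def bij_betw_def by auto
  have t0: "t i \<noteq> 0" if "i < r" for i using t(1) that by (auto simp: Gm_def PiE_iff)
  define N where "N = (\<Union>i<r. {a. poly [:1, t i - 1:] a = 0})"
  define c where "c a = (\<lambda>i\<in>{..<r}. 1 + a * (t i - 1))" for a
  have "finite N" unfolding N_def by (intro finite_UN_I poly_roots_finite) auto
  moreover have "0 \<notin> N" "1 \<notin> N" using t0 by (auto simp: N_def)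
  moreover have m: "morphism (line_minus N) (Gm_pow_var r) c"
    unfolding Gm_pow_var_def
  proof (rule morphism_zariskiI[OF function_space_line_minus])
    fix a assume "a \<in> points (line_minus N)"
    then show "c a \<in> {..<r} \<rightarrow>\<^sub>E (UNIV - {0})"
      unfolding c_def N_def by auto
  next
    fix f :: "(nat \<Rightarrow> 'k) \<Rightarrow> 'k" assume "f \<in> coords r"
    then obtain i where i: "i < r" "f = (\<lambda>x. x i)" by (auto simp: coords_def)
    have "morphism (line_minus N) Ga_var (\<lambda>a. 1 + a * (t i - 1))"
      by (intro morphism_Ga_add morphism_Ga_mult morphism_Ga_const morphism_Ga_line function_space_line_minus)
    moreover have "f \<circ> c = (\<lambda>a. 1 + a * (t i - 1))" using i by (auto simp: c_def)
    ultimately show "cut (points (line_minus N)) (f \<circ> c) \<in> regular (line_minus N) (points (line_minus N))"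
      unfolding morphism_Ga[OF function_space_line_minus] by simp
  qed
  moreover have "morphism (line_minus N) VS (\<lambda>a. \<phi> (c a))"
    using morphism_comp[OF m] iso unfolding isomorphism_def by blast
  moreover have "\<phi> (c 0) = \<one>\<^bsub>S\<^esub>"
  proof -
    have "c 0 = \<one>\<^bsub>Gm_pow r\<^esub>" by (simp add: c_def Gm_def)
    moreover have "group (Gm_pow r :: (nat \<Rightarrow> 'k) monoid)"
    proof (rule product_group)
      show "group (Gm :: 'k monoid)"
        by (rule groupI) (auto simp: Gm_def intro!: bexI[where x="inverse _"])
    qed
    ultimately show ?thesis using hom_one[of \<phi> "Gm_pow r" S] \<phi> is_group by (simp add: iso_def)
  qed
  moreover have "c 1 = t" using t(1) by (auto simp: c_def PiE_iff extensional_def)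
  ultimately show ?thesis using t(2) by (intro exI[of _ N] exI[of _ "\<lambda>a. \<phi> (c a)"]) simp
qed

locale sl2_times_torus =
  fixes S :: "'s monoid" and VS :: "('s, 'k::{alg_closed_field, field_char_0}) fspace"
  assumes torus: "torus S VS"
begin

abbreviation G :: "(('k^2^2) \<times> 's) monoid" where "G \<equiv> SL2 \<times>\<times> S"
abbreviation VG :: "(('k^2^2) \<times> 's, 'k) fspace" where "VG \<equiv> prod_space SL2_var VS"

sublocale S: comm_group S using torus_comm_group[OF torus] .

lemma group_S: "group S" ..

sublocale G: group G by (rule DirProd_group[OF group_SL2 group_S])

lemma variety_S: "variety VS"
  using torus by (simp add: torus_def algebraic_group_def)

lemma points_S [simp]: "points VS = carrier S"
  using torus by (simp add: torus_def algebraic_group_def)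

lemmas function_space_S = function_space_variety[OF variety_S]
lemmas has_one_SL2 = has_one_function_space[OF function_space_SL2]
lemmas has_one_S = has_one_function_space[OF function_space_S]
lemmas has_one_G = has_one_prod_space[OF has_one_SL2 has_one_S]

lemma points_G [simp]: "points VG = {A. det A = 1} \<times> carrier S"
  by (simp add: points_prod_space[OF has_one_SL2 has_one_S])

lemma inv_G: "det A = 1 \<Longrightarrow> s \<in> carrier S \<Longrightarrow> inv\<^bsub>G\<^esub> (A, s) = (adj2 A, inv\<^bsub>S\<^esub> s)"
  by (subst inv_DirProd[OF group_SL2 group_S]) (auto simp: carrier_SL2 inv_SL2)

lemma morphism_G_pair:
  "function_space Y \<Longrightarrow> morphism Y SL2_var a \<Longrightarrow> morphism Y VS b \<Longrightarrow> morphism Y VG (\<lambda>y. (a y, b y))"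
  by (rule morphism_pair[OF _ has_one_SL2 has_one_S])

lemma morphism_entry:
  fixes P Q :: "'k^2^2"
  shows "morphism VG Ga_var (\<lambda>g. (P ** fst g ** Q) $ i $ j)"
proof -
  have "regular_matrix SL2_var (\<lambda>A. P ** A ** Q)"
    by (intro regular_matrix_mult regular_matrix_const regular_matrix_SL2 function_space_SL2)
  then have "morphism SL2_var Ga_var (\<lambda>A. (P ** A ** Q) $ i $ j)" by (simp add: regular_matrix_def)
  from morphism_comp[OF morphism_fst[OF function_space_SL2 function_space_S] this] show ?thesis .
qed

lemma closedin_G_snd_one: "closedin (top_of VG) {g \<in> points VG. snd g = \<one>\<^bsub>S\<^esub>}"
proof -
  let ?V = "carrier S - {\<one>\<^bsub>S\<^esub>}"
  have V: "openin (top_of VS) ?V"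
    using closedin_singleton[OF variety_S, of "\<one>\<^bsub>S\<^esub>"] by (simp add: closedin_def)
  have "openin (top_of VG) {z \<in> points SL2_var \<times> ?V. (\<lambda>(x, y). cut (points SL2_var) (\<lambda>_. 1 :: 'k) x * cut ?V (\<lambda>_. 1) y) z \<noteq> 0}"
    by (intro prod_basic_open tensor_single regular_const function_space_SL2 function_space_S V openin_topspace)
  also have "{z \<in> points SL2_var \<times> ?V. (\<lambda>(x, y). cut (points SL2_var) (\<lambda>_. 1 :: 'k) x * cut ?V (\<lambda>_. 1) y) z \<noteq> (0 :: 'k)}
      = points VG - {g \<in> points VG. snd g = \<one>\<^bsub>S\<^esub>}"
    by (auto simp: cut_def)
  finally show ?thesis by (simp only: closedin_def) auto
qed

end

section \<open>The lower triangular Borel subgroup\<close>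

lemma matrix_mult_add_left: "(A + B) ** C = A ** C + B ** C" for A B :: "'k::semiring_1^'n^'m"
  by (simp add: matrix_matrix_mult_def vec_eq_iff sum.distrib distrib_right)

context group
begin

lemma derived_power_restrict:
  assumes H: "subgroup H G"
  shows "(derived (G\<lparr>carrier := H\<rparr>) ^^ n) H = (derived G ^^ n) H \<and> (derived G ^^ n) H \<subseteq> H"
proof (induction n)
  case (Suc n)
  then show ?case
    using derived_consistent[OF _ H, of "(derived G ^^ n) H"] derived_incl[OF _ H, of "(derived G ^^ n) H"] by simp
qed simp

lemma solvable_restrict_iff:
  assumes H: "subgroup H G"
  shows "solvable (G\<lparr>carrier := H\<rparr>) \<longleftrightarrow> (\<exists>n. (derived G ^^ n) H = {\<one>})"
  using group.solvable_iff_trivial_derived_seq[OF subgroup_imp_group[OF H]] derived_power_restrict[OF H]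
  by simp

lemma commutator_in_derived:
  "x \<in> H \<Longrightarrow> y \<in> H \<Longrightarrow> x \<otimes> y \<otimes> inv x \<otimes> inv y \<in> derived G H"
  unfolding derived_def by (rule generate.incl) blast

end

text \<open>The columns of \<open>C\<close> are a basis of the plane, and \<open>Ci\<close> is the inverse matrix. The map \<open>cj\<close> turns the matrix
of an endomorphism in this basis into its matrix in the standard basis, and \<open>uncj\<close> goes back.\<close>

locale adapted_basis = sl2_times_torus S VS
  for S :: "'s monoid" and VS :: "('s, 'k::{alg_closed_field, field_char_0}) fspace" +
  fixes C Ci :: "'k^2^2"
  assumes C_Ci: "C ** Ci = mat 1" and Ci_C: "Ci ** C = mat 1"
begin

definition cj :: "'k^2^2 \<Rightarrow> 'k^2^2" where "cj A = C ** A ** Ci"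
definition uncj :: "'k^2^2 \<Rightarrow> 'k^2^2" where "uncj A = Ci ** A ** C"

lemma cj_mult: "cj A ** cj B = cj (A ** B)"
proof -
  have "C ** A ** Ci ** (C ** B ** Ci) = C ** A ** (Ci ** C) ** B ** Ci"
    by (simp only: matrix_mul_assoc)
  then show ?thesis by (simp add: cj_def Ci_C matrix_mul_assoc)
qed

lemma uncj_cj [simp]: "uncj (cj A) = A"
proof -
  have "Ci ** (C ** A ** Ci) ** C = (Ci ** C) ** A ** (Ci ** C)" by (simp only: matrix_mul_assoc)
  then show ?thesis by (simp add: cj_def uncj_def Ci_C)
qed

lemma cj_uncj [simp]: "cj (uncj A) = A"
proof -
  have "C ** (Ci ** A ** C) ** Ci = (C ** Ci) ** A ** (C ** Ci)" by (simp only: matrix_mul_assoc)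
  then show ?thesis by (simp add: cj_def uncj_def C_Ci)
qed

lemma cj_eq_iff [simp]: "cj A = cj B \<longleftrightarrow> A = B" by (metis uncj_cj)

lemma uncj_mult: "uncj (A ** B) = uncj A ** uncj B" by (metis cj_mult cj_uncj uncj_cj)

lemma cj_one [simp]: "cj (mat 1) = mat 1" by (simp add: cj_def C_Ci)

lemma det_cj [simp]: "det (cj A) = det A"
proof -
  have "det C * det Ci = 1" using arg_cong[OF C_Ci, of det] by (simp add: det_mul)
  then show ?thesis by (simp add: cj_def det_mul)
qed

lemma det_uncj [simp]: "det (uncj A) = det A" by (metis cj_uncj det_cj)

lemma adj2_cj: assumes "det A = 1" shows "adj2 (cj A) = cj (adj2 A)"
proof -
  have "adj2 (cj A) = adj2 (cj A) ** (cj A ** cj (adj2 A))"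
    using adj2_mult[OF assms] by (simp add: cj_mult)
  then show ?thesis
    using adj2_mult[of "cj A"] assms by (simp add: matrix_mul_assoc)
qed

lemma regular_matrix_cj:
  "function_space Y \<Longrightarrow> regular_matrix Y A \<Longrightarrow> regular_matrix Y (\<lambda>y. cj (A y))"
  unfolding cj_def by (intro regular_matrix_mult regular_matrix_const)

lemma morphism_uncj_entry: "morphism VG Ga_var (\<lambda>g. uncj (fst g) $ i $ j)"
  unfolding uncj_def by (rule morphism_entry)

definition lower_borel :: "(('k^2^2) \<times> 's) set" where
  "lower_borel = {g \<in> carrier G. uncj (fst g) $ 1 $ 2 = 0}"

definition lower_unipotent :: "(('k^2^2) \<times> 's) set" where
  "lower_unipotent = {(cj (mat2 1 0 b 1), \<one>\<^bsub>S\<^esub>) | b. True}"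

lemma lower_borelE:
  assumes "g \<in> lower_borel"
  obtains a b s where "a \<noteq> 0" "s \<in> carrier S" "g = (cj (mat2 a 0 b (1 / a)), s)"
proof -
  obtain A s where g: "g = (A, s)" by force
  obtain a b c d where A: "uncj A = mat2 a b c d" by (rule mat2_cases)
  have "A = cj (mat2 a b c d)" by (metis A cj_uncj)
  moreover from this have "b = 0" "a * d = 1" "s \<in> carrier S"
    using assms by (auto simp: lower_borel_def g carrier_SL2)
  moreover have "a \<noteq> 0" using \<open>a * d = 1\<close> by auto
  moreover from this have "d = 1 / a" using \<open>a * d = 1\<close> by (simp add: eq_divide_eq mult.commute)
  ultimately show ?thesis using that[of a s c] g by simp
qed

lemma lower_borelI: "a \<noteq> 0 \<Longrightarrow> s \<in> carrier S \<Longrightarrow> (cj (mat2 a 0 b (1 / a)), s) \<in> lower_borel"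
  by (simp add: lower_borel_def carrier_SL2)

lemma lower_unipotent_subset: "lower_unipotent \<subseteq> lower_borel"
  by (auto simp: lower_borel_def lower_unipotent_def carrier_SL2)

lemma subgroup_lower_borel: "subgroup lower_borel G"
proof (rule G.subgroupI)
  show "lower_borel \<subseteq> carrier G" by (auto simp: lower_borel_def)
  show "lower_borel \<noteq> {}" using lower_borelI[of 1 "\<one>\<^bsub>S\<^esub>" 0] by auto
  fix g assume g: "g \<in> lower_borel"
  then show "inv\<^bsub>G\<^esub> g \<in> lower_borel"
    by (elim lower_borelE) (simp add: inv_G adj2_cj lower_borel_def carrier_SL2)
  fix h assume "h \<in> lower_borel"
  then show "g \<otimes>\<^bsub>G\<^esub> h \<in> lower_borel"
    using g by (elim lower_borelE) (simp add: cj_mult lower_borel_def carrier_SL2)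
qed

lemma subgroup_lower_unipotent: "subgroup lower_unipotent G"
proof (rule G.subgroupI)
  show "lower_unipotent \<subseteq> carrier G" by (auto simp: lower_unipotent_def carrier_SL2)
  show "lower_unipotent \<noteq> {}" by (auto simp: lower_unipotent_def)
qed (auto simp: lower_unipotent_def inv_G adj2_cj cj_mult)

lemma closedin_lower_borel: "closedin (top_of VG) lower_borel"
proof -
  have "lower_borel = {g \<in> points VG. uncj (fst g) $ 1 $ 2 = 0}"
    by (auto simp: lower_borel_def carrier_SL2)
  then show ?thesis using closedin_zero_set[OF morphism_uncj_entry[of 1 2]] by simp
qed

lemma closedin_lower_unipotent: "closedin (top_of VG) lower_unipotent"
proof -
  have "lower_unipotent = lower_borel \<inter> {g \<in> points VG. uncj (fst g) $ 1 $ 1 - 1 = 0} \<inter> {g \<in> points VG. snd g = \<one>\<^bsub>S\<^esub>}"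
  proof
    show "lower_unipotent \<subseteq> lower_borel \<inter> {g \<in> points VG. uncj (fst g) $ 1 $ 1 - 1 = 0} \<inter> {g \<in> points VG. snd g = \<one>\<^bsub>S\<^esub>}"
      using lower_unipotent_subset by (auto simp: lower_unipotent_def)
    show "lower_borel \<inter> {g \<in> points VG. uncj (fst g) $ 1 $ 1 - 1 = 0} \<inter> {g \<in> points VG. snd g = \<one>\<^bsub>S\<^esub>} \<subseteq> lower_unipotent"
      by (auto elim!: lower_borelE simp: lower_unipotent_def)
  qed
  moreover have "closedin (top_of VG) {g \<in> points VG. uncj (fst g) $ 1 $ 1 - 1 = 0}"
  proof -
    have "morphism Ga_var Ga_var (\<lambda>a :: 'k. a - 1)"
      using morphism_Ga_line by (intro morphism_Ga_diff morphism_Ga_const function_space_Ga) (simp add: Ga_var_line)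
    from closedin_zero_set[OF morphism_comp[OF morphism_uncj_entry this]] show ?thesis .
  qed
  ultimately show ?thesis
    using closedin_lower_borel closedin_G_snd_one by (simp only: closedin_Int)
qed

text \<open>The segment from the identity to a lower triangular matrix, with the last entry chosen to keep the determinant
\<open>1\<close>; the excluded set \<open>N\<close> contains the zeros of the first entry.\<close>

lemma curve_lower_borel:
  assumes a: "a \<noteq> 0" and c: "morphism (line_minus N) VS c" and N: "\<And>z. z \<notin> N \<Longrightarrow> 1 + z * (a - 1) \<noteq> 0"
  shows "morphism (line_minus N) VG (\<lambda>z. (cj (mat2 (1 + z * (a - 1)) 0 (z * b) (1 / (1 + z * (a - 1)))), c z))"
proof -
  note fs = function_space_line_minus[of N]
  have 1: "morphism (line_minus N) Ga_var (\<lambda>z. 1 + z * (a - 1))"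
    by (intro morphism_Ga_add morphism_Ga_mult morphism_Ga_const morphism_Ga_line fs)
  have 2: "morphism (line_minus N) Ga_var (\<lambda>z. 1 / (1 + z * (a - 1)))"
    using morphism_Ga_inverse[OF fs 1] N by (simp add: inverse_eq_divide)
  show ?thesis
  proof (rule morphism_G_pair[OF fs morphism_SL2I[OF fs] c])
    show "regular_matrix (line_minus N) (\<lambda>z. cj (mat2 (1 + z * (a - 1)) 0 (z * b) (1 / (1 + z * (a - 1)))))"
      by (intro regular_matrix_cj regular_matrix_mat2 fs 1 2 morphism_Ga_const morphism_Ga_mult morphism_Ga_line)
    fix z assume "z \<in> points (line_minus N)"
    then show "det (cj (mat2 (1 + z * (a - 1)) 0 (z * b) (1 / (1 + z * (a - 1))))) = 1"
      using N by simp
  qed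
qed

lemma connectedin_lower_borel: "connectedin (top_of VG) lower_borel"
proof (rule connectedin_rational_curves)
  show "(mat 1, \<one>\<^bsub>S\<^esub>) \<in> lower_borel"
    using lower_borelI[of 1 "\<one>\<^bsub>S\<^esub>" 0] by (simp flip: mat_1_mat2)
  fix g assume "g \<in> lower_borel"
  then obtain a b s where g: "a \<noteq> 0" "s \<in> carrier S" "g = (cj (mat2 a 0 b (1 / a)), s)"
    by (rule lower_borelE)
  obtain N c where c: "finite N" "0 \<notin> N" "1 \<notin> N" "morphism (line_minus N) VS c" "c 0 = \<one>\<^bsub>S\<^esub>" "c 1 = s"
    using torus_rational_curve[OF torus g(2)] by blast
  define M where "M = N \<union> {z. poly [:1, a - 1:] z = 0}"
  let ?c = "\<lambda>z. (cj (mat2 (1 + z * (a - 1)) 0 (z * b) (1 / (1 + z * (a - 1)))), c z)"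
  have inc: "morphism (line_minus M) (line_minus N) (\<lambda>z. z)"
    unfolding line_minus_def[of N]
  proof (rule morphism_zariskiI[OF function_space_line_minus])
    show "cut (points (line_minus M)) (f \<circ> (\<lambda>z. z)) \<in> regular (line_minus M) (points (line_minus M))" if "f \<in> {\<lambda>x. x}" for f
      using that morphism_Ga_line[of M] unfolding morphism_Ga[OF function_space_line_minus] by (simp add: comp_def)
  qed (simp add: M_def)
  have "finite M" unfolding M_def using c(1) poly_roots_finite[of "[:1, a - 1:]"] by simp
  moreover have mc: "morphism (line_minus M) VG ?c"
    by (rule curve_lower_borel[OF g(1) morphism_comp[OF inc c(4)]]) (simp add: M_def)
  moreover have "?c z \<in> lower_borel" if "z \<notin> M" for z
    using morphism_points[OF morphism_comp[OF inc c(4)], of z] that by (intro lower_borelI) (simp_all add: M_def)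
  moreover have "0 \<notin> M" "1 \<notin> M" using c g by (simp_all add: M_def)
  moreover have "?c 0 = (mat 1, \<one>\<^bsub>S\<^esub>)" "?c 1 = g"
    using c g by (simp_all flip: mat_1_mat2)
  ultimately show "\<exists>N c. finite N \<and> morphism (line_minus N) VG c \<and>
      c ` (UNIV - N) \<subseteq> lower_borel \<and> (mat 1, \<one>\<^bsub>S\<^esub>) \<in> c ` (UNIV - N) \<and> g \<in> c ` (UNIV - N)"
    by (intro exI[of _ M] exI[of _ ?c])
       (auto intro: image_eqI[of _ _ 0] image_eqI[of _ _ 1])
qed

lemma connectedin_lower_unipotent: "connectedin (top_of VG) lower_unipotent"
proof (rule connectedin_rational_curves)
  show "(cj (mat2 1 0 0 1), \<one>\<^bsub>S\<^esub>) \<in> lower_unipotent" unfolding lower_unipotent_def by blast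
  fix g assume "g \<in> lower_unipotent"
  then obtain b where g: "g = (cj (mat2 1 0 b 1), \<one>\<^bsub>S\<^esub>)" by (auto simp: lower_unipotent_def)
  let ?c = "\<lambda>z. (cj (mat2 1 0 (z * b) 1), \<one>\<^bsub>S\<^esub>)"
  have "morphism (line_minus {}) VG ?c"
    using curve_lower_borel[of 1 "{}" "\<lambda>_. \<one>\<^bsub>S\<^esub>" b] morphism_const[OF function_space_line_minus, of "\<one>\<^bsub>S\<^esub>" VS] by simp
  then show "\<exists>N c. finite N \<and> morphism (line_minus N) VG c \<and>
      c ` (UNIV - N) \<subseteq> lower_unipotent \<and> (cj (mat2 1 0 0 1), \<one>\<^bsub>S\<^esub>) \<in> c ` (UNIV - N) \<and> g \<in> c ` (UNIV - N)"
    using g by (intro exI[of _ "{}"] exI[of _ ?c])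
       (auto simp: lower_unipotent_def intro: image_eqI[of _ _ 0] image_eqI[of _ _ 1])
qed

text \<open>A commutator of lower triangular matrices has diagonal entries \<open>1\<close>, and its component in the commutative group
\<open>S\<close> is trivial; lower unipotent matrices commute.\<close>

lemma solvable_lower_borel: "solvable (G\<lparr>carrier := lower_borel\<rparr>)"
proof -
  have "derived_set G lower_borel \<subseteq> lower_unipotent"
  proof
    fix x assume "x \<in> derived_set G lower_borel"
    then obtain g h where gh: "g \<in> lower_borel" "h \<in> lower_borel" "x = g \<otimes>\<^bsub>G\<^esub> h \<otimes>\<^bsub>G\<^esub> inv\<^bsub>G\<^esub> g \<otimes>\<^bsub>G\<^esub> inv\<^bsub>G\<^esub> h" by blast
    obtain a b s where g: "a \<noteq> 0" "s \<in> carrier S" "g = (cj (mat2 a 0 b (1 / a)), s)" using gh(1) by (rule lower_borelE)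
    obtain c d t where h: "c \<noteq> 0" "t \<in> carrier S" "h = (cj (mat2 c 0 d (1 / c)), t)" using gh(2) by (rule lower_borelE)
    have "s \<otimes>\<^bsub>S\<^esub> t \<otimes>\<^bsub>S\<^esub> inv\<^bsub>S\<^esub> s \<otimes>\<^bsub>S\<^esub> inv\<^bsub>S\<^esub> t = \<one>\<^bsub>S\<^esub>"
      using g(2) h(2) by (simp add: S.m_comm[of s t] S.m_assoc)
    then show "x \<in> lower_unipotent"
      using g(1,2) h(1,2) unfolding gh(3) g(3) h(3) lower_unipotent_def
      by (simp add: inv_G adj2_cj cj_mult)
  qed
  then have 1: "derived G lower_borel \<subseteq> lower_unipotent"
    unfolding derived_def using G.generate_subgroup_incl subgroup_lower_unipotent by blast
  have "derived_set G lower_unipotent \<subseteq> {\<one>\<^bsub>G\<^esub>}"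
    by (auto simp: lower_unipotent_def inv_G adj2_cj cj_mult simp flip: mat_1_mat2)
  then have 2: "derived G lower_unipotent \<subseteq> {\<one>\<^bsub>G\<^esub>}"
    unfolding derived_def using G.generate_subgroup_incl G.triv_subgroup by blast
  have "(derived G ^^ 2) lower_borel \<subseteq> {\<one>\<^bsub>G\<^esub>}"
    using G.mono_derived[OF 1] 2 by (simp add: numeral_2_eq_2)
  moreover have "\<one>\<^bsub>G\<^esub> \<in> (derived G ^^ 2) lower_borel"
    using G.exp_of_derived_is_subgroup[OF subgroup_lower_borel] subgroup.one_closed by blast
  ultimately show ?thesis
    using G.solvable_restrict_iff[OF subgroup_lower_borel] by blast
qed

lemma connected_solvable_lower_borel: "connected_solvable_subgroup G VG lower_borel"
  unfolding connected_solvable_subgroup_def closed_subgroup_def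
  using subgroup_lower_borel closedin_lower_borel connectedin_lower_borel solvable_lower_borel by simp

lemma connected_normal_unipotent_lower: "connected_normal_unipotent S VS lower_borel lower_unipotent"
  unfolding connected_normal_unipotent_def unipotent_subgroup_def closed_subgroup_def
proof (intro conjI subgroup_lower_unipotent closedin_lower_unipotent connectedin_lower_unipotent ballI)
  fix g assume "g \<in> lower_unipotent"
  then obtain b where g: "g = (cj (mat2 1 0 b 1), \<one>\<^bsub>S\<^esub>)" by (auto simp: lower_unipotent_def)
  have "cj (mat2 0 0 b 0) + mat 1 = cj (mat2 0 0 b 0) + cj (mat2 1 0 0 1)"
    by (simp flip: mat_1_mat2)
  also have "\<dots> = cj (mat2 0 0 b 0 + mat2 1 0 0 1)"
    by (simp only: cj_def matrix_add_ldistrib matrix_mult_add_left)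
  also have "mat2 0 0 b 0 + mat2 1 0 0 1 = mat2 1 0 b 1" by (rule mat2_eqI) simp_all
  finally have "fst g - mat 1 = cj (mat2 0 0 b 0)" by (simp add: g algebra_simps)
  then have "(((**) (fst g - mat 1)) ^^ 2) (mat 1) = cj (mat2 0 0 0 0)"
    by (simp add: numeral_2_eq_2 cj_mult)
  also have "\<dots> = 0"
  proof -
    have "mat2 0 0 0 0 = (0 :: 'k^2^2)" by (rule mat2_eqI) simp_all
    then show ?thesis by (simp add: cj_def)
  qed
  finally show "unipotent S g" unfolding unipotent_def g by auto
next
  have "group (G\<lparr>carrier := lower_borel\<rparr>)" by (rule G.subgroup_imp_group[OF subgroup_lower_borel])
  moreover have "subgroup lower_unipotent (G\<lparr>carrier := lower_borel\<rparr>)"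
    by (rule G.subgroup_incl[OF subgroup_lower_unipotent subgroup_lower_borel lower_unipotent_subset])
  moreover have "g \<otimes>\<^bsub>G\<^esub> h \<otimes>\<^bsub>G\<^esub> inv\<^bsub>G\<lparr>carrier := lower_borel\<rparr>\<^esub> g \<in> lower_unipotent"
    if "g \<in> lower_borel" "h \<in> lower_unipotent" for g h
  proof -
    have "inv\<^bsub>G\<lparr>carrier := lower_borel\<rparr>\<^esub> g = inv\<^bsub>G\<^esub> g"
      by (rule G.m_inv_consistent[OF subgroup_lower_borel that(1)])
    then show ?thesis
      using that by (elim lower_borelE) (auto simp: lower_unipotent_def inv_G adj2_cj cj_mult)
  qed
  ultimately show "lower_unipotent \<lhd> G\<lparr>carrier := lower_borel\<rparr>"
    by (subst group.normal_inv_iff) simp_all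
qed

end

section \<open>The Borel subgroup opposite to the upper triangular one\<close>

context adapted_basis
begin

text \<open>The matrices \<open>(p  z q; r / z  w)\<close> are the conjugates of \<open>(p q; r w)\<close> by diagonal matrices. If \<open>K\<close> contains
all conjugates of a matrix that has two nonzero off-diagonal entries and is not antidiagonal, then so does the derived
group: the commutator of two conjugates is a Laurent polynomial in the quotient \<open>z\<close> of their parameters, and for
almost all \<open>z\<close> it has the same shape. Conjugating the commutator conjugates both arguments, which accounts for its
own conjugates.\<close>

lemma commutator_of_torus_twists:
  fixes p q r w :: 'k
  assumes det: "p * w - q * r = 1" and q: "q \<noteq> 0" and r: "r \<noteq> 0" and pw: "p \<noteq> 0 \<or> w \<noteq> 0"
    and s: "s \<in> carrier S"
    and K: "\<And>z. z \<noteq> 0 \<Longrightarrow> (cj (mat2 p (z * q) (r / z) w), s) \<in> K"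
  shows "\<exists>p' q' r' w'. p' * w' - q' * r' = 1 \<and> q' \<noteq> 0 \<and> r' \<noteq> 0 \<and> (p' \<noteq> 0 \<or> w' \<noteq> 0) \<and>
    (\<forall>z. z \<noteq> 0 \<longrightarrow> (cj (mat2 p' (z * q') (r' / z) w'), \<one>\<^bsub>S\<^esub>) \<in> derived G K)"
proof -
  \<comment> \<open>up to sign, factors \<open>q\<close>, \<open>r\<close>, \<open>z - 1\<close> and powers of \<open>z\<close>, the polynomials \<open>P1\<close>, \<open>P2\<close>, \<open>P3\<close> are the entries 12, 21 and 11 of the commutator\<close>
  define e1 where "e1 = p\<^sup>2 * w - p ^ 3 - q * r * w"
  define e2 where "e2 = w\<^sup>2 * p - w ^ 3 - q * r * p"
  define P1 where "P1 = [:- (p * q * r), e1 - p * q * r, - (p * q * r):]"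
  define P2 where "P2 = [:- (w * q * r), e2 - w * q * r, - (w * q * r):]"
  define P3 where "P3 = [:q * r, p\<^sup>2:] * [:q * r, w\<^sup>2:] - [:0, q * r:] * [:w, p:] * [:p, w:]"
  have "P1 \<noteq> 0" using q r pw by (cases "p = 0") (auto simp: P1_def e1_def)
  moreover have "P2 \<noteq> 0" using q r pw by (cases "w = 0") (auto simp: P2_def e2_def)
  \<comment> \<open>for \<open>z = 1\<close> the commutator is the identity matrix\<close>
  moreover have "poly P3 1 = (p * w - q * r)\<^sup>2"
    unfolding P3_def by (simp add: power2_eq_square algebra_simps)
  then have "P3 \<noteq> 0" using det by auto
  ultimately have "P1 * P2 * P3 * [:0, 1:] * [:- 1, 1:] \<noteq> 0" unfolding mult_eq_0_iff by simp
  then obtain z where "poly (P1 * P2 * P3 * [:0, 1:] * [:- 1, 1:]) z \<noteq> 0"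
    using poly_all_0_iff_0 by blast
  then have z: "poly P1 z \<noteq> 0" "poly P2 z \<noteq> 0" "poly P3 z \<noteq> 0" "z \<noteq> 0" "z \<noteq> 1" by auto
  define k11 where "k11 = (p\<^sup>2 + q * r / z) * (w\<^sup>2 + q * r / z) - q * (p * z + w) * r * (w + p / z)"
  define k12 where "k12 = q * (p * z + w) * (q * r * z + p\<^sup>2) - (p\<^sup>2 + q * r / z) * q * (w * z + p)"
  define k21 where "k21 = r * (p + w / z) * (w\<^sup>2 + q * r / z) - (q * r * z + w\<^sup>2) * r * (w + p / z)"
  define k22 where "k22 = (q * r * z + w\<^sup>2) * (q * r * z + p\<^sup>2) - r * (p + w / z) * q * (w * z + p)"
  have "z * k12 = - q * (z - 1) * poly P1 z"
    using z(4) unfolding k12_def P1_def e1_def by (simp add: field_simps power2_eq_square power3_eq_cube)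
  then have k12: "k12 \<noteq> 0" using z q by auto
  have "z\<^sup>2 * k21 = r * (z - 1) * poly P2 z"
    using z(4) unfolding k21_def P2_def e2_def by (simp add: field_simps power2_eq_square power3_eq_cube)
  then have k21: "k21 \<noteq> 0" using z r by auto
  have "z\<^sup>2 * k11 = poly P3 z"
    using z(4) unfolding k11_def P3_def by (simp add: field_simps power2_eq_square power3_eq_cube)
  then have k11: "k11 \<noteq> 0" using z by auto
  define A where "A y = mat2 p (y * q) (r / y) w" for y
  have detA: "det (A y) = 1" if "y \<noteq> 0" for y using that det by (simp add: A_def)
  have comm: "A y ** A (y * z) ** adj2 (A y) ** adj2 (A (y * z)) = mat2 k11 (y * k12) (k21 / y) k22" if "y \<noteq> 0" for y
    using that z(4) unfolding A_def k11_def k12_def k21_def k22_def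
    by (simp add: field_simps power2_eq_square)
  have mem: "(cj (mat2 k11 (y * k12) (k21 / y) k22), \<one>\<^bsub>S\<^esub>) \<in> derived G K" if y: "y \<noteq> 0" for y
  proof -
    have yz: "y * z \<noteq> 0" using y z by simp
    have "(cj (A y), s) \<otimes>\<^bsub>G\<^esub> (cj (A (y * z)), s) \<otimes>\<^bsub>G\<^esub> inv\<^bsub>G\<^esub> (cj (A y), s) \<otimes>\<^bsub>G\<^esub> inv\<^bsub>G\<^esub> (cj (A (y * z)), s) \<in> derived G K"
      by (rule G.commutator_in_derived) (use K[OF y] K[OF yz] in \<open>simp_all add: A_def\<close>)
    then show ?thesis
      using s detA[OF y] detA[OF yz] by (simp add: inv_G adj2_cj cj_mult comm[OF y] S.m_assoc)
  qed
  have "det (mat2 k11 (1 * k12) (k21 / 1) k22) = 1"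
    using detA[of 1] detA[of "1 * z"] z(4) by (simp only: comm[of 1, OF one_neq_zero, symmetric] det_mul det_adj2) simp
  then show ?thesis using k11 k12 k21 mem
    by (intro exI[of _ k11] exI[of _ k12] exI[of _ k21] exI[of _ k22]) simp
qed

text \<open>By \<open>commutator_of_torus_twists\<close> a matrix violating the conclusion would produce nontrivial elements in every term
of the derived series. Antidiagonal matrices have to be admitted because the normalizer of the diagonal torus is
solvable.\<close>

lemma solvable_with_torus:
  assumes H: "subgroup H G" and solv: "solvable (G\<lparr>carrier := H\<rparr>)"
    and tor: "\<And>c. c \<noteq> 0 \<Longrightarrow> (cj (mat2 c 0 0 (1 / c)), \<one>\<^bsub>S\<^esub>) \<in> H"
    and g: "(cj (mat2 p q r w), s) \<in> H"
  shows "q = 0 \<or> r = 0 \<or> p = 0 \<and> w = 0"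
proof (rule ccontr)
  assume "\<not> ?thesis"
  then have generic: "q \<noteq> 0" "r \<noteq> 0" "p \<noteq> 0 \<or> w \<noteq> 0" by auto
  have "(cj (mat2 p q r w), s) \<in> carrier G" using g subgroup.subset[OF H] by blast
  then have det: "p * w - q * r = 1" and s: "s \<in> carrier S" by (simp_all add: carrier_SL2)
  have twists: "\<exists>p q r w s. p * w - q * r = 1 \<and> q \<noteq> 0 \<and> r \<noteq> 0 \<and> (p \<noteq> 0 \<or> w \<noteq> 0) \<and> s \<in> carrier S \<and>
      (\<forall>z. z \<noteq> 0 \<longrightarrow> (cj (mat2 p (z * q) (r / z) w), s) \<in> (derived G ^^ n) H)" for n
  proof (induction n)
    case 0
    have "(cj (mat2 p (z * q) (r / z) w), s) \<in> H" if "z \<noteq> 0" for z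
    proof -
      \<comment> \<open>conjugation by \<open>diag(c, 1/c)\<close> multiplies the entry 12 by \<open>c\<^sup>2\<close>\<close>
      obtain c where c: "c ^ 2 = z" using nth_root_exists[of 2 z] by auto
      have c0: "c \<noteq> 0" using c that by auto
      let ?t = "(cj (mat2 c 0 0 (1 / c)), \<one>\<^bsub>S\<^esub>)"
      have "?t \<otimes>\<^bsub>G\<^esub> (cj (mat2 p q r w), s) \<otimes>\<^bsub>G\<^esub> inv\<^bsub>G\<^esub> ?t \<in> H"
        using tor[OF c0] g H by (simp add: subgroup.m_closed subgroup.m_inv_closed del: mult_DirProd)
      then show ?thesis
        using c0 s by (simp add: inv_G adj2_cj cj_mult power2_eq_square mult_ac flip: c)
    qed
    then show ?case using generic det s by (intro exI[of _ p] exI[of _ q] exI[of _ r] exI[of _ w] exI[of _ s]) simp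
  next
    case (Suc n)
    then obtain p q r w s where *: "p * w - q * r = 1" "q \<noteq> 0" "r \<noteq> 0" "p \<noteq> 0 \<or> w \<noteq> 0" "s \<in> carrier S"
      "\<And>z. z \<noteq> 0 \<Longrightarrow> (cj (mat2 p (z * q) (r / z) w), s) \<in> (derived G ^^ n) H" by auto
    obtain p' q' r' w' where "p' * w' - q' * r' = 1" "q' \<noteq> 0" "r' \<noteq> 0" "p' \<noteq> 0 \<or> w' \<noteq> 0"
      "\<forall>z. z \<noteq> 0 \<longrightarrow> (cj (mat2 p' (z * q') (r' / z) w'), \<one>\<^bsub>S\<^esub>) \<in> (derived G ^^ Suc n) H"
      using commutator_of_torus_twists[OF *] by auto
    then show ?case
      by (intro exI conjI) (assumption | rule S.one_closed)+
  qed
  obtain n where n: "(derived G ^^ n) H = {\<one>\<^bsub>G\<^esub>}"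
    using G.solvable_restrict_iff[OF H] solv by blast
  obtain p q r w s where "q \<noteq> 0" "\<forall>z. z \<noteq> 0 \<longrightarrow> (cj (mat2 p (z * q) (r / z) w), s) \<in> (derived G ^^ n) H"
    using twists[of n] by (elim exE conjE) (rule that)
  from spec[OF this(2), of 1] have "cj (mat2 p q r w) = cj (mat 1)" by (simp add: n)
  then show False using \<open>q \<noteq> 0\<close> by (simp only: cj_eq_iff) (simp add: mat_1_mat2)
qed

text \<open>An upper triangular element of \<open>H\<close> that is not diagonal would, by taking its commutator with a diagonal matrix, give
a nontrivial upper unipotent element. So by \<open>solvable_with_torus\<close> an element with a nonzero entry 12 is antidiagonal. If there
is one, multiplication by it shows that all elements are diagonal or antidiagonal, and these two kinds form a
separation of \<open>H\<close>; this is where connectedness enters.\<close>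

lemma opposite_to_upper_is_lower:
  assumes H: "subgroup H G" and solv: "solvable (G\<lparr>carrier := H\<rparr>)" and conn: "connectedin (top_of VG) H"
    and tor: "\<And>c. c \<noteq> 0 \<Longrightarrow> (cj (mat2 c 0 0 (1 / c)), \<one>\<^bsub>S\<^esub>) \<in> H"
    and opp: "\<And>b. (cj (mat2 1 b 0 1), \<one>\<^bsub>S\<^esub>) \<in> H \<Longrightarrow> b = 0"
  shows "H \<subseteq> lower_borel"
proof -
  have carr: "p * w - q * r = 1 \<and> s \<in> carrier S" if "(cj (mat2 p q r w), s) \<in> H" for p q r w s
    using subgroup.subset[OF H] that by (auto simp: carrier_SL2)
  have anti: "p = 0 \<and> w = 0" if g: "(cj (mat2 p q r w), s) \<in> H" and q: "q \<noteq> 0" for p q r w s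
  proof -
    have "r \<noteq> 0"
    proof
      assume r: "r = 0"
      let ?t = "(cj (mat2 2 0 0 (1 / 2)), \<one>\<^bsub>S\<^esub>)" and ?g = "(cj (mat2 p q 0 w), s)"
      have pw: "p * w = 1" and s: "s \<in> carrier S" using carr[OF g] r by auto
      have "?t \<otimes>\<^bsub>G\<^esub> ?g \<otimes>\<^bsub>G\<^esub> inv\<^bsub>G\<^esub> ?t \<otimes>\<^bsub>G\<^esub> inv\<^bsub>G\<^esub> ?g \<in> H"
        using tor[of 2] g r H by (simp add: subgroup.m_closed subgroup.m_inv_closed del: mult_DirProd)
      then have "(cj (mat2 1 (3 * p * q) 0 1), \<one>\<^bsub>S\<^esub>) \<in> H"
        using pw s by (simp add: inv_G adj2_cj cj_mult algebra_simps)
      then have "3 * p * q = 0" by (rule opp)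
      then show False using pw q by auto
    qed
    then show ?thesis using solvable_with_torus[OF H solv tor g] q by blast
  qed
  show ?thesis
  proof (rule ccontr)
    assume "\<not> H \<subseteq> lower_borel"
    then obtain A\<^sub>0 s\<^sub>0 where g0: "(A\<^sub>0, s\<^sub>0) \<in> H" "(A\<^sub>0, s\<^sub>0) \<notin> lower_borel" by force
    obtain p\<^sub>0 q\<^sub>0 r\<^sub>0 w\<^sub>0 where "uncj A\<^sub>0 = mat2 p\<^sub>0 q\<^sub>0 r\<^sub>0 w\<^sub>0" by (rule mat2_cases)
    then have A0: "A\<^sub>0 = cj (mat2 p\<^sub>0 q\<^sub>0 r\<^sub>0 w\<^sub>0)" by (metis cj_uncj)
    have q0: "q\<^sub>0 \<noteq> 0" using g0 subgroup.subset[OF H] by (auto simp: lower_borel_def A0)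
    note w0 = anti[OF g0(1)[unfolded A0] q0]
    let ?E = "{g \<in> points VG. uncj (fst g) $ 1 $ 2 = 0}" and ?F = "{g \<in> points VG. uncj (fst g) $ 1 $ 1 = 0}"
    have sep: "(q = 0 \<and> p \<noteq> 0) \<or> (q \<noteq> 0 \<and> p = 0)" if g: "(cj (mat2 p q r w), s) \<in> H" for p q r w s
      using carr[OF g] anti[OF g] by (cases "q = 0") auto
    have H_pts: "H \<subseteq> points VG" using subgroup.subset[OF H] by (auto simp: carrier_SL2)
    have "(uncj (fst g) $ 1 $ 2 = 0) \<noteq> (uncj (fst g) $ 1 $ 1 = 0)" if "g \<in> H" for g
    proof -
      obtain A s where g: "g = (A, s)" by force
      obtain p q r w where e: "uncj A = mat2 p q r w" by (rule mat2_cases)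
      then have "A = cj (mat2 p q r w)" by (metis cj_uncj)
      then show ?thesis using sep[of p q r w s] that by (auto simp: g)
    qed
    then have "H \<subseteq> ?E \<union> ?F" "?E \<inter> ?F \<inter> H = {}"
      using H_pts by auto
    moreover have "(cj (mat2 1 0 0 (1 / 1)), \<one>\<^bsub>S\<^esub>) \<in> ?E \<inter> H" using tor[of 1] by simp
    then have "?E \<inter> H \<noteq> {}" by blast
    moreover have "(A\<^sub>0, s\<^sub>0) \<in> ?F \<inter> H" using g0(1) w0 carr[of p\<^sub>0 q\<^sub>0 r\<^sub>0 w\<^sub>0 s\<^sub>0] by (simp add: A0)
    then have "?F \<inter> H \<noteq> {}" by blast
    ultimately have "closedin (top_of VG) ?E \<and> closedin (top_of VG) ?F \<and> H \<subseteq> ?E \<union> ?F \<and>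
        ?E \<inter> ?F \<inter> H = {} \<and> ?E \<inter> H \<noteq> {} \<and> ?F \<inter> H \<noteq> {}"
      by (intro conjI closedin_zero_set morphism_uncj_entry)
    with conn show False unfolding connectedin_closedin by meson
  qed
qed

text \<open>The torus \<open>T = B \<inter> Bm\<close> is commutative and contains the diagonal matrices, so it has no upper unipotent elements.
Therefore \<open>Bm\<close> is contained in the lower triangular Borel subgroup, and by maximality equal to it.\<close>

lemma lower_unipotent_in_opposite_radical:
  assumes tor: "\<And>c. c \<noteq> 0 \<Longrightarrow> (cj (mat2 c 0 0 (1 / c)), \<one>\<^bsub>S\<^esub>) \<in> T"
    and up: "\<And>b. (cj (mat2 1 b 0 1), \<one>\<^bsub>S\<^esub>) \<in> B"
    and T: "torus (restrict_group G T) VT"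
    and Bm: "borel_subgroup G VG Bm" and opp: "B \<inter> Bm = T"
    and Um: "unipotent_radical S VS Bm Um"
  shows "lower_unipotent \<subseteq> Um"
proof -
  interpret T: comm_group "restrict_group G T" by (rule torus_comm_group[OF T])
  have cs: "connected_solvable_subgroup G VG Bm" using Bm by (simp add: borel_subgroup_def)
  have "Bm \<subseteq> lower_borel"
  proof (rule opposite_to_upper_is_lower)
    show "subgroup Bm G" "solvable (G\<lparr>carrier := Bm\<rparr>)" "connectedin (top_of VG) Bm"
      using cs by (simp_all add: connected_solvable_subgroup_def closed_subgroup_def)
    show "(cj (mat2 c 0 0 (1 / c)), \<one>\<^bsub>S\<^esub>) \<in> Bm" if "c \<noteq> 0" for c
      using tor[OF that] opp by blast
    fix b assume "(cj (mat2 1 b 0 1), \<one>\<^bsub>S\<^esub>) \<in> Bm"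
    then have "(cj (mat2 1 b 0 1), \<one>\<^bsub>S\<^esub>) \<in> T" using up opp by blast
    from T.m_comm[of "(cj (mat2 1 b 0 1), \<one>\<^bsub>S\<^esub>)" "(cj (mat2 2 0 0 (1 / 2)), \<one>\<^bsub>S\<^esub>)"] this tor[of 2]
    show "b = 0" by (simp add: cj_mult)
  qed
  then have "Bm = lower_borel"
    using Bm connected_solvable_lower_borel unfolding borel_subgroup_def by blast
  then show ?thesis
    using Um connected_normal_unipotent_lower unfolding unipotent_radical_def by blast
qed

end

section \<open>Normal form of a pair of a root subgroup and its coroot\<close>

text \<open>For a matrix of determinant \<open>1\<close> the difference \<open>2 - tr A\<close> is the determinant of the nilpotent matrix \<open>A - 1\<close>.\<close>

lemma unipotent_trace:
  fixes A :: "'k::field^2^2"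
  assumes "det A = 1" "(((**) (A - mat 1)) ^^ n) (mat 1) = 0"
  shows "A $ 1 $ 1 + A $ 2 $ 2 = 2"
proof -
  have "det ((((**) N) ^^ n) (mat 1)) = det N ^ n" for N :: "'k^2^2" and n
    by (induction n) (simp_all add: det_mul)
  from this[of n "A - mat 1"] have "det (A - mat 1) ^ n = 0" using assms(2) by (simp add: det_2)
  then have "det (A - mat 1) = 0" by simp
  moreover obtain a b c d where "A = mat2 a b c d" by (rule mat2_cases)
  ultimately show ?thesis using assms(1) by (simp add: mat_1_mat2 mat2_diff algebra_simps)
qed

text \<open>A nilpotent matrix \<open>N \<noteq> 0\<close> has rank one; the columns of \<open>C\<close> are \<open>N e\<close> and \<open>e\<close> for a coordinate vector
\<open>e\<close> with \<open>N e \<noteq> 0\<close>, where \<open>N = A - 1\<close>.\<close>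

lemma unipotent_normal_form:
  fixes A :: "'k::field^2^2"
  assumes det: "det A = 1" and tr: "A $ 1 $ 1 + A $ 2 $ 2 = 2" and "A \<noteq> mat 1"
  shows "\<exists>C Ci. C ** Ci = mat 1 \<and> Ci ** C = mat 1 \<and> A = C ** mat2 1 1 0 1 ** Ci"
proof -
  obtain a b c d where A: "A = mat2 a b c d" by (rule mat2_cases)
  have d: "d = 2 - a" using tr by (simp add: A algebra_simps)
  have bc: "b * c = - (a - 1) * (a - 1)" using det by (simp add: A d algebra_simps)
  show ?thesis
  proof (cases "c = 0")
    case True
    then have "a = 1" using bc by simp
    then have "b \<noteq> 0" using assms(3) True d by (auto simp: A mat_1_mat2)
    then show ?thesis using True \<open>a = 1\<close> d
      by (intro exI[of _ "mat2 b 0 0 1"] exI[of _ "mat2 (1 / b) 0 0 1"]) (simp add: A mat_1_mat2)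
  next
    case False
    then have b: "b = - (a - 1) * (a - 1) / c" using bc by (simp add: field_simps)
    show ?thesis
    proof (intro exI conjI)
      show "mat2 (a - 1) 1 c 0 ** mat2 0 (1 / c) 1 (- (a - 1) / c) = mat 1"
        "mat2 0 (1 / c) 1 (- (a - 1) / c) ** mat2 (a - 1) 1 c 0 = mat 1"
        using False by (simp_all add: mat_1_mat2 flip: add_divide_distrib)
      show "A = mat2 (a - 1) 1 c 0 ** mat2 1 1 0 1 ** mat2 0 (1 / c) 1 (- (a - 1) / c)"
        using False by (simp add: A b d) (simp add: field_simps)
    qed
  qed
qed

text \<open>Additivity and \<open>\<phi>(1) = 1\<close> determine \<open>\<phi>\<close> on the natural numbers, which in characteristic \<open>0\<close> are infinitely many points, so the
rational function representing \<open>\<phi>\<close> is the identity; additivity again reaches the zeros of its denominator.\<close>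

lemma additive_regular_function:
  fixes \<phi> :: "'k::field_char_0 \<Rightarrow> 'k"
  assumes m: "morphism Ga_var Ga_var \<phi>" and add: "\<And>a b. \<phi> (a + b) = \<phi> a + \<phi> b" and one: "\<phi> 1 = 1"
  shows "\<phi> a = a"
proof -
  have "cut UNIV (\<lambda>x. x) \<in> regular (Ga_var :: ('k, 'k) fspace) UNIV"
    unfolding Ga_var_def by (rule regular_polyfun) (simp add: polyfuns.coord)
  then obtain p q where q0: "poly q 0 \<noteq> 0" and pq: "\<And>a. poly q a \<noteq> 0 \<Longrightarrow> \<phi> a = poly p a / poly q a"
    using regular_along_curve[of "{}" Ga_var \<phi> UNIV "cut UNIV (\<lambda>x. x)" 0] m openin_topspace[of "top_of (Ga_var :: ('k, 'k) fspace)"]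
    by (auto simp: Ga_var_line[symmetric] cut_def)
  have "\<phi> 0 = 0" using add[of 0 0] by simp
  then have nat: "\<phi> (of_nat n) = of_nat n" for n
    by (induction n) (simp_all add: add one)
  have fin: "finite {a. poly q a = 0}" using q0 poly_roots_finite[of q] by (cases "q = 0") auto
  have "p = [:0, 1:] * q"
  proof (rule ccontr)
    assume "p \<noteq> [:0, 1:] * q"
    then have "finite {a. poly (p - [:0, 1:] * q) a = 0}" by (intro poly_roots_finite) simp
    then have "finite ({a. poly (p - [:0, 1:] * q) a = 0} \<union> {a. poly q a = 0})" using fin by simp
    moreover have "range of_nat \<subseteq> {a. poly (p - [:0, 1:] * q) a = 0} \<union> {a. poly q a = 0}"
      using nat pq by (force simp: field_simps)
    moreover have "infinite (range (of_nat :: nat \<Rightarrow> 'k))"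
      by (simp add: finite_image_iff inj_of_nat)
    ultimately show False using finite_subset by blast
  qed
  then have id: "\<phi> a = a" if "poly q a \<noteq> 0" for a using pq[OF that] that by simp
  have "finite ({z. poly q z = 0} \<union> (\<lambda>z. a - z) ` {z. poly q z = 0})" using fin by simp
  then obtain z where z: "z \<notin> {z. poly q z = 0} \<union> (\<lambda>z. a - z) ` {z. poly q z = 0}"
    using ex_new_if_finite[OF infinite_UNIV_char_0] by blast
  have "poly q (a - z) \<noteq> 0" using z image_iff[of z "\<lambda>z. a - z" "{z. poly q z = 0}"] by force
  then show ?thesis using add[of "a - z" z] id z by simp
qed

context sl2_times_torus
begin

text \<open>The matrices \<open>M a\<close> of the root subgroup commute with the unipotent matrix \<open>M 1\<close>. In a basis that brings
\<open>M 1\<close> into normal form they are therefore \<open>(1 \<phi>(a); 0 1)\<close> with \<open>\<phi>\<close> additive and regular, that is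
\<open>\<phi>(a) = a\<close>. The coroot normalizes this subgroup with pairing \<open>2\<close>, so it is upper triangular with first entry
\<open>\<plusminus> c\<close>; the sign is \<open>+\<close> since every \<open>c\<close> is a square. Finally a unipotent change of basis, which does not affect
\<open>M\<close>, diagonalizes the value of the coroot at \<open>2\<close>, and with it all the values, since they commute.\<close>

lemma root_subgroup_normal_form:
  assumes U: "unipotent_subgroup S VS U" and root: "root_parametrization G VG T U \<alpha> u"
    and coroot: "coroot G VG T \<alpha> \<alpha>\<^sub>v" and T: "T \<subseteq> carrier G"
  shows "\<exists>C Ci. C ** Ci = mat 1 \<and> Ci ** C = mat 1 \<and>
    (\<forall>a. u a = (C ** mat2 1 a 0 1 ** Ci, \<one>\<^bsub>S\<^esub>)) \<and>
    (\<forall>c. c \<noteq> 0 \<longrightarrow> \<alpha>\<^sub>v c = (C ** mat2 c 0 0 (1 / c) ** Ci, \<one>\<^bsub>S\<^esub>))"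
proof -
  have UG: "U \<subseteq> carrier G"
    using U subgroup.subset unfolding unipotent_subgroup_def closed_subgroup_def by blast
  have iso: "u \<in> iso Ga (restrict_group G U)" "isomorphism Ga_var (subspace_on VG U) u"
    using root by (simp_all add: root_parametrization_def alg_group_iso_def)
  have uU: "u a \<in> U" for a using iso(1) by (auto simp: iso_def hom_def Ga_def)
  have u_add: "u (a + b) = u a \<otimes>\<^bsub>G\<^esub> u b" for a b using iso(1) by (auto simp: iso_def hom_def Ga_def)
  have u_inj: "u a = u b \<Longrightarrow> a = b" for a b using iso(1) by (auto simp: iso_def bij_betw_def Ga_def inj_on_def)
  have uni: "unipotent S (u a)" for a using U uU by (simp add: unipotent_subgroup_def)
  define M where "M a = fst (u a)" for a
  have u: "u a = (M a, \<one>\<^bsub>S\<^esub>)" for a using uni[of a] unfolding unipotent_def M_def by (metis prod.collapse)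
  have detM: "det (M a) = 1" for a using UG uU[of a] by (auto simp: u carrier_SL2)
  have M_add: "M (a + b) = M a ** M b" for a b using u_add[of a b] by (simp add: u)
  have "M 0 = mat 1"
  proof -
    have "M 0 ** M 0 = M 0" using M_add[of 0 0] by simp
    then show ?thesis by (metis adj2_mult(2)[OF detM[of 0]] matrix_mul_assoc matrix_mul_lid)
  qed
  then have M1: "M 1 \<noteq> mat 1" using u_inj[of 1 0] by (auto simp: u)
  have "M 1 $ 1 $ 1 + M 1 $ 2 $ 2 = 2"
    using unipotent_trace[OF detM[of 1]] uni[of 1] unfolding unipotent_def by (auto simp: u)
  from unipotent_normal_form[OF detM this M1] obtain C0 Ci0 where
    C0: "C0 ** Ci0 = mat 1" "Ci0 ** C0 = mat 1" "M 1 = C0 ** mat2 1 1 0 1 ** Ci0" by blast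
  interpret A: adapted_basis S VS C0 Ci0 by unfold_locales (rule C0)+
  have M1': "M 1 = A.cj (mat2 1 1 0 1)" by (simp add: C0(3) A.cj_def)
  have comm1: "\<exists>p q. A.uncj (M a) = mat2 p q 0 p \<and> p * p = 1" for a
  proof -
    obtain p q r w where e: "A.uncj (M a) = mat2 p q r w" by (rule mat2_cases)
    then have Ma: "M a = A.cj (mat2 p q r w)" by (metis A.cj_uncj)
    have "M a ** M 1 = M 1 ** M a" by (simp flip: M_add add: add.commute)
    then have "r = 0" "p = w" unfolding Ma M1' by (simp_all add: A.cj_mult)
    then show ?thesis using e detM[of a] unfolding Ma by auto
  qed
  define \<phi> where "\<phi> a = A.uncj (M a) $ 1 $ 2" for a
  have M_\<phi>: "M a = A.cj (mat2 1 (\<phi> a) 0 1)" for a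
  proof -
    obtain p q where pq: "A.uncj (M (a / 2)) = mat2 p q 0 p" "p * p = 1" using comm1 by blast
    \<comment> \<open>squaring removes the sign left open by \<open>p * p = 1\<close>\<close>
    have "M a = M (a / 2) ** M (a / 2)" using M_add[of "a / 2" "a / 2"] by simp
    then have "A.uncj (M a) = mat2 1 (2 * p * q) 0 1" using pq by (simp add: A.uncj_mult)
    then have "A.uncj (M a) = mat2 1 (\<phi> a) 0 1" by (simp add: \<phi>_def)
    then show ?thesis by (metis A.cj_uncj)
  qed
  have \<phi>_id: "\<phi> a = a" for a
  proof (rule additive_regular_function)
    have "morphism Ga_var (subspace_on VG U) u" using iso(2) by (simp add: isomorphism_def)
    from morphism_comp[OF morphism_comp[OF this morphism_subspace_inclusion] A.morphism_uncj_entry[of 1 2]]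
    show "morphism Ga_var Ga_var \<phi>" unfolding \<phi>_def M_def .
    fix a b
    show "\<phi> (a + b) = \<phi> a + \<phi> b"
      using M_add[of a b] unfolding M_\<phi> by (simp add: A.cj_mult add.commute)
    show "\<phi> 1 = 1" by (simp add: \<phi>_def M1')
  qed
  note M_a = M_\<phi>[unfolded \<phi>_id]
  define \<Gamma> where "\<Gamma> c = fst (\<alpha>\<^sub>v c)" for c
  have hom: "\<alpha>\<^sub>v \<in> hom Gm (restrict_group G T)" and der: "\<And>c. c \<noteq> 0 \<Longrightarrow> \<alpha>\<^sub>v c \<in> derived G (carrier G)"
    and pair: "has_pairing \<alpha>\<^sub>v \<alpha> 2"
    using coroot by (simp_all add: coroot_def cocharacter_def)
  have avT: "\<alpha>\<^sub>v c \<in> T" if "c \<noteq> 0" for c using hom that by (auto simp: hom_def Gm_def)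
  have av_mult: "\<alpha>\<^sub>v (c * d) = \<alpha>\<^sub>v c \<otimes>\<^bsub>G\<^esub> \<alpha>\<^sub>v d" if "c \<noteq> 0" "d \<noteq> 0" for c d
    using hom that by (auto simp: hom_def Gm_def)
  have "derived G (carrier G) \<subseteq> {g \<in> carrier G. snd g = \<one>\<^bsub>S\<^esub>}"
    unfolding derived_def
  proof (rule G.generate_subgroup_incl)
    show "subgroup {g \<in> carrier G. snd g = \<one>\<^bsub>S\<^esub>} G"
    proof (rule G.subgroupI)
      show "{g \<in> carrier G. snd g = \<one>\<^bsub>S\<^esub>} \<noteq> {}" using G.one_closed by (auto intro: exI[of _ "\<one>\<^bsub>G\<^esub>"])
    qed (auto simp: carrier_SL2 inv_G det_adj2 det_mul)
    have "s \<otimes>\<^bsub>S\<^esub> t \<otimes>\<^bsub>S\<^esub> inv\<^bsub>S\<^esub> s \<otimes>\<^bsub>S\<^esub> inv\<^bsub>S\<^esub> t = \<one>\<^bsub>S\<^esub>" if "s \<in> carrier S" "t \<in> carrier S" for s t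
      using that by (simp add: S.m_comm[of s t] S.m_assoc)
    then show "derived_set G (carrier G) \<subseteq> {g \<in> carrier G. snd g = \<one>\<^bsub>S\<^esub>}"
      by (auto simp: carrier_SL2 inv_G det_adj2 det_mul)
  qed
  then have av: "\<alpha>\<^sub>v c = (\<Gamma> c, \<one>\<^bsub>S\<^esub>)" and det\<Gamma>: "det (\<Gamma> c) = 1" if "c \<noteq> 0" for c
    using der[OF that] unfolding \<Gamma>_def by (auto simp: carrier_SL2)
  have \<Gamma>_mult: "\<Gamma> (c * d) = \<Gamma> c ** \<Gamma> d" if "c \<noteq> 0" "d \<noteq> 0" for c d
    using av_mult[OF that] that by (simp add: av)
  have \<Gamma>_upper: "\<exists>p q. A.uncj (\<Gamma> c) = mat2 p q 0 (1 / p) \<and> p * p = c * c" if c: "c \<noteq> 0" for c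
  proof -
    obtain p q r w where e: "A.uncj (\<Gamma> c) = mat2 p q r w" by (rule mat2_cases)
    then have g: "\<Gamma> c = A.cj (mat2 p q r w)" by (metis A.cj_uncj)
    have det: "p * w - q * r = 1" using det\<Gamma>[OF c] by (simp add: g)
    have "\<alpha>\<^sub>v c \<otimes>\<^bsub>G\<^esub> u 1 \<otimes>\<^bsub>G\<^esub> inv\<^bsub>G\<^esub> (\<alpha>\<^sub>v c) = u (\<alpha> (\<alpha>\<^sub>v c) * 1)"
      using root avT[OF c] by (simp add: root_parametrization_def)
    moreover have "\<alpha> (\<alpha>\<^sub>v c) = c * c" using pair c by (simp add: has_pairing_def power2_eq_square)
    moreover have "\<alpha>\<^sub>v c \<in> carrier G" "u b \<in> carrier G" for b using avT[OF c] T UG uU by blast+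
    ultimately have "\<alpha>\<^sub>v c \<otimes>\<^bsub>G\<^esub> u 1 = u (c * c) \<otimes>\<^bsub>G\<^esub> \<alpha>\<^sub>v c"
      using G.inv_solve_right'[of "u (c * c)" "\<alpha>\<^sub>v c \<otimes>\<^bsub>G\<^esub> u 1" "\<alpha>\<^sub>v c"] G.m_closed
      by (simp only: mult_1_right)
    then have eq: "mat2 p q r w ** mat2 1 1 0 1 = mat2 1 (c * c) 0 1 ** mat2 p q r w"
      using c by (simp add: av u g M_a A.cj_mult)
    then have "r = 0" "p = c * c * w" using c by auto
    moreover from this det have "p * w = 1" by simp
    moreover from this have "p \<noteq> 0" by auto
    moreover from calculation have "w = 1 / p" by (simp add: eq_divide_eq mult.commute)
    ultimately show ?thesis using e by (auto simp: field_simps)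
  qed
  have \<Gamma>_c: "\<exists>q. A.uncj (\<Gamma> c) = mat2 c q 0 (1 / c)" if c: "c \<noteq> 0" for c
  proof -
    obtain d where d: "d ^ 2 = c" using nth_root_exists[of 2 c] by auto
    have d0: "d \<noteq> 0" using d c by auto
    obtain p q where pq: "A.uncj (\<Gamma> d) = mat2 p q 0 (1 / p)" "p * p = d * d" using \<Gamma>_upper[OF d0] by blast
    have "\<Gamma> c = \<Gamma> d ** \<Gamma> d" using \<Gamma>_mult[OF d0 d0] d by (simp add: power2_eq_square)
    then have "A.uncj (\<Gamma> c) = mat2 p q 0 (1 / p) ** mat2 p q 0 (1 / p)" by (simp add: A.uncj_mult pq)
    then show ?thesis using pq(2) d by (simp add: power2_eq_square)
  qed
  obtain m where m: "A.uncj (\<Gamma> 2) = mat2 2 m 0 (1 / 2)" using \<Gamma>_c[of 2] by auto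
  \<comment> \<open>the solution of \<open>2 z + m - z / 2 = 0\<close>, which makes the entry 12 of the conjugate of \<open>\<Gamma> 2\<close> vanish\<close>
  define z where "z = - (2 * m / 3)"
  define C where "C = C0 ** mat2 1 z 0 1"
  define Ci where "Ci = mat2 1 (- z) 0 1 ** Ci0"
  have inv: "mat2 1 z 0 1 ** mat2 1 (- z) 0 1 = mat 1" "mat2 1 (- z) 0 1 ** mat2 1 z 0 1 = mat 1"
    by (simp_all add: mat_1_mat2)
  have CC: "C ** Ci = mat 1" "Ci ** C = mat 1"
  proof -
    have "C ** Ci = C0 ** (mat2 1 z 0 1 ** mat2 1 (- z) 0 1) ** Ci0"
      unfolding C_def Ci_def by (simp only: matrix_mul_assoc)
    then show "C ** Ci = mat 1" by (simp only: inv matrix_mul_rid C0)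
    have "Ci ** C = mat2 1 (- z) 0 1 ** (Ci0 ** C0) ** mat2 1 z 0 1"
      unfolding C_def Ci_def by (simp only: matrix_mul_assoc)
    then show "Ci ** C = mat 1" by (simp only: inv matrix_mul_rid C0)
  qed
  interpret A': adapted_basis S VS C Ci by unfold_locales (rule CC)+
  have uncj': "A'.uncj X = mat2 1 (- z) 0 1 ** A.uncj X ** mat2 1 z 0 1" for X
    unfolding A'.uncj_def A.uncj_def by (simp only: C_def Ci_def matrix_mul_assoc)
  have "u a = (A'.cj (mat2 1 a 0 1), \<one>\<^bsub>S\<^esub>)" for a
  proof -
    have "A'.uncj (M a) = mat2 1 a 0 1" by (simp add: uncj' M_a)
    then show ?thesis unfolding u by (metis A'.cj_uncj)
  qed
  moreover have "\<alpha>\<^sub>v c = (A'.cj (mat2 c 0 0 (1 / c)), \<one>\<^bsub>S\<^esub>)" if c: "c \<noteq> 0" for c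
  proof -
    obtain q where q: "A.uncj (\<Gamma> c) = mat2 c q 0 (1 / c)" using \<Gamma>_c[OF c] by blast
    define q' where "q' = c * z + (q - z / c)"
    have c': "A'.uncj (\<Gamma> c) = mat2 c q' 0 (1 / c)"
      by (simp add: uncj' q q'_def)
    have two: "A'.uncj (\<Gamma> 2) = mat2 2 0 0 (1 / 2)"
      by (simp add: uncj' m z_def field_simps)
    have "\<Gamma> c ** \<Gamma> 2 = \<Gamma> 2 ** \<Gamma> c" using \<Gamma>_mult[of c 2] \<Gamma>_mult[of 2 c] c by (simp add: mult.commute)
    from arg_cong[OF this, of A'.uncj] have "q' / 2 = 2 * q'" by (simp add: A'.uncj_mult c' two)
    then have "q' = 0" by (simp add: field_simps)
    then show ?thesis unfolding av[OF c] using c' by (metis A'.cj_uncj)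
  qed
  ultimately show ?thesis using CC by (intro exI[of _ C] exI[of _ Ci]) (simp add: A'.cj_def)
qed

end

section \<open>The orbit map on the punctured plane\<close>

lemma open_sets_meet:
  assumes "irreducible_in T (topspace T)" "openin T U" "U \<noteq> {}" "openin T V" "V \<noteq> {}"
  shows "U \<inter> V \<noteq> {}"
proof
  assume e: "U \<inter> V = {}"
  have "closedin T (topspace T - U)" "closedin T (topspace T - V)" using assms(2,4) by auto
  moreover have "topspace T \<subseteq> (topspace T - U) \<union> (topspace T - V)" using e by auto
  ultimately have "topspace T \<subseteq> topspace T - U \<or> topspace T \<subseteq> topspace T - V"
    using assms(1) unfolding irreducible_in_def by blast
  then show False using openin_subset[OF assms(2)] openin_subset[OF assms(4)] assms(3,5) by blast
qed

lemma regular_vanishes_on_dense: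
  assumes X: "function_space X" "irreducible_in (top_of X) (points X)"
    and U: "openin (top_of X) U" "F \<in> regular X U"
    and V: "openin (top_of X) V" "V \<noteq> {}" and zero: "\<And>x. x \<in> U \<inter> V \<Longrightarrow> F x = 0"
  shows "F = (\<lambda>_. 0)"
proof
  fix x
  have "{x \<in> U. F x \<noteq> 0} \<inter> V = {}" using zero by auto
  then have "{x \<in> U. F x \<noteq> 0} = {}"
    using open_sets_meet[OF X(2) nonvanishing_open[OF X(1) U] _ V] by blast
  then show "F x = 0" using sheaf_outside[OF function_space_sheaf[OF X(1)] U] by blast
qed

text \<open>A right inverse, over the punctured plane, of the map sending a matrix in \<open>SL2\<close> to its second column. The second
case makes up for the pole of the first; near each point the map has a regular choice.\<close>

definition sec :: "'k::field^2 \<Rightarrow> 'k^2^2" where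
  "sec p = (if p $ 2 \<noteq> 0 then mat2 (1 / p $ 2) (p $ 1) 0 (p $ 2) else mat2 0 (p $ 1) (- 1 / p $ 1) (p $ 2))"

lemma sec:
  assumes "p \<noteq> 0" shows "det (sec p) = 1" "sec p *v vec2 0 1 = p"
proof -
  obtain a b where p: "p = vec2 a b" by (metis vec2_entries)
  have "a \<noteq> 0 \<or> b \<noteq> 0" using assms by (auto simp: p vec_eq_iff forall_2)
  then show "det (sec p) = 1" "sec p *v vec2 0 1 = p" by (auto simp: sec_def p)
qed

lemma SL2_same_second_column:
  fixes A A' :: "'k::field^2^2"
  assumes "det A = 1" "det A' = 1" "A *v vec2 0 1 = A' *v vec2 0 1"
  shows "\<exists>b. A = A' ** mat2 1 0 b 1"
proof -
  obtain a b c d where A: "A = mat2 a b c d" by (rule mat2_cases)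
  obtain a' b' c' d' where A': "A' = mat2 a' b' c' d'" by (rule mat2_cases)
  have bd: "b = b'" "d = d'" using assms(3) by (simp_all add: A A')
  have 1: "a * d - b * c = 1" "a' * d - b * c' = 1" using assms(1,2) by (simp_all add: A A' bd)
  have "A' ** mat2 1 0 (a' * c - c' * a) 1 = A"
  proof -
    have "a' + b * (a' * c - c' * a) = a' * (a * d - b * c) + b * (a' * c - c' * a)" by (simp add: 1)
    also have "\<dots> = a * (a' * d - b * c')" by (simp add: algebra_simps)
    finally have "a' + b * (a' * c - c' * a) = a" by (simp add: 1)
    moreover have "c' + d * (a' * c - c' * a) = c' * (a * d - b * c) + d * (a' * c - c' * a)" by (simp add: 1)
    then have "c' + d * (a' * c - c' * a) = c * (a' * d - b * c')" by (simp add: algebra_simps)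
    then have "c' + d * (a' * c - c' * a) = c" by (simp add: 1)
    ultimately show ?thesis by (simp add: A A' bd)
  qed
  then show ?thesis by metis
qed

locale adapted_orbit = adapted_basis S VS C Ci
  for S :: "'s monoid" and VS :: "('s, 'k::{alg_closed_field, field_char_0}) fspace" and C Ci :: "'k^2^2" +
  fixes X :: "('x, 'k) fspace" and act :: "('k^2^2) \<times> 's \<Rightarrow> 'x \<Rightarrow> 'x" and x\<^sub>0 :: 'x
  assumes variety: "variety X" and irreducible: "irreducible_in (top_of X) (points X)"
    and action: "algebraic_action G VG X act"
    and x0: "x\<^sub>0 \<in> points X"
    and fixed: "\<And>b. act (cj (mat2 1 0 b 1), \<one>\<^bsub>S\<^esub>) x\<^sub>0 = x\<^sub>0"
begin

sublocale act: group_action G "points X" act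
  using action by (simp add: algebraic_action_def)

lemmas fs = function_space_variety[OF variety]
lemmas sheaf = function_space_sheaf[OF fs]

lemma act_mult: "g \<in> carrier G \<Longrightarrow> h \<in> carrier G \<Longrightarrow> x \<in> points X \<Longrightarrow> act g (act h x) = act (g \<otimes>\<^bsub>G\<^esub> h) x"
  using act.composition_rule by simp

lemma act_points: "g \<in> carrier G \<Longrightarrow> x \<in> points X \<Longrightarrow> act g x \<in> points X"
  using act.element_image by blast

lemma act_one: "x \<in> points X \<Longrightarrow> act \<one>\<^bsub>G\<^esub> x = x"
  using act.id_eq_one by (metis restrict_apply')

lemma act_inv: "g \<in> carrier G \<Longrightarrow> x \<in> points X \<Longrightarrow> act (inv\<^bsub>G\<^esub> g) (act g x) = x"
  "g \<in> carrier G \<Longrightarrow> x \<in> points X \<Longrightarrow> act g (act (inv\<^bsub>G\<^esub> g) x) = x"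
  by (simp_all add: act_mult act_one del: one_DirProd carrier_DirProd)

lemma act_inv_points: "g \<in> carrier G \<Longrightarrow> x \<in> points X \<Longrightarrow> act (inv\<^bsub>G\<^esub> g) x \<in> points X"
  by (rule act_points[OF G.inv_closed])

lemma morphism_action: "morphism (prod_space VG X) X (\<lambda>(g, x). act g x)"
  using action by (simp add: algebraic_action_def)

lemma morphism_act:
  assumes g: "g \<in> carrier G" shows "morphism X X (act g)"
proof -
  have "g \<in> points VG" using g by (simp add: carrier_SL2)
  from morphism_comp[OF morphism_pair[OF fs has_one_G has_one_function_space[OF fs] morphism_const[OF fs this] morphism_id[OF fs]] morphism_action]
  show ?thesis by simp
qed

lemma morphism_orbit_map:
  assumes Y: "function_space Y" and c: "morphism Y VG c" and x: "x \<in> points X"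
  shows "morphism Y X (\<lambda>y. act (c y) x)"
  using morphism_comp[OF morphism_pair[OF Y has_one_G has_one_function_space[OF fs] c morphism_const[OF Y x]] morphism_action]
  by simp

definition orb :: "'s \<Rightarrow> 'k^2 \<Rightarrow> 'x" where "orb s p = act (cj (sec p), s) x\<^sub>0"

lemma cj_in_G: "det A = 1 \<Longrightarrow> s \<in> carrier S \<Longrightarrow> (cj A, s) \<in> carrier G"
  by (simp add: carrier_SL2)

lemma orb_points: "s \<in> carrier S \<Longrightarrow> p \<noteq> 0 \<Longrightarrow> orb s p \<in> points X"
  unfolding orb_def by (intro act_points cj_in_G x0) (simp_all add: sec)

lemma SL2_vec_nonzero:
  fixes Q :: "'k^2^2" assumes "det Q = 1" "p \<noteq> 0" shows "Q *v p \<noteq> 0"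
proof
  assume "Q *v p = 0"
  then have "adj2 Q *v (Q *v p) = 0" by simp
  then show False using assms adj2_mult(2)[OF assms(1)] by (simp add: matrix_vector_mul_assoc)
qed

text \<open>Matrices with the same second column differ by a factor \<open>(1 0; b 1)\<close> on the right, which fixes \<open>x\<^sub>0\<close>. So
\<open>orb s p\<close> does not depend on the choices made in \<open>sec\<close>.\<close>

lemma act_x0:
  assumes A: "det A = 1" and s: "s \<in> carrier S"
  shows "act (cj A, s) x\<^sub>0 = orb s (A *v vec2 0 1)"
proof -
  have "A *v vec2 0 1 \<noteq> 0" by (rule SL2_vec_nonzero[OF A]) (simp add: vec_eq_iff forall_2)
  note sc = sec[OF this]
  obtain b where b: "A = sec (A *v vec2 0 1) ** mat2 1 0 b 1"
    using SL2_same_second_column[OF A sc(1)] sc(2) by auto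
  have "(cj A, s) = (cj (sec (A *v vec2 0 1)), s) \<otimes>\<^bsub>G\<^esub> (cj (mat2 1 0 b 1), \<one>\<^bsub>S\<^esub>)"
    using s by (simp add: cj_mult flip: b)
  then have "act (cj A, s) x\<^sub>0 = act (cj (sec (A *v vec2 0 1)), s) (act (cj (mat2 1 0 b 1), \<one>\<^bsub>S\<^esub>) x\<^sub>0)"
    using s sc by (subst act_mult) (simp_all add: cj_in_G x0 del: carrier_DirProd mult_DirProd)
  then show ?thesis by (simp add: fixed orb_def)
qed

lemma act_orb:
  assumes Q: "det Q = 1" and st: "t \<in> carrier S" "s \<in> carrier S" and p: "p \<noteq> 0"
  shows "act (cj Q, t) (orb s p) = orb (t \<otimes>\<^bsub>S\<^esub> s) (Q *v p)"
proof -
  have "act (cj Q, t) (orb s p) = act (cj (Q ** sec p), t \<otimes>\<^bsub>S\<^esub> s) x\<^sub>0"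
    unfolding orb_def using Q st p
    by (subst act_mult) (simp_all add: cj_in_G x0 sec cj_mult del: carrier_DirProd)
  also have "\<dots> = orb (t \<otimes>\<^bsub>S\<^esub> s) (Q *v p)"
    using Q st p by (subst act_x0) (simp_all add: det_mul sec flip: matrix_vector_mul_assoc)
  finally show ?thesis .
qed

text \<open>Near a point with \<open>p\<^sub>2 \<noteq> 0\<close> use the lift \<open>(1/p\<^sub>2  p\<^sub>1; 0  p\<^sub>2)\<close> to \<open>SL2\<close>, near a point with
\<open>p\<^sub>1 \<noteq> 0\<close> the lift \<open>(0  p\<^sub>1; -1/p\<^sub>1  p\<^sub>2)\<close>. Both are regular on the respective open set, so the
pullback of a regular function on \<open>X\<close> is locally a quotient of polynomials. The factor \<open>p\<^sub>i\<close> put into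
numerator and denominator restricts the quotient to the chart.\<close>

lemma orb_rational:
  assumes V: "openin (top_of X) V" "h \<in> regular X V" and s: "s \<in> carrier S"
    and p0: "p\<^sub>0 \<noteq> 0" "orb s p\<^sub>0 \<in> V"
  shows "\<exists>P\<in>polyfuns plane_coords. \<exists>Q\<in>polyfuns plane_coords. Q p\<^sub>0 \<noteq> 0 \<and>
    (\<forall>p. Q p \<noteq> 0 \<longrightarrow> p \<noteq> 0 \<and> orb s p \<in> V \<and> h (orb s p) = P p / Q p)"
proof -
  have chart: ?thesis
    if i: "p\<^sub>0 $ i \<noteq> 0" and M: "regular_matrix (zariski {p. p $ i \<noteq> 0} plane_coords) M"
      "\<And>p. p $ i \<noteq> 0 \<Longrightarrow> det (M p) = 1 \<and> M p *v vec2 0 1 = p" for i and M :: "'k^2 \<Rightarrow> 'k^2^2"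
  proof -
    let ?Y = "zariski {p :: 'k^2. p $ i \<noteq> 0} plane_coords"
    note fsY = function_space_zariski[of "{p :: 'k^2. p $ i \<noteq> 0}" plane_coords]
    have "morphism ?Y VG (\<lambda>p. (cj (M p), s))"
      using M s by (intro morphism_G_pair morphism_SL2I regular_matrix_cj morphism_const fsY) simp_all
    note m = morphism_orbit_map[OF fsY this x0]
    have eq: "act (cj (M p), s) x\<^sub>0 = orb s p" if "p $ i \<noteq> 0" for p
      using act_x0[OF _ s, of "M p"] M(2)[OF that] by simp
    let ?V = "{p \<in> points ?Y. act (cj (M p), s) x\<^sub>0 \<in> V}"
    have o: "openin (top_of ?Y) ?V" by (rule morphism_preimage_open[OF m V(1)])
    have "p\<^sub>0 \<in> ?V" using i p0 eq by simp
    then obtain P Q where PQ: "P \<in> polyfuns plane_coords" "Q \<in> polyfuns plane_coords" "Q p\<^sub>0 \<noteq> 0"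
        "\<forall>p\<in>{p. p $ i \<noteq> 0}. Q p \<noteq> 0 \<longrightarrow> p \<in> ?V \<and> cut ?V (h \<circ> (\<lambda>p. act (cj (M p), s) x\<^sub>0)) p = P p / Q p"
      using morphism_pullback[OF m V] unfolding regular_zariski[OF o] by auto
    have c: "(\<lambda>p. p $ i) \<in> polyfuns plane_coords" by (auto simp: plane_coords_def intro: polyfuns.coord)
    have "p \<noteq> 0 \<and> orb s p \<in> V \<and> h (orb s p) = P p * p $ i / (Q p * p $ i)" if "Q p * p $ i \<noteq> 0" for p
      using PQ(4) eq[of p] that by (auto simp: cut_def)
    then show ?thesis
      using PQ i c by (intro bexI[of _ "\<lambda>p. P p * p $ i"] bexI[of _ "\<lambda>p. Q p * p $ i"]) (auto intro: polyfuns.mult)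
  qed
  have co: "morphism (zariski P plane_coords) Ga_var (\<lambda>p. p $ j)" for P :: "('k^2) set" and j
    by (rule morphism_Ga_coord) (auto simp: plane_coords_def)
  have ci: "morphism (zariski {p. p $ j \<noteq> 0} plane_coords) Ga_var (\<lambda>p :: 'k^2. 1 / p $ j)" for j
    using morphism_Ga_inverse[OF function_space_zariski co[of "{p. p $ j \<noteq> 0}" j]] by (simp add: inverse_eq_divide)
  show ?thesis
  proof (cases "p\<^sub>0 $ 2 = 0")
    case False
    show ?thesis
    proof (rule chart[OF False])
      show "regular_matrix (zariski {p :: 'k^2. p $ 2 \<noteq> 0} plane_coords) (\<lambda>p. mat2 (1 / p $ 2) (p $ 1) 0 (p $ 2))"
        by (intro regular_matrix_mat2 ci co morphism_Ga_const function_space_zariski)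
      show "det (mat2 (1 / p $ 2) (p $ 1) 0 (p $ 2)) = 1 \<and> mat2 (1 / p $ 2) (p $ 1) 0 (p $ 2) *v vec2 0 1 = p"
        if "p $ 2 \<noteq> 0" for p :: "'k^2" using that by (simp add: vec2_entries)
    qed
  next
    case True
    then have "p\<^sub>0 $ 1 \<noteq> 0" using p0(1) by (auto simp: vec_eq_iff forall_2)
    then show ?thesis
    proof (rule chart)
      show "regular_matrix (zariski {p :: 'k^2. p $ 1 \<noteq> 0} plane_coords) (\<lambda>p. mat2 0 (p $ 1) (- 1 * (1 / p $ 1)) (p $ 2))"
        by (intro regular_matrix_mat2 ci co morphism_Ga_const morphism_Ga_mult function_space_zariski)
      show "det (mat2 0 (p $ 1) (- 1 * (1 / p $ 1)) (p $ 2)) = 1 \<and> mat2 0 (p $ 1) (- 1 * (1 / p $ 1)) (p $ 2) *v vec2 0 1 = p"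
        if "p $ 1 \<noteq> 0" for p :: "'k^2" using that by (simp add: vec2_entries)
    qed
  qed
qed

lemma orb_directional_derivative:
  assumes V: "openin (top_of X) V" "h \<in> regular X V" and s: "s \<in> carrier S"
    and p: "p \<noteq> 0" "orb s p \<in> V"
  shows "\<exists>d. has_deriv_at_0 (\<lambda>a. h (orb s (p + a *s v))) d"
proof -
  obtain P Q where PQ: "P \<in> polyfuns plane_coords" "Q \<in> polyfuns plane_coords" "Q p \<noteq> 0"
      "\<And>p. Q p \<noteq> 0 \<Longrightarrow> h (orb s p) = P p / Q p"
    using orb_rational[OF assms] by auto
  obtain Pv Qv where "polynomial_derivative v P Pv" "polynomial_derivative v Q Qv"
    using polynomial_derivatives_commute[OF PQ(1), of v v] polynomial_derivatives_commute[OF PQ(2), of v v] by auto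
  from has_deriv_at_0_polynomial_quotient[OF this PQ(3), of "\<lambda>p. h (orb s p)"] PQ(4)
  show ?thesis by blast
qed

text \<open>\<open>u(a)\<^sup>-\<^sup>1\<close> moves \<open>p\<close> along the line with direction \<open>- p\<^sub>2 e\<^sub>1\<close>. At points with \<open>p\<^sub>2 = 0\<close>, which are
fixed, both sides vanish.\<close>

lemma infinitesimal_action_orb:
  assumes u: "\<And>a. u a = (cj (mat2 1 a 0 1), \<one>\<^bsub>S\<^esub>)"
    and V: "openin (top_of X) V" "h \<in> regular X V" and s: "s \<in> carrier S"
    and p: "p \<noteq> 0" "orb s p \<in> V" and d: "has_deriv_at_0 (\<lambda>a. h (orb s (p + a *s vec2 1 0))) d"
  shows "infinitesimal_action G X act u V h (orb s p) = - p $ 2 * d"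
proof -
  have "act (inv\<^bsub>G\<^esub> (u a)) (orb s p) = orb s (p + (- p $ 2 * a) *s vec2 1 0)" for a
  proof -
    have "inv\<^bsub>G\<^esub> (u a) = (cj (mat2 1 (- a) 0 1), \<one>\<^bsub>S\<^esub>)" by (simp add: u inv_G adj2_cj)
    moreover have "mat2 1 (- a) 0 1 *v p = p + (- p $ 2 * a) *s vec2 1 0"
      using mat2_vec2[of 1 "- a" 0 1 "p $ 1" "p $ 2"] vec2_entries[of p]
      by (simp add: vec_eq_iff forall_2)
    ultimately show ?thesis using s p by (simp add: act_orb)
  qed
  moreover have "has_deriv_at_0 (\<lambda>a. h (orb s (p + (- p $ 2 * a) *s vec2 1 0))) (- p $ 2 * d)"
    using has_deriv_at_0_scale[OF d, of "- p $ 2"] .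
  ultimately have "(THE d. has_deriv_at_0 (\<lambda>a. h (act (inv\<^bsub>G\<^esub> (u a)) (orb s p))) d) = - p $ 2 * d"
    using has_deriv_at_0_unique by (intro the_equality) simp_all
  then show ?thesis using V p by (simp add: infinitesimal_action_def)
qed

text \<open>The group generated by the diagonal and the upper unipotent matrices acts transitively on the points with
\<open>p\<^sub>2 \<noteq> 0\<close> and multiplies \<open>f\<close> and \<open>p\<^sub>2\<close> by inverse factors, so \<open>f p\<^sub>2\<close> is constant there. If
a point with \<open>p\<^sub>2 = 0\<close> is also mapped to \<open>W\<close>, then the constant \<open>\<kappa>\<close> has to be \<open>0\<close>: on the line through this
point in the direction \<open>e\<^sub>2\<close> the function \<open>f = \<kappa> / p\<^sub>2\<close> would otherwise have a pole where it is regular.\<close>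

lemma semiinvariant_on_orbit:
  assumes semi: "rational_semiinvariant G T U X act \<xi> W f" and s: "s \<in> carrier S"
    and tor: "\<And>c. c \<noteq> 0 \<Longrightarrow> (cj (mat2 c 0 0 (1 / c)), \<one>\<^bsub>S\<^esub>) \<in> T"
    and \<xi>: "\<And>c. c \<noteq> 0 \<Longrightarrow> \<xi> (cj (mat2 c 0 0 (1 / c)), \<one>\<^bsub>S\<^esub>) = 1 / c"
    and up: "\<And>b. (cj (mat2 1 b 0 1), \<one>\<^bsub>S\<^esub>) \<in> U"
  shows "\<exists>\<kappa>. \<forall>p. p \<noteq> 0 \<longrightarrow> orb s p \<in> W \<longrightarrow> f (orb s p) * p $ 2 = \<kappa>"
proof -
  have W: "openin (top_of X) W" "f \<in> regular X W" using semi by (simp_all add: rational_semiinvariant_def)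
  have ratio: "f (orb s p) * p $ 2 = f (orb s p') * p' $ 2"
    if p: "p $ 2 \<noteq> 0" "orb s p \<in> W" and p': "p' $ 2 \<noteq> 0" "orb s p' \<in> W" for p p'
  proof -
    define c where "c = p' $ 2 / p $ 2"
    define b where "b = (p $ 1 / c - p' $ 1) / p' $ 2"
    have c0: "c \<noteq> 0" using p p' by (simp add: c_def)
    let ?t = "(cj (mat2 c 0 0 (1 / c)), \<one>\<^bsub>S\<^esub>)" and ?v = "(cj (mat2 1 b 0 1), \<one>\<^bsub>S\<^esub>)"
    have nz: "p \<noteq> 0" "p' \<noteq> 0" using p p' by auto
    have inv: "inv\<^bsub>G\<^esub> (?t \<otimes>\<^bsub>G\<^esub> ?v) = (cj (mat2 (1 / c) (- (c * b)) 0 c), \<one>\<^bsub>S\<^esub>)"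
      using c0 by (simp add: cj_mult inv_G adj2_cj)
    have "mat2 (1 / c) (- (c * b)) 0 c *v p = p'"
    proof -
      have "c * p $ 2 = p' $ 2" using p by (simp add: c_def)
      moreover have "p $ 1 / c + - (c * b) * p $ 2 = p' $ 1"
      proof -
        have "c * b * p $ 2 = b * (c * p $ 2)" by simp
        also have "\<dots> = p $ 1 / c - p' $ 1" using p' by (simp add: \<open>c * p $ 2 = p' $ 2\<close> b_def)
        finally show ?thesis by simp
      qed
      ultimately show ?thesis
        using mat2_vec2[of "1 / c" "- (c * b)" 0 c "p $ 1" "p $ 2"] vec2_entries[of p]
        by (simp add: vec_eq_iff forall_2)
    qed
    then have a: "act (inv\<^bsub>G\<^esub> (?t \<otimes>\<^bsub>G\<^esub> ?v)) (orb s p) = orb s p'"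
      unfolding inv using c0 s nz by (subst act_orb) simp_all
    have "f (orb s p') = \<xi> ?t * f (orb s p)"
      using semi tor[OF c0] up[of b] p(2) p'(2) a unfolding rational_semiinvariant_def by metis
    then show ?thesis using p p' \<xi>[OF c0] by (simp add: c_def)
  qed
  have zero: "f (orb s p') * p' $ 2 = 0"
    if p: "p \<noteq> 0" "p $ 2 = 0" "orb s p \<in> W" and p': "p' $ 2 \<noteq> 0" "orb s p' \<in> W" for p p'
  proof -
    obtain P Q where PQ: "P \<in> polyfuns plane_coords" "Q \<in> polyfuns plane_coords" "Q p \<noteq> 0"
        "\<forall>p. Q p \<noteq> 0 \<longrightarrow> p \<noteq> 0 \<and> orb s p \<in> W \<and> f (orb s p) = P p / Q p"
      using orb_rational[OF W s p(1,3)] by blast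
    obtain P' Q' where "polynomial_derivative (vec2 0 1) P P'" "polynomial_derivative (vec2 0 1) Q Q'"
      using polynomial_derivatives_commute[OF PQ(1), of "vec2 0 1" "vec2 0 1"]
        polynomial_derivatives_commute[OF PQ(2), of "vec2 0 1" "vec2 0 1"] by blast
    then obtain r q where rq: "\<And>a. P (p + a *s vec2 0 1) = poly r a" "\<And>a. Q (p + a *s vec2 0 1) = poly q a"
      unfolding polynomial_derivative_def by meson
    have q0: "poly q 0 \<noteq> 0" using rq(2)[of 0] PQ(3) by simp
    define \<kappa> where "\<kappa> = f (orb s p') * p' $ 2"
    have "poly ([:0, 1:] * q * ([:0, 1:] * r - smult \<kappa> q)) a = 0" for a
    proof (cases "a = 0 \<or> poly q a = 0")
      case False
      let ?p = "p + a *s vec2 0 1"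
      have "?p $ 2 = a" using p(2) by simp
      moreover have "f (orb s ?p) = poly r a / poly q a" "orb s ?p \<in> W"
        using PQ(4) rq False by auto
      ultimately have "poly r a / poly q a * a = \<kappa>"
        using ratio[OF _ _ p', of ?p] False unfolding \<kappa>_def by simp
      then show ?thesis using False by (simp add: field_simps)
    qed auto
    then have "[:0, 1:] * q * ([:0, 1:] * r - smult \<kappa> q) = 0" using poly_all_0_iff_0 by blast
    then have "[:0, 1:] * r - smult \<kappa> q = 0" using q0 by auto
    from arg_cong[OF this, of "\<lambda>f. poly f 0"] have "\<kappa> = 0" using q0 by simp
    then show ?thesis by (simp add: \<kappa>_def)
  qed
  show ?thesis
  proof (cases "\<exists>p'. p' $ 2 \<noteq> 0 \<and> orb s p' \<in> W")
    case True
    then obtain p' where p': "p' $ 2 \<noteq> 0" "orb s p' \<in> W" by blast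
    show ?thesis
    proof (intro exI[of _ "f (orb s p') * p' $ 2"] allI impI)
      fix p :: "'k^2" assume "p \<noteq> 0" "orb s p \<in> W"
      then show "f (orb s p) * p $ 2 = f (orb s p') * p' $ 2"
        using ratio[OF _ _ p', of p] zero[OF _ _ _ p', of p] by (cases "p $ 2 = 0") auto
    qed
  next
    case False
    then show ?thesis by (intro exI[of _ 0]) auto
  qed
qed

text \<open>Along \<open>p \<mapsto> orb s p\<close> the vector field \<open>E\<close> is \<open>c\<close> times the derivative in the direction \<open>v\<close>, as far as the
orbit meets \<open>W\<close>. The constant may vary with \<open>s\<close>.\<close>

definition constant_on_plane :: "('x, 'k) vfield \<Rightarrow> 'x set \<Rightarrow> 's \<Rightarrow> 'k^2 \<Rightarrow> 'k \<Rightarrow> bool" where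
  "constant_on_plane E W s v c \<longleftrightarrow>
     (\<forall>V h p. openin (top_of X) V \<longrightarrow> V \<subseteq> W \<longrightarrow> h \<in> regular X V \<longrightarrow> p \<noteq> 0 \<longrightarrow> orb s p \<in> V \<longrightarrow>
        (\<exists>d. has_deriv_at_0 (\<lambda>a. h (orb s (p + a *s v))) d \<and> E V h (orb s p) = c * d))"

text \<open>The factor \<open>- p\<^sub>2\<close> of \<open>infinitesimal_action_orb\<close> cancels against the denominator of \<open>f\<close>.\<close>

lemma highest_weight_constant_on_plane:
  assumes u: "\<And>a. u a = (cj (mat2 1 a 0 1), \<one>\<^bsub>S\<^esub>)"
    and semi: "rational_semiinvariant G T U X act \<xi> W f" and s: "s \<in> carrier S"
    and tor: "\<And>c. c \<noteq> 0 \<Longrightarrow> (cj (mat2 c 0 0 (1 / c)), \<one>\<^bsub>S\<^esub>) \<in> T"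
    and \<xi>: "\<And>c. c \<noteq> 0 \<Longrightarrow> \<xi> (cj (mat2 c 0 0 (1 / c)), \<one>\<^bsub>S\<^esub>) = 1 / c"
    and up: "\<And>b. (cj (mat2 1 b 0 1), \<one>\<^bsub>S\<^esub>) \<in> U"
    and D: "rational_multiple X W f (infinitesimal_action G X act u) D"
  shows "\<exists>c. constant_on_plane D W s (vec2 1 0) c"
proof -
  obtain \<kappa> where \<kappa>: "\<And>p. p \<noteq> 0 \<Longrightarrow> orb s p \<in> W \<Longrightarrow> f (orb s p) * p $ 2 = \<kappa>"
    using semiinvariant_on_orbit[OF semi s tor \<xi> up] by blast
  have "constant_on_plane D W s (vec2 1 0) (- \<kappa>)"
    unfolding constant_on_plane_def
  proof (intro allI impI)
    fix V h p assume V: "openin (top_of X) V" "V \<subseteq> W" "h \<in> regular X V" and p: "p \<noteq> 0" "orb s p \<in> V"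
    obtain d where d: "has_deriv_at_0 (\<lambda>a. h (orb s (p + a *s vec2 1 0))) d"
      using orb_directional_derivative[OF V(1,3) s p] by blast
    have "D V h (orb s p) = f (orb s p) * (- p $ 2 * d)"
      using D V infinitesimal_action_orb[OF u V(1,3) s p d] unfolding rational_multiple_def by simp
    also have "\<dots> = - \<kappa> * d" using \<kappa>[of p] p V(2) by (auto simp: algebra_simps)
    finally show "\<exists>d. has_deriv_at_0 (\<lambda>a. h (orb s (p + a *s vec2 1 0))) d \<and> D V h (orb s p) = - \<kappa> * d"
      using d by blast
  qed
  then show ?thesis by blast
qed

subsection \<open>Translates of vector fields\<close>

text \<open>The function \<open>g\<^sup>-\<^sup>1 f\<close> on the translate \<open>g\<^sup>-\<^sup>1 U\<close>, as it occurs in the action on vector fields.\<close>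

definition pull :: "('k^2^2) \<times> 's \<Rightarrow> 'x set \<Rightarrow> ('x \<Rightarrow> 'k) \<Rightarrow> 'x \<Rightarrow> 'k" where
  "pull g U f = cut (act (inv\<^bsub>G\<^esub> g) ` U) (\<lambda>y. f (act g y))"

lemma translate_eq:
  assumes g: "g \<in> carrier G" and U: "U \<subseteq> points X"
  shows "act (inv\<^bsub>G\<^esub> g) ` U = {y \<in> points X. act g y \<in> U}"
proof
  show "act (inv\<^bsub>G\<^esub> g) ` U \<subseteq> {y \<in> points X. act g y \<in> U}"
    using act_inv(2)[OF g] act_inv_points[OF g] U by (auto simp: subset_iff)
  show "{y \<in> points X. act g y \<in> U} \<subseteq> act (inv\<^bsub>G\<^esub> g) ` U"
    using act_inv(1)[OF g] by (force intro: rev_image_eqI)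
qed

lemma translate_open:
  assumes g: "g \<in> carrier G" and U: "openin (top_of X) U" shows "openin (top_of X) (act (inv\<^bsub>G\<^esub> g) ` U)"
  using morphism_preimage_open[OF morphism_act[OF g] U] translate_eq[OF g openin_subset[OF U]] by simp

lemma pull_regular:
  assumes g: "g \<in> carrier G" and U: "openin (top_of X) U" and f: "f \<in> regular X U"
  shows "pull g U f \<in> regular X (act (inv\<^bsub>G\<^esub> g) ` U)"
  using morphism_pullback[OF morphism_act[OF g] U f] translate_eq[OF g openin_subset[OF U]]
  by (simp add: pull_def comp_def)

lemma act_vfield_apply:
  "openin (top_of X) U \<Longrightarrow> f \<in> regular X U \<Longrightarrow> x \<in> U \<Longrightarrow>
     act_vfield G X act g D U f x = D (act (inv\<^bsub>G\<^esub> g) ` U) (pull g U f) (act (inv\<^bsub>G\<^esub> g) x)"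
  by (simp add: act_vfield_def pull_def)

lemma act_vfield_junk:
  "\<not> (openin (top_of X) U \<and> f \<in> regular X U \<and> x \<in> U) \<Longrightarrow> act_vfield G X act g D U f x = 0"
  by (auto simp: act_vfield_def)

lemma vfield_junk:
  assumes "D \<in> vector_fields X" "\<not> (openin (top_of X) U \<and> f \<in> regular X U)" shows "D U f = (\<lambda>_. 0)"
  using assms by (auto simp: vector_fields_def)

lemma vfield_regular: "D \<in> vector_fields X \<Longrightarrow> openin (top_of X) U \<Longrightarrow> f \<in> regular X U \<Longrightarrow> D U f \<in> regular X U"
  by (auto simp: vector_fields_def)

lemma vfield_scale: "D \<in> vector_fields X \<Longrightarrow> openin (top_of X) U \<Longrightarrow> f \<in> regular X U \<Longrightarrow> D U (\<lambda>x. c * f x) = (\<lambda>x. c * D U f x)"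
  by (auto simp: vector_fields_def)

lemma vfield_add: "D \<in> vector_fields X \<Longrightarrow> openin (top_of X) U \<Longrightarrow> f \<in> regular X U \<Longrightarrow> g \<in> regular X U \<Longrightarrow>
    D U (\<lambda>x. f x + g x) = (\<lambda>x. D U f x + D U g x)"
  by (auto simp: vector_fields_def)

lemma vfield_restrict: "D \<in> vector_fields X \<Longrightarrow> openin (top_of X) U \<Longrightarrow> f \<in> regular X U \<Longrightarrow>
    openin (top_of X) V \<Longrightarrow> V \<subseteq> U \<Longrightarrow> D V (cut V f) = cut V (D U f)"
  by (auto simp: vector_fields_def)

lemma vfield_zero: "D \<in> vector_fields X \<Longrightarrow> D U (\<lambda>_. 0) = (\<lambda>_. 0)"
  using vfield_scale[of D U "\<lambda>_. 0" 0] regular_zero[OF fs] vfield_junk[of D U "\<lambda>_. 0"] by auto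

lemma vfield_outside: "D \<in> vector_fields X \<Longrightarrow> x \<notin> U \<Longrightarrow> D U f x = 0"
  using vfield_junk[of D U f] vfield_regular[of D U f] sheaf_outside[OF sheaf, of U "D U f" x] by metis

lemma act_vfield_mult:
  assumes g: "g \<in> carrier G" and h: "h \<in> carrier G"
  shows "act_vfield G X act g (act_vfield G X act h D) = act_vfield G X act (g \<otimes>\<^bsub>G\<^esub> h) D"
proof (intro ext)
  fix U f x
  show "act_vfield G X act g (act_vfield G X act h D) U f x = act_vfield G X act (g \<otimes>\<^bsub>G\<^esub> h) D U f x"
  proof (cases "openin (top_of X) U \<and> f \<in> regular X U \<and> x \<in> U")
    case True
    then have U: "openin (top_of X) U" "f \<in> regular X U" "x \<in> U" by auto
    have sub: "U \<subseteq> points X" using openin_subset[OF U(1)] .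
    have inv: "act (inv\<^bsub>G\<^esub> h) (act (inv\<^bsub>G\<^esub> g) y) = act (inv\<^bsub>G\<^esub> (g \<otimes>\<^bsub>G\<^esub> h)) y" if "y \<in> points X" for y
      using g h that by (simp only: act_mult G.inv_closed G.inv_mult_group)
    have "act (inv\<^bsub>G\<^esub> h) ` act (inv\<^bsub>G\<^esub> g) ` U = act (inv\<^bsub>G\<^esub> (g \<otimes>\<^bsub>G\<^esub> h)) ` U"
      using inv sub by (auto simp: image_image subset_iff intro!: image_cong)
    moreover have "pull h (act (inv\<^bsub>G\<^esub> g) ` U) (pull g U f) = pull (g \<otimes>\<^bsub>G\<^esub> h) U f"
      unfolding pull_def calculation
    proof (rule cut_cong)
      fix y assume y: "y \<in> act (inv\<^bsub>G\<^esub> (g \<otimes>\<^bsub>G\<^esub> h)) ` U"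
      then have y: "y \<in> points X" "act (g \<otimes>\<^bsub>G\<^esub> h) y \<in> U"
        using translate_eq[OF G.m_closed[OF g h] sub] by auto
      moreover have "act h y \<in> act (inv\<^bsub>G\<^esub> g) ` U"
        unfolding translate_eq[OF g sub] using act_mult[OF g h y(1)] y act_points[OF h] by simp
      ultimately show "cut (act (inv\<^bsub>G\<^esub> g) ` U) (\<lambda>y. f (act g y)) (act h y) = f (act (g \<otimes>\<^bsub>G\<^esub> h) y)"
        using act_mult[OF g h y(1)] by (simp add: cut_apply)
    qed
    ultimately show ?thesis
      using U translate_open[OF g U(1)] pull_regular[OF g U(1,2)] inv[of x] sub
      by (simp add: act_vfield_apply subset_iff)
  qed (simp add: act_vfield_junk)
qed

lemma act_vfield_one:
  assumes "D \<in> vector_fields X" shows "act_vfield G X act \<one>\<^bsub>G\<^esub> D = D"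
proof (intro ext)
  fix U f x
  show "act_vfield G X act \<one>\<^bsub>G\<^esub> D U f x = D U f x"
  proof (cases "openin (top_of X) U \<and> f \<in> regular X U \<and> x \<in> U")
    case True
    then have U: "openin (top_of X) U" "f \<in> regular X U" "x \<in> U" by auto
    have sub: "y \<in> U \<Longrightarrow> act \<one>\<^bsub>G\<^esub> y = y" for y using openin_subset[OF U(1)] act_one by blast
    have inv1: "inv\<^bsub>G\<^esub> \<one>\<^bsub>G\<^esub> = \<one>\<^bsub>G\<^esub>" by (rule G.inv_one)
    have "act (inv\<^bsub>G\<^esub> \<one>\<^bsub>G\<^esub>) ` U = U" unfolding inv1 using sub by force
    moreover from this have "pull \<one>\<^bsub>G\<^esub> U f = f"
      unfolding pull_def using cut_cong[of U "\<lambda>y. f (act \<one>\<^bsub>G\<^esub> y)" f] sub sheaf_cut[OF sheaf U(1,2)] by (simp del: one_DirProd)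
    ultimately show ?thesis using U sub[of x] by (simp add: act_vfield_apply inv1 del: one_DirProd)
  next
    case False
    then show ?thesis using vfield_junk[OF assms, of U f] vfield_outside[OF assms, of x U f] act_vfield_junk by metis
  qed
qed

lemma act_vfield_bracket:
  assumes g: "g \<in> carrier G" and D: "D \<in> vector_fields X" and E: "E \<in> vector_fields X"
    and gD: "act_vfield G X act g D \<in> vector_fields X" and gE: "act_vfield G X act g E \<in> vector_fields X"
  shows "lie_bracket (act_vfield G X act g D) (act_vfield G X act g E) = act_vfield G X act g (lie_bracket D E)"
proof (intro ext)
  fix U f x
  let ?g = "act_vfield G X act g"
  show "lie_bracket (?g D) (?g E) U f x = ?g (lie_bracket D E) U f x"
  proof (cases "openin (top_of X) U \<and> f \<in> regular X U \<and> x \<in> U")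
    case True
    then have U: "openin (top_of X) U" "f \<in> regular X U" "x \<in> U" by auto
    let ?U = "act (inv\<^bsub>G\<^esub> g) ` U"
    have pull: "pull g U (?g A U f) = A ?U (pull g U f)" if A: "A \<in> vector_fields X" for A
    proof
      fix y
      show "pull g U (?g A U f) y = A ?U (pull g U f) y"
      proof (cases "y \<in> ?U")
        case True
        then have "y \<in> points X" "act g y \<in> U" using translate_eq[OF g openin_subset[OF U(1)]] by auto
        then show ?thesis using True U act_inv(1)[OF g] by (simp add: pull_def cut_apply act_vfield_apply)
      next
        case False
        then show ?thesis using vfield_outside[OF A False] by (simp add: pull_def cut_def)
      qed
    qed
    show ?thesis
      using U vfield_regular[OF gD U(1,2)] vfield_regular[OF gE U(1,2)]
      by (simp add: lie_bracket_def act_vfield_apply pull D E)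
  next
    case False
    then have "lie_bracket (?g D) (?g E) U f x = 0"
      using vfield_junk[OF gD, of U f] vfield_junk[OF gE, of U f] vfield_zero[OF gD] vfield_zero[OF gE]
        vfield_outside[OF gD, of x U] vfield_outside[OF gE, of x U]
      by (cases "x \<in> U") (auto simp: lie_bracket_def)
    then show ?thesis using False by (simp add: act_vfield_junk)
  qed
qed

text \<open>By equivariance of the orbit maps, \<open>(Q, t)\<close> maps the line \<open>q + a v\<close> of the plane belonging to
\<open>t\<^sup>-\<^sup>1 s\<close> to the line \<open>Q q + a Q v\<close> of the plane belonging to \<open>s\<close>.\<close>

lemma constant_on_plane_translate:
  assumes E: "constant_on_plane E W (inv\<^bsub>S\<^esub> t \<otimes>\<^bsub>S\<^esub> s) v c" and Q: "det Q = 1" and st: "s \<in> carrier S" "t \<in> carrier S"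
  shows "constant_on_plane (act_vfield G X act (cj Q, t) E) {x \<in> points X. act (inv\<^bsub>G\<^esub> (cj Q, t)) x \<in> W} s (Q *v v) c"
  unfolding constant_on_plane_def
proof (intro allI impI)
  let ?g = "(cj Q, t)"
  have g: "?g \<in> carrier G" using Q st by (intro cj_in_G)
  fix V h p assume V: "openin (top_of X) V" "V \<subseteq> {x \<in> points X. act (inv\<^bsub>G\<^esub> ?g) x \<in> W}" "h \<in> regular X V"
    and p: "p \<noteq> 0" "orb s p \<in> V"
  let ?V = "act (inv\<^bsub>G\<^esub> ?g) ` V" and ?s = "inv\<^bsub>S\<^esub> t \<otimes>\<^bsub>S\<^esub> s"
  define q where "q = adj2 Q *v p"
  have q0: "q \<noteq> 0" unfolding q_def by (rule SL2_vec_nonzero) (use Q p in \<open>simp_all add: det_adj2\<close>)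
  have Qq: "Q *v q = p" unfolding q_def by (simp add: matrix_vector_mul_assoc adj2_mult[OF Q])
  have s': "?s \<in> carrier S" "t \<otimes>\<^bsub>S\<^esub> ?s = s" using st by (simp_all add: S.m_assoc[symmetric])
  have orb_q: "act (inv\<^bsub>G\<^esub> ?g) (orb s p) = orb ?s q"
    using Q st p by (simp add: inv_G adj2_cj act_orb det_adj2 q_def)
  have orb_back: "act ?g (orb ?s y) = orb s (Q *v y)" if "y \<noteq> 0" for y
    using act_orb[OF Q st(2) s'(1) that] s' by simp
  have "orb ?s q \<in> ?V" using p orb_q by (metis image_eqI)
  moreover have "?V \<subseteq> W" using V(2) by auto
  ultimately obtain d where d: "has_deriv_at_0 (\<lambda>a. pull ?g V h (orb ?s (q + a *s v))) d"
      "E ?V (pull ?g V h) (orb ?s q) = c * d"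
    using E translate_open[OF g V(1)] pull_regular[OF g V(1,3)] q0 unfolding constant_on_plane_def by blast
  \<comment> \<open>\<open>orb\<close> has no meaning at the origin, which the line \<open>q + a v\<close> may meet, though not at \<open>a = 0\<close>\<close>
  have "finite {a. q + a *s v = 0}"
  proof (cases "v = 0")
    case False
    then obtain i where i: "v $ i \<noteq> 0" by (auto simp: vec_eq_iff)
    have "{a. q + a *s v = 0} \<subseteq> {- (q $ i) / v $ i}"
      using i by (auto simp: vec_eq_iff field_simps eq_neg_iff_add_eq_0 dest!: spec[of _ i])
    then show ?thesis using finite_subset by blast
  qed (use q0 in simp)
  moreover have "h (orb s (p + a *s (Q *v v))) = pull ?g V h (orb ?s (q + a *s v))" if "q + a *s v \<noteq> 0" for a
  proof -
    have lin: "Q *v (q + a *s v) = p + a *s (Q *v v)"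
      by (simp add: matrix_vector_right_distrib Qq vector_scalar_commute)
    have "pull ?g V h (orb ?s (q + a *s v)) = h (act ?g (orb ?s (q + a *s v)))"
    proof (cases "orb ?s (q + a *s v) \<in> ?V")
      case False
      then have "act ?g (orb ?s (q + a *s v)) \<notin> V"
        using translate_eq[OF g openin_subset[OF V(1)]] orb_points[OF s'(1) that] by blast
      then show ?thesis using False sheaf_outside[OF sheaf V(1,3)] by (simp add: pull_def cut_def)
    qed (simp add: pull_def cut_apply)
    then show ?thesis using orb_back[OF that] lin by simp
  qed
  ultimately have "has_deriv_at_0 (\<lambda>a. h (orb s (p + a *s (Q *v v)))) d"
    using has_deriv_at_0_cong[OF d(1), of "{a. q + a *s v = 0}"] q0 by auto
  moreover have "act_vfield G X act ?g E V h (orb s p) = c * d"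
    using V p d(2) by (simp add: act_vfield_apply orb_q)
  ultimately show "\<exists>d. has_deriv_at_0 (\<lambda>a. h (orb s (p + a *s (Q *v v)))) d \<and> act_vfield G X act ?g E V h (orb s p) = c * d"
    by blast
qed

text \<open>Both fields may be evaluated on \<open>U \<inter> W1 \<inter> W2\<close>, where they are constant multiples of directional derivatives of
rational functions on the plane; these commute.\<close>

lemma constant_fields_commute:
  assumes D: "D \<in> vector_fields X" "constant_on_plane D W1 s v c1" and W1: "openin (top_of X) W1"
    and E: "E \<in> vector_fields X" "constant_on_plane E W2 s w c2" and W2: "openin (top_of X) W2"
    and s: "s \<in> carrier S" and U: "openin (top_of X) U" "f \<in> regular X U"
    and p: "p \<noteq> 0" "orb s p \<in> U" "orb s p \<in> W1" "orb s p \<in> W2"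
  shows "lie_bracket D E U f (orb s p) = 0"
proof -
  define V where "V = U \<inter> W1 \<inter> W2"
  have V: "openin (top_of X) V" "V \<subseteq> U" "V \<subseteq> W1" "V \<subseteq> W2" "orb s p \<in> V"
    using U W1 W2 p by (auto simp: V_def)
  define h where "h = cut V f"
  have h: "h \<in> regular X V" unfolding h_def by (rule sheaf_restrict[OF sheaf U(1) V(1,2) U(2)])
  have Dh: "D V h \<in> regular X V" and Eh: "E V h \<in> regular X V"
    using vfield_regular D E V(1) h by blast+
  obtain P Q where PQ: "P \<in> polyfuns plane_coords" "Q \<in> polyfuns plane_coords" "Q p \<noteq> 0"
      "\<forall>p. Q p \<noteq> 0 \<longrightarrow> p \<noteq> 0 \<and> orb s p \<in> V \<and> h (orb s p) = P p / Q p"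
    using orb_rational[OF V(1) h s p(1) V(5)] by blast
  have 1: "\<exists>d. has_deriv_at_0 (\<lambda>a. h (orb s (y + a *s v))) d \<and> D V h (orb s y) = c1 * d" if "Q y \<noteq> 0" for y
    using D(2) PQ(4) that V(1,3) h unfolding constant_on_plane_def by blast
  have 2: "\<exists>d. has_deriv_at_0 (\<lambda>a. h (orb s (y + a *s w))) d \<and> E V h (orb s y) = c2 * d" if "Q y \<noteq> 0" for y
    using E(2) PQ(4) that V(1,4) h unfolding constant_on_plane_def by blast
  obtain e where e: "has_deriv_at_0 (\<lambda>a. D V h (orb s (p + a *s w))) (c1 * e)"
      "has_deriv_at_0 (\<lambda>a. E V h (orb s (p + a *s v))) (c2 * e)"
    using directional_derivatives_commute[OF PQ(1-3), of "\<lambda>p. h (orb s p)" v "\<lambda>p. D V h (orb s p)" c1 w "\<lambda>p. E V h (orb s p)" c2]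
      PQ(4) 1 2 by blast
  obtain d1 where "has_deriv_at_0 (\<lambda>a. E V h (orb s (p + a *s v))) d1" "D V (E V h) (orb s p) = c1 * d1"
    using D(2) V(1,3,5) Eh p(1) unfolding constant_on_plane_def by blast
  then have DE: "D V (E V h) (orb s p) = c1 * (c2 * e)" using has_deriv_at_0_unique e(2) by blast
  obtain d2 where "has_deriv_at_0 (\<lambda>a. D V h (orb s (p + a *s w))) d2" "E V (D V h) (orb s p) = c2 * d2"
    using E(2) V(1,4,5) Dh p(1) unfolding constant_on_plane_def by blast
  then have ED: "E V (D V h) (orb s p) = c2 * (c1 * e)" using has_deriv_at_0_unique e(1) by blast
  have "D U (E U f) (orb s p) = D V (E V h) (orb s p)"
    using vfield_restrict[OF D(1) U(1) vfield_regular[OF E(1) U] V(1,2)] vfield_restrict[OF E(1) U V(1,2)] V(5)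
    unfolding h_def by (metis cut_apply)
  moreover have "E U (D U f) (orb s p) = E V (D V h) (orb s p)"
    using vfield_restrict[OF E(1) U(1) vfield_regular[OF D(1) U] V(1,2)] vfield_restrict[OF D(1) U V(1,2)] V(5)
    unfolding h_def by (metis cut_apply)
  ultimately show ?thesis by (simp add: lie_bracket_def DE ED)
qed

end

section \<open>Vanishing of the brackets\<close>

context adapted_orbit
begin

lemma lie_bracket_regular:
  assumes D: "D \<in> vector_fields X" and E: "E \<in> vector_fields X" and U: "openin (top_of X) U" "f \<in> regular X U"
  shows "lie_bracket D E U f \<in> regular X U"
proof -
  have 1: "D U (E U f) \<in> regular X U" and 2: "E U (D U f) \<in> regular X U"
    using vfield_regular D E U by blast+
  have "(\<lambda>x. D U (E U f) x + cut U (\<lambda>_. - 1) x * E U (D U f) x) \<in> regular X U"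
    by (intro regular_add regular_mult regular_const fs U 1 2)
  moreover have "(\<lambda>x. D U (E U f) x + cut U (\<lambda>_. - 1) x * E U (D U f) x) = lie_bracket D E U f"
    using vfield_outside[OF D] vfield_outside[OF E] by (auto simp: lie_bracket_def cut_def fun_eq_iff)
  ultimately show ?thesis by simp
qed

lemma lie_bracket_junk:
  assumes D: "D \<in> vector_fields X" and E: "E \<in> vector_fields X" and "\<not> (openin (top_of X) U \<and> f \<in> regular X U)"
  shows "lie_bracket D E U f = (\<lambda>_. 0)"
  using vfield_junk[OF D assms(3)] vfield_junk[OF E assms(3)] vfield_zero[OF D] vfield_zero[OF E]
  by (simp add: lie_bracket_def)

text \<open>The open orbit meets \<open>W1 \<inter> W2\<close> in a nonempty open set, which is dense by irreducibility, and all its points are of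
the form \<open>orb s p\<close>.\<close>

lemma constant_fields_bracket_zero:
  assumes orbit: "openin (top_of X) (orbit G act x\<^sub>0)"
    and D: "D \<in> vector_fields X" "openin (top_of X) W1" "W1 \<noteq> {}"
    and E: "E \<in> vector_fields X" "openin (top_of X) W2" "W2 \<noteq> {}"
    and const: "\<And>s. s \<in> carrier S \<Longrightarrow> \<exists>c. constant_on_plane D W1 s v c"
      "\<And>s. s \<in> carrier S \<Longrightarrow> \<exists>c. constant_on_plane E W2 s w c"
  shows "lie_bracket D E = 0"
proof (intro ext)
  fix U f x
  show "lie_bracket D E U f x = 0 U f x"
  proof (cases "openin (top_of X) U \<and> f \<in> regular X U")
    case True
    let ?O = "orbit G act x\<^sub>0"
    have "?O \<noteq> {}" unfolding orbit_def using G.one_closed by blast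
    then have V: "W1 \<inter> W2 \<inter> ?O \<noteq> {}" "openin (top_of X) (W1 \<inter> W2 \<inter> ?O)"
      using open_sets_meet[OF irreducible] D E orbit by (auto simp: openin_Int)
    have "lie_bracket D E U f y = 0" if y: "y \<in> U \<inter> (W1 \<inter> W2 \<inter> ?O)" for y
    proof -
      obtain A s where "(A, s) \<in> carrier G" "y = act (A, s) x\<^sub>0" using y unfolding orbit_def by auto
      then have A: "det (uncj A) = 1" and s: "s \<in> carrier S" and "y = act (cj (uncj A), s) x\<^sub>0"
        by (simp_all add: carrier_SL2)
      then have yp: "y = orb s (uncj A *v vec2 0 1)" using act_x0[OF A s] by simp
      have p: "uncj A *v vec2 0 1 \<noteq> 0" by (rule SL2_vec_nonzero[OF A]) (simp add: vec_eq_iff forall_2)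
      obtain c1 c2 where "constant_on_plane D W1 s v c1" "constant_on_plane E W2 s w c2"
        using const[OF s] by blast
      from constant_fields_commute[OF D(1) this(1) D(2) E(1) this(2) E(2) s _ _ p, of U f]
      show ?thesis using True y unfolding yp by blast
    qed
    then have "lie_bracket D E U f = (\<lambda>_. 0)"
      using regular_vanishes_on_dense[OF fs irreducible _ _ V(2,1)] lie_bracket_regular[OF D(1) E(1)] True by blast
    then show ?thesis by simp
  next
    case False
    then show ?thesis using lie_bracket_junk[OF D(1) E(1)] by simp
  qed
qed

lemma bracket_with_translate_zero:
  assumes orbit: "openin (top_of X) (orbit G act x\<^sub>0)"
    and D: "D \<in> vector_fields X" "openin (top_of X) W1" "W1 \<noteq> {}"
      "\<And>s. s \<in> carrier S \<Longrightarrow> \<exists>c. constant_on_plane D W1 s v c"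
    and E: "act_vfield G X act g E \<in> vector_fields X" "openin (top_of X) W2" "W2 \<noteq> {}"
      "\<And>s. s \<in> carrier S \<Longrightarrow> \<exists>c. constant_on_plane E W2 s w c"
    and g: "g \<in> carrier G"
  shows "lie_bracket D (act_vfield G X act g E) = 0"
proof -
  obtain A t where "g = (A, t)" by force
  then have g': "g = (cj (uncj A), t)" and A: "det (uncj A) = 1" and t: "t \<in> carrier S"
    using g by (simp_all add: carrier_SL2)
  let ?W = "{x \<in> points X. act (inv\<^bsub>G\<^esub> g) x \<in> W2}"
  have o: "openin (top_of X) ?W"
    by (rule morphism_preimage_open[OF morphism_act[OF G.inv_closed[OF g]] E(2)])
  have ne: "?W \<noteq> {}"
  proof -
    obtain y where y: "y \<in> W2" using E(3) by blast
    then have "y \<in> points X" using openin_subset[OF E(2)] by blast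
    then have "act g y \<in> ?W" using y act_inv(1)[OF g] act_points[OF g] by simp
    then show ?thesis by blast
  qed
  have c: "\<exists>c. constant_on_plane (act_vfield G X act g E) ?W s (uncj A *v w) c" if s: "s \<in> carrier S" for s
  proof -
    have "inv\<^bsub>S\<^esub> t \<otimes>\<^bsub>S\<^esub> s \<in> carrier S" using s t by simp
    then obtain c where "constant_on_plane E W2 (inv\<^bsub>S\<^esub> t \<otimes>\<^bsub>S\<^esub> s) w c" using E(4) by blast
    from constant_on_plane_translate[OF this A s t] show ?thesis unfolding g' by blast
  qed
  show ?thesis
    by (rule constant_fields_bracket_zero[OF orbit D(1-3) E(1) o ne D(4) c])
qed

text \<open>The elements of \<open>K2\<close> all of whose translates commute with \<open>D\<close> form a submodule containing \<open>E\<close>, so this is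
\<open>K2\<close>. Then the elements of \<open>K1\<close> that commute with all of \<open>K2\<close> form a subspace, which is a submodule since
\<open>[g A, B] = g [A, g\<^sup>-\<^sup>1 B]\<close>; it contains \<open>D\<close>, so it is \<open>K1\<close>.\<close>

lemma simple_submodules_commute:
  assumes K1: "simple_G_submodule G X act K1" and K2: "simple_G_submodule G X act K2"
    and D: "D \<in> K1" "D \<noteq> 0" and E: "E \<in> K2" "E \<noteq> 0"
    and zero: "\<And>g. g \<in> carrier G \<Longrightarrow> lie_bracket D (act_vfield G X act g E) = 0"
  shows "bracket_span K1 K2 = {0}"
proof -
  interpret V: vector_space "vscale :: 'k \<Rightarrow> ('x, 'k) vfield \<Rightarrow> _" by (rule vector_space_vscale)
  let ?g = "act_vfield G X act"
  have sub: "K1 \<subseteq> vector_fields X" "K2 \<subseteq> vector_fields X"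
    "V.subspace K1" "V.subspace K2"
    "\<And>g A. g \<in> carrier G \<Longrightarrow> A \<in> K1 \<Longrightarrow> ?g g A \<in> K1" "\<And>g A. g \<in> carrier G \<Longrightarrow> A \<in> K2 \<Longrightarrow> ?g g A \<in> K2"
    using K1 K2 by (auto simp: simple_G_submodule_def G_submodule_def)
  have simple: "L = K" if "simple_G_submodule G X act K" "G_submodule G X act L" "L \<subseteq> K" "A \<in> L" "A \<noteq> 0" for L K A
    using that unfolding simple_G_submodule_def by blast
  have zero_bracket: "lie_bracket A 0 = 0" "lie_bracket 0 A = 0" if "A \<in> vector_fields X" for A
    using vfield_zero[OF that] by (auto simp: lie_bracket_def fun_eq_iff zero_fun_def)
  have add_bracket: "lie_bracket A (B + B') = lie_bracket A B + lie_bracket A B'"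
    if "A \<in> vector_fields X" "B \<in> vector_fields X" "B' \<in> vector_fields X" for A B B'
  proof (intro ext)
    fix U f x
    show "lie_bracket A (B + B') U f x = (lie_bracket A B + lie_bracket A B') U f x"
    proof (cases "openin (top_of X) U \<and> f \<in> regular X U")
      case True
      then show ?thesis
        using vfield_add[OF that(1), of U "B U f" "B' U f"] vfield_regular[OF that(2)] vfield_regular[OF that(3)]
        by (simp add: lie_bracket_def plus_fun_def)
    next
      case False
      then show ?thesis
        using vfield_junk[OF that(1)] vfield_junk[OF that(2)] vfield_junk[OF that(3)]
          vfield_zero[OF that(1)] vfield_zero[OF that(2)] vfield_zero[OF that(3)]
        by (simp add: lie_bracket_def plus_fun_def)
    qed
  qed
  have scale_bracket: "lie_bracket A (vscale c B) = vscale c (lie_bracket A B)"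
    if "A \<in> vector_fields X" "B \<in> vector_fields X" for A B c
  proof (intro ext)
    fix U f x
    show "lie_bracket A (vscale c B) U f x = vscale c (lie_bracket A B) U f x"
    proof (cases "openin (top_of X) U \<and> f \<in> regular X U")
      case True
      then show ?thesis
        using vfield_scale[OF that(1), of U "B U f" c] vfield_regular[OF that(2)]
        by (simp add: lie_bracket_def vscale_def right_diff_distrib)
    next
      case False
      then show ?thesis
        using vfield_junk[OF that(1)] vfield_junk[OF that(2)] vfield_zero[OF that(1)] vfield_zero[OF that(2)]
        by (simp add: lie_bracket_def vscale_def)
    qed
  qed
  have anti: "lie_bracket A B = - lie_bracket B A" for A B :: "('x, 'k) vfield"
    by (auto simp: lie_bracket_def fun_eq_iff)
  have add_left: "lie_bracket (B + B') A = lie_bracket B A + lie_bracket B' A"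
    if "A \<in> vector_fields X" "B \<in> vector_fields X" "B' \<in> vector_fields X" for A B B'
    using add_bracket[OF that] anti[of "B + B'" A] anti[of B A] anti[of B' A] by simp
  have scale_left: "lie_bracket (vscale c B) A = vscale c (lie_bracket B A)"
    if "A \<in> vector_fields X" "B \<in> vector_fields X" for A B c
    using scale_bracket[OF that] anti[of "vscale c B" A] anti[of B A] V.scale_minus_right by simp
  have lin: "?g g 0 = 0" "?g g (A + B) = ?g g A + ?g g B" "?g g (vscale c A) = vscale c (?g g A)"
    for g c and A B :: "('x, 'k) vfield"
    by (auto simp: act_vfield_def vscale_def fun_eq_iff)
  define L2 where "L2 = {B \<in> K2. \<forall>g\<in>carrier G. lie_bracket D (?g g B) = 0}"
  have "G_submodule G X act L2"
    unfolding G_submodule_def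
  proof (intro conjI ballI)
    show "L2 \<subseteq> vector_fields X" using sub by (auto simp: L2_def)
    have "D \<in> vector_fields X" using D sub by blast
    then show "V.subspace L2"
      unfolding V.subspace_def L2_def
      using sub(4,6) V.subspace_0[OF sub(4)] V.subspace_add[OF sub(4)] V.subspace_scale[OF sub(4)]
      by (auto simp: lin zero_bracket add_bracket scale_bracket subsetD[OF sub(2)])
    fix g B assume g: "g \<in> carrier G" and B: "B \<in> L2"
    then have "lie_bracket D (?g h (?g g B)) = 0" if "h \<in> carrier G" for h
      using act_vfield_mult[OF that g, of B] G.m_closed[OF that g] by (auto simp only: L2_def mem_Collect_eq)
    then show "?g g B \<in> L2" using g B sub(6) by (auto simp only: L2_def mem_Collect_eq)
  qed
  moreover have "E \<in> L2" "L2 \<subseteq> K2" using E zero by (auto simp: L2_def)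
  ultimately have "L2 = K2" using simple[OF K2 _ _ _ E(2)] by blast
  then have DK2: "lie_bracket D B = 0" if "B \<in> K2" for B
  proof -
    have "lie_bracket D (?g \<one>\<^bsub>G\<^esub> B) = 0"
      using that \<open>L2 = K2\<close> G.one_closed unfolding L2_def by blast
    then show ?thesis using act_vfield_one[of B] that sub(2) by (simp add: subsetD del: one_DirProd)
  qed
  define L1 where "L1 = {A \<in> K1. \<forall>B\<in>K2. lie_bracket A B = 0}"
  have "G_submodule G X act L1"
    unfolding G_submodule_def
  proof (intro conjI ballI)
    show "L1 \<subseteq> vector_fields X" using sub by (auto simp: L1_def)
    show "V.subspace L1"
      unfolding V.subspace_def L1_def
      using V.subspace_0[OF sub(3)] V.subspace_add[OF sub(3)] V.subspace_scale[OF sub(3)]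
      by (auto simp: zero_bracket add_left scale_left subsetD[OF sub(1)] subsetD[OF sub(2)])
    fix g A assume g: "g \<in> carrier G" and A: "A \<in> L1"
    have "lie_bracket (?g g A) B = 0" if B: "B \<in> K2" for B
    proof -
      let ?B = "?g (inv\<^bsub>G\<^esub> g) B"
      have B': "?B \<in> K2" using sub(6) B g by (simp only: G.inv_closed)
      have eq: "B = ?g g ?B"
        using act_vfield_mult[OF g G.inv_closed[OF g], of B] act_vfield_one[of B] sub(2) B g
        by (simp only: G.r_inv) (simp add: subsetD)
      have A': "A \<in> K1" "lie_bracket A ?B = 0" using A B' by (simp_all add: L1_def)
      have "?g g ?B \<in> K2" using B eq[symmetric] by simp
      then have "lie_bracket (?g g A) (?g g ?B) = ?g g (lie_bracket A ?B)"
        by (intro act_vfield_bracket g subsetD[OF sub(1)] subsetD[OF sub(2)] A' B' sub(5))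
      then show ?thesis using eq[symmetric] A'(2) by (simp add: lin(1))
    qed
    then show "?g g A \<in> L1" using g A sub(5) by (simp add: L1_def)
  qed
  moreover have "D \<in> L1" "L1 \<subseteq> K1" using D DK2 by (auto simp: L1_def)
  ultimately have "L1 = K1" using simple[OF K1 _ _ _ D(2)] by blast
  then have "{lie_bracket A B | A B. A \<in> K1 \<and> B \<in> K2} \<subseteq> {0}" unfolding L1_def by blast
  then have "V.span {lie_bracket A B | A B. A \<in> K1 \<and> B \<in> K2} \<subseteq> {0}"
    by (rule V.span_minimal) (rule V.subspace_single_0)
  then show ?thesis unfolding bracket_span_def using V.span_zero by blast
qed

end

theorem proposition6:
  fixes S :: "'s monoid"
    and VS :: "('s, 'k::{alg_closed_field, field_char_0}) fspace"
    and G :: "(('k^2^2) \<times> 's) monoid"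
    and VG :: "(('k^2^2) \<times> 's, 'k) fspace"
    and B Bm T U Um :: "(('k^2^2) \<times> 's) set"
    and \<alpha> \<mu>\<^sub>1 \<mu>\<^sub>2 :: "('k^2^2) \<times> 's \<Rightarrow> 'k"
    and u \<alpha>\<^sub>v :: "'k \<Rightarrow> ('k^2^2) \<times> 's"
    and X :: "('x, 'k) fspace"
    and act :: "('k^2^2) \<times> 's \<Rightarrow> 'x \<Rightarrow> 'x"
    and x\<^sub>0 :: 'x
    and Z :: "'x set"
    and K\<^sub>1 K\<^sub>2 :: "('x, 'k) vfield set"
  assumes "torus S VS"
    and "G = SL2 \<times>\<times> S" and "VG = prod_space SL2_var VS"
    and "borel_subgroup G VG B"
    and "maximal_torus G VG T" and "T \<subseteq> B"
    and "borel_subgroup G VG Bm" and "B \<inter> Bm = T"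
    and "unipotent_radical S VS B U" and "unipotent_radical S VS Bm Um"
    and "root_parametrization G VG T U \<alpha> u"
    and "coroot G VG T \<alpha> \<alpha>\<^sub>v"
    and "horospherical S VS X act" and "complete_variety X"
    and "\<exists>A\<in>carrier SL2. \<exists>x\<in>points X. act (A, \<one>\<^bsub>S\<^esub>) x \<noteq> x"
    and "x\<^sub>0 \<in> points X" and "openin (top_of X) (orbit G act x\<^sub>0)"
    and "\<forall>v\<in>Um. act v x\<^sub>0 = x\<^sub>0"
    and "Z = canonical_section G B T X act x\<^sub>0"
    and "\<exists>\<gamma>\<in>weights_of G VG T X act Z. \<forall>t\<in>T. \<mu>\<^sub>1 t = \<alpha> t * \<gamma> t"
    and "\<exists>\<gamma>\<in>weights_of G VG T X act Z. \<forall>t\<in>T. \<mu>\<^sub>2 t = \<alpha> t * \<gamma> t"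
    and "has_pairing \<alpha>\<^sub>v \<mu>\<^sub>1 1" and "has_pairing \<alpha>\<^sub>v \<mu>\<^sub>2 1"
    and "is_module_K G T U X act x\<^sub>0 \<alpha> u \<mu>\<^sub>1 K\<^sub>1"
    and "is_module_K G T U X act x\<^sub>0 \<alpha> u \<mu>\<^sub>2 K\<^sub>2"
  shows "bracket_span K\<^sub>1 K\<^sub>2 = {0}"
proof -
  note G = assms(2) and VG = assms(3)
  interpret L: sl2_times_torus S VS by unfold_locales (rule assms(1))
  have U: "connected_normal_unipotent S VS B U" using assms(9) by (simp add: unipotent_radical_def)
  then have uU: "unipotent_subgroup S VS U" by (simp add: connected_normal_unipotent_def)
  have "subgroup U (restrict_group (SL2 \<times>\<times> S) B)"
    using U unfolding connected_normal_unipotent_def by (metis normal_imp_subgroup)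
  then have UB: "U \<subseteq> B" using subgroup.subset by fastforce
  have T: "closed_subgroup G VG T" "torus (restrict_group G T) (subspace_on VG T)"
    using assms(5) by (simp_all add: maximal_torus_def subtorus_def)
  then have TG: "T \<subseteq> carrier G" using subgroup.subset unfolding closed_subgroup_def by blast
  obtain C Ci where C: "C ** Ci = mat 1" "Ci ** C = mat 1"
    and u': "\<And>a. u a = (C ** mat2 1 a 0 1 ** Ci, \<one>\<^bsub>S\<^esub>)"
    and av': "\<And>c. c \<noteq> 0 \<Longrightarrow> \<alpha>\<^sub>v c = (C ** mat2 c 0 0 (1 / c) ** Ci, \<one>\<^bsub>S\<^esub>)"
    using L.root_subgroup_normal_form[OF uU assms(11,12)[unfolded G VG] TG[unfolded G]] by blast
  interpret L: adapted_basis S VS C Ci by unfold_locales (rule C)+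
  note u = u'[folded L.cj_def] and av = av'[folded L.cj_def]
  have u_in: "u a \<in> U" for a
    using assms(11) by (auto simp: root_parametrization_def alg_group_iso_def iso_def hom_def Ga_def)
  have av_in: "\<alpha>\<^sub>v c \<in> T" if "c \<noteq> 0" for c
    using assms(12) that by (auto simp: coroot_def cocharacter_def hom_def Gm_def)
  have tor: "(L.cj (mat2 c 0 0 (1 / c)), \<one>\<^bsub>S\<^esub>) \<in> T" if "c \<noteq> 0" for c
    using av_in[OF that] av[OF that] by simp
  have up: "(L.cj (mat2 1 b 0 1), \<one>\<^bsub>S\<^esub>) \<in> U" for b
    using u_in[of b] u[of b] by simp
  have "L.lower_unipotent \<subseteq> Um"
    by (rule L.lower_unipotent_in_opposite_radical[OF tor _ T(2)[unfolded G] assms(7)[unfolded G VG] assms(8,10)])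
       (use up UB in auto)
  then have fixed: "act (L.cj (mat2 1 0 b 1), \<one>\<^bsub>S\<^esub>) x\<^sub>0 = x\<^sub>0" for b
    using assms(18) unfolding L.lower_unipotent_def by blast
  interpret L: adapted_orbit S VS C Ci X act x\<^sub>0
    by unfold_locales (use assms(13,16) fixed in \<open>simp_all add: horospherical_def\<close>)
  have \<xi>: "\<mu> (L.cj (mat2 c 0 0 (1 / c)), \<one>\<^bsub>S\<^esub>) / \<alpha> (L.cj (mat2 c 0 0 (1 / c)), \<one>\<^bsub>S\<^esub>) = 1 / c"
    if \<mu>: "has_pairing \<alpha>\<^sub>v \<mu> 1" and c: "c \<noteq> 0" for \<mu> c
    using \<mu> assms(12) c av[OF c, symmetric] by (simp add: has_pairing_def coroot_def power2_eq_square)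
  have highest: "\<exists>W D. openin (top_of X) W \<and> W \<noteq> {} \<and> D \<in> K \<and> D \<noteq> 0 \<and>
      (\<forall>s\<in>carrier S. \<exists>c. L.constant_on_plane D W s (vec2 1 0) c)"
    if K: "is_module_K G T U X act x\<^sub>0 \<alpha> u \<mu> K" and \<mu>: "has_pairing \<alpha>\<^sub>v \<mu> 1" for \<mu> K
  proof -
    obtain W f D where W: "rational_semiinvariant G T U X act (\<lambda>t. \<mu> t / \<alpha> t) W f"
      "rational_multiple X W f (infinitesimal_action G X act u) D" "D \<in> K" "highest_weight_vector G T U X act \<mu> D"
      using K unfolding is_module_K_def by blast
    have "\<exists>c. L.constant_on_plane D W s (vec2 1 0) c" if "s \<in> carrier S" for s
      by (rule L.highest_weight_constant_on_plane[OF u W(1)[unfolded G] that tor \<xi>[OF \<mu>] up W(2)[unfolded G]])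
    then show ?thesis
      using W by (intro exI[of _ W] exI[of _ D]) (simp add: rational_semiinvariant_def highest_weight_vector_def)
  qed
  have K: "simple_G_submodule (SL2 \<times>\<times> S) X act K\<^sub>1" "simple_G_submodule (SL2 \<times>\<times> S) X act K\<^sub>2"
    using assms(24,25) by (simp_all add: is_module_K_def G)
  obtain W1 D where D: "openin (top_of X) W1" "W1 \<noteq> {}" "D \<in> K\<^sub>1" "D \<noteq> 0"
      "\<And>s. s \<in> carrier S \<Longrightarrow> \<exists>c. L.constant_on_plane D W1 s (vec2 1 0) c"
    using highest[OF assms(24,22)] by blast
  obtain W2 E where E: "openin (top_of X) W2" "W2 \<noteq> {}" "E \<in> K\<^sub>2" "E \<noteq> 0"
      "\<And>s. s \<in> carrier S \<Longrightarrow> \<exists>c. L.constant_on_plane E W2 s (vec2 1 0) c"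
    using highest[OF assms(25,23)] by blast
  show ?thesis
  proof (rule L.simple_submodules_commute[OF K D(3,4) E(3,4)])
    fix g :: "('k^2^2) \<times> 's" assume g: "g \<in> carrier (SL2 \<times>\<times> S)"
    have sub: "G_submodule (SL2 \<times>\<times> S) X act K\<^sub>1" "G_submodule (SL2 \<times>\<times> S) X act K\<^sub>2"
      using K unfolding simple_G_submodule_def by blast+
    have DX: "D \<in> vector_fields X" using sub(1) D(3) unfolding G_submodule_def by blast
    have EX: "act_vfield (SL2 \<times>\<times> S) X act g E \<in> vector_fields X"
      using sub(2) E(3) g unfolding G_submodule_def by (meson subsetD)
    show "lie_bracket D (act_vfield (SL2 \<times>\<times> S) X act g E) = 0"
      by (rule L.bracket_with_translate_zero[OF assms(17)[unfolded G] DX D(1,2,5) EX E(1,2,5) g])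
  qed
qed

end
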